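(* Let the spaces $H,V$ and the operators $A$, $A_{\rm rc}$, $B$, $W$, $K$, $L$ satisfy the standing assumptions listed in the context (in particular, $-A-A_{\rm rc}+BK$ is $(D_1,\mu_1)$-stable with $D_1\ge1$, $\mu_1>0$, and $-A-A_{\rm rc}+LW$ is $(C,0)$-stable for some $C\ge1$). Let $\tau>0$. Then there exist constants $C_1\ge1$ and $C_2\ge0$, where $C_1$ depends only on $(D_1,C_{\rm rc},\tau,\mu_1)$ and $C_2$ depends only on $(C_{\rm rc},\tau,D_1\mu_1^{-1},\|BK\|_{\mathcal L(H)})$ (the triple $(H,V,A)$ being fixed), such that for all $y_0,\widehat y_0\in H$ the solution $(y,\widehat y)$ of the coupled closed-loop system $$\begin{aligned} &\dot y+Ay+A_{\rm rc}y=B\widehat u_\tau(t-\tau),\quad t>0,&& y(0)=y_0,\\ &\dot{\widehat y}+A\widehat y+A_{\rm rc}\widehat y=B\widehat u_\tau(t-\tau)+L(W\widehat y-Wy),\quad t>0,&& \widehat y(0)=\widehat y_0, \end{aligned}$$ with the predictor- and state-estimate-based input $$\widehat u_\tau(t)=0\ \text{ for } t\in[-\tau,0),\qquad \widehat u_\tau(t)=K\,\mathfrak Y\bigl(t,t+\tau,\widehat u_\tau^{[\tau]};\widehat y(t)\bigr)\ \text{ for } t\ge0,$$ satisfies $$|y(t)|_H\le C_1 e^{-\mu_1(t-s)}|y(s)|_H+C_2\,\bigl|\mathfrak E_0(\widehat y-y)\bigr|_{L^\infty((s-\tau,t-\tau);H)}\qquad\text{for all } t\ge s\ge0.$$ Furthermore,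 $\widehat u_\tau\in L^\infty(\mathbb R_+,\mathbb R^m)\cap C([0,\infty),\mathbb R^m)$.
   Context: Standing setting. $H$ and $V$ are real separable Hilbert spaces, $H$ is the pivot space ($H=H'$), and $|\cdot|_X$ denotes the norm of $X$. (1) The inclusion $V\subseteq H$ is dense, continuous and compact. (2) $A\in\mathcal L(V,V')$ is symmetric and $(y,z)\mapsto\langle Ay,z\rangle_{V',V}$ is a complete scalar product on $V$; $V$ is endowed with this scalar product. (3) $A_{\rm rc}\in C([0,\infty),\mathcal L(V,H)+\mathcal L(H,V'))$ and $C_{\rm rc}:=\sup_{t\ge0}\|A_{\rm rc}(t)\|_{\mathcal L(V,H)+\mathcal L(H,V')}<\infty$. Control and output operators: $B:\mathbb R^m\to H$, $Bu=\sum_{i=1}^m u_i\Phi_i$ with given $\Phi_i\in H$; $W\in\mathcal L(H,\mathbb R^s)$ (in the symbol $\mathbb R^s$ the letter $s$ denotes the number of sensors; elsewhere $s$ denotes a time). Stability: for $D\ge1$, $\mu\ge0$, a (time-dependent) operator $\mathcal A=\mathcal A(t)\in\mathcal L(V,V')$ is called $(D,\mu)$-stable if for all $z_0\in H$ the solution of $\dot z=\mathcal A z$, $z(0)=z_0$, satisfies $|z(t)|_H\le De^{-\mu(t-s)}|z(s)|_H$ for all $t\ge s\ge0$. (4) $K\in\mathcal L(H,\mathbb R^m)$ is such that $-A-A_{\rm rc}+BK$ is $(D_1,\mu_1)$-stable, for some $D_1\ge1$ and $\mu_1>0$. (5) $L\in\mathcal L(\mathbb R^s,H)$ is such that $-A-A_{\rm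 rc}+LW$ is $(C,0)$-stable for some $C\ge1$. Notation. $g^{[\tau]}(t):=g(t-\tau)$. For $t\ge t_0\geq 0$, $\mathfrak Y(t_0,t,f;\mathfrak y)$ denotes the value $Y(t)$ at time $t$ of the solution of $\dot Y+AY+A_{\rm rc}Y=Bf$ on $(t_0,t)$ with $Y(t_0)=\mathfrak y\in H$. Thus $\mathfrak Y(t,t+\tau,\widehat u_\tau^{[\tau]};\widehat y(t))$ uses only the values of $\widehat u_\tau$ on $(t-\tau,t)$ and of $\widehat y$ at time $t$. $\mathfrak E_0$ is extension by zero: $\mathfrak E_0f(t)=0$ for $t\in(-\tau,0)$ and $\mathfrak E_0f(t)=f(t)$ for $t>0$. Solutions are understood in the usual weak (variational) sense, with $y\in L^2_{\rm loc}(\mathbb R_+;V)$, $\dot y\in L^2_{\rm loc}(\mathbb R_+;V')$, so that $y\in C([0,\infty);H)$. *)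

theory Defs
  imports "HOL-Analysis.Analysis" "HOL-Probability.Essential_Supremum"
begin

text \<open>The inclusion of \<open>V\<close> in \<open>H\<close> is an explicit operator \<open>j\<close> between two types, and \<open>V'\<close> is the
  type of bounded linear functionals on \<open>V\<close>. Identifying \<open>H\<close> with \<open>H'\<close> makes \<open>h\<close> the functional
  that maps \<open>v\<close> to \<open>h \<bullet> j v\<close>.\<close>

definition pivot_dual :: "('v::real_inner \<Rightarrow>\<^sub>L 'h::real_inner) \<Rightarrow> 'h \<Rightarrow> ('v \<Rightarrow>\<^sub>L real)" where
  "pivot_dual j h = blinfun_inner_right h o\<^sub>L j"

definition dense_compact_inclusion :: "('v::real_inner \<Rightarrow>\<^sub>L 'h::real_inner) \<Rightarrow> bool" where
  "dense_compact_inclusion j \<longleftrightarrow>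
     inj (blinfun_apply j) \<and> closure (range (blinfun_apply j)) = UNIV \<and>
     (\<forall>S. bounded S \<longrightarrow> compact (closure (blinfun_apply j ` S)))"

text \<open>\<open>V\<close> is endowed with the scalar product that \<open>A\<close> induces. Symmetry and definiteness
  of \<open>A\<close> are thus those of the inner product of the type \<open>'v\<close>, and completeness is required by its
  type class.\<close>

definition scalar_product_operator ::
    "('v::real_inner \<Rightarrow>\<^sub>L ('v \<Rightarrow>\<^sub>L real)) \<Rightarrow> bool" where
  "scalar_product_operator A \<longleftrightarrow> (\<forall>y z. blinfun_apply (blinfun_apply A y) z = y \<bullet> z)"


text \<open>The sum \<open>L(V,H) + L(H,V')\<close>, as a subspace of \<open>L(V,V')\<close>, with the usual norm of a sum of
  Banach spaces. The infimum is meaningful only on elements of the sum.\<close>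

definition sum_split ::
    "('v::real_inner \<Rightarrow>\<^sub>L 'h::real_inner) \<Rightarrow> ('v \<Rightarrow>\<^sub>L ('v \<Rightarrow>\<^sub>L real))
      \<Rightarrow> ('v \<Rightarrow>\<^sub>L 'h) \<Rightarrow> ('h \<Rightarrow>\<^sub>L ('v \<Rightarrow>\<^sub>L real)) \<Rightarrow> bool" where
  "sum_split j R P Q \<longleftrightarrow> (\<forall>v. R v = pivot_dual j (P v) + Q (j v))"

definition sum_space ::
    "('v::real_inner \<Rightarrow>\<^sub>L 'h::real_inner) \<Rightarrow> ('v \<Rightarrow>\<^sub>L ('v \<Rightarrow>\<^sub>L real)) set" where
  "sum_space j = {R. \<exists>P Q. sum_split j R P Q}"

definition sum_norm ::
    "('v::real_inner \<Rightarrow>\<^sub>L 'h::real_inner) \<Rightarrow> ('v \<Rightarrow>\<^sub>L ('v \<Rightarrow>\<^sub>L real)) \<Rightarrow> real" where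
  "sum_norm j R = Inf {norm P + norm Q | P Q. sum_split j R P Q}"

definition continuous_bounded_in_sum ::
    "('v::real_inner \<Rightarrow>\<^sub>L 'h::real_inner) \<Rightarrow> (real \<Rightarrow> ('v \<Rightarrow>\<^sub>L ('v \<Rightarrow>\<^sub>L real))) \<Rightarrow> bool" where
  "continuous_bounded_in_sum j R \<longleftrightarrow>
     (\<forall>t\<ge>0. R t \<in> sum_space j) \<and>
     (\<forall>t\<ge>0. \<forall>\<epsilon>>0. \<exists>\<delta>>0. \<forall>r\<ge>0. \<bar>r - t\<bar> < \<delta> \<longrightarrow> sum_norm j (R r - R t) < \<epsilon>) \<and>
     bdd_above ((\<lambda>t. sum_norm j (R t)) ` {0..})"

definition sup_sum_norm ::
    "('v::real_inner \<Rightarrow>\<^sub>L 'h::real_inner) \<Rightarrow> (real \<Rightarrow> ('v \<Rightarrow>\<^sub>L ('v \<Rightarrow>\<^sub>L real))) \<Rightarrow> real" where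
  "sup_sum_norm j R = (SUP t\<in>{0..}. sum_norm j (R t))"


text \<open>The constants of the theorem must not depend on the numbers of actuators and sensors, so these
  are quantified inside the formula and cannot be types. A vector of \<open>\<real>\<^sup>n\<close> is a
  function on \<open>nat\<close> that vanishes from \<open>n\<close> on; on these functions the product topology of
  \<open>nat \<Rightarrow> real\<close> is the Euclidean one.\<close>

definition Rn :: "nat \<Rightarrow> (nat \<Rightarrow> real) set" where
  "Rn n = {x. \<forall>i\<ge>n. x i = 0}"

definition Rn_norm :: "nat \<Rightarrow> (nat \<Rightarrow> real) \<Rightarrow> real" where
  "Rn_norm n x = L2_set x {..<n}"

definition bounded_linear_into_Rn :: "nat \<Rightarrow> ('h::real_normed_vector \<Rightarrow> (nat \<Rightarrow> real)) \<Rightarrow> bool" where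
  "bounded_linear_into_Rn n K \<longleftrightarrow>
     (\<forall>x. K x \<in> Rn n) \<and>
     (\<forall>x y. K (x + y) = (\<lambda>i. K x i + K y i)) \<and>
     (\<forall>c x. K (c *\<^sub>R x) = (\<lambda>i. c * K x i)) \<and>
     (\<exists>M. \<forall>x. Rn_norm n (K x) \<le> M * norm x)"

definition bounded_linear_from_Rn :: "nat \<Rightarrow> ((nat \<Rightarrow> real) \<Rightarrow> 'h::real_normed_vector) \<Rightarrow> bool" where
  "bounded_linear_from_Rn n L \<longleftrightarrow>
     (\<forall>x\<in>Rn n. \<forall>y\<in>Rn n. L (\<lambda>i. x i + y i) = L x + L y) \<and>
     (\<forall>c. \<forall>x\<in>Rn n. L (\<lambda>i. c * x i) = c *\<^sub>R L x) \<and>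
     (\<exists>M. \<forall>x\<in>Rn n. norm (L x) \<le> M * Rn_norm n x)"

definition control_operator :: "nat \<Rightarrow> (nat \<Rightarrow> 'h::real_vector) \<Rightarrow> (nat \<Rightarrow> real) \<Rightarrow> 'h" where
  "control_operator m \<Phi> u = (\<Sum>i<m. u i *\<^sub>R \<Phi> i)"


text \<open>Local square integrability is tested on the compact subintervals of \<open>J\<close>; so it is local up to
  every endpoint that belongs to \<open>J\<close>.\<close>

definition L2_loc :: "real set \<Rightarrow> (real \<Rightarrow> 'a::real_normed_vector) \<Rightarrow> bool" where
  "L2_loc J f \<longleftrightarrow>
     (\<forall>a b. {a..b} \<subseteq> J \<longrightarrow>
        f \<in> borel_measurable (lebesgue_on {a..b}) \<and>
        integrable (lebesgue_on {a..b}) (\<lambda>t. (norm (f t))\<^sup>2))"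

definition Linf_norm :: "real set \<Rightarrow> (real \<Rightarrow> 'a::real_normed_vector) \<Rightarrow> ennreal" where
  "Linf_norm J f = esssup (lebesgue_on J) (\<lambda>t. ennreal (norm (f t)))"

definition Linf_Rn :: "nat \<Rightarrow> real set \<Rightarrow> (real \<Rightarrow> (nat \<Rightarrow> real)) \<Rightarrow> bool" where
  "Linf_Rn n J u \<longleftrightarrow>
     (\<forall>i<n. (\<lambda>t. u t i) \<in> borel_measurable (lebesgue_on J)) \<and>
     Linf_norm J (\<lambda>t. Rn_norm n (u t)) < \<infinity>"

text \<open>\<open>yd\<close> is the \<open>V'\<close>-valued time derivative of \<open>y\<close>, tested against the elements of \<open>V\<close>.\<close>

definition weak_time_derivative ::
    "('v::real_inner \<Rightarrow>\<^sub>L 'h::real_inner) \<Rightarrow> real set \<Rightarrow> (real \<Rightarrow> 'h) \<Rightarrow> (real \<Rightarrow> ('v \<Rightarrow>\<^sub>L real)) \<Rightarrow> bool"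
  where
  "weak_time_derivative j J y yd \<longleftrightarrow>
     (\<forall>w a b. a \<le> b \<and> {a..b} \<subseteq> J \<longrightarrow>
        y b \<bullet> j w - y a \<bullet> j w = (LINT t|lebesgue_on {a..b}. yd t w))"

text \<open>Weak solutions on \<open>J\<close> of the equation whose time derivative is \<open>G t (y t)\<close> in \<open>V'\<close>; \<open>v\<close> is \<open>y\<close>
  regarded as a \<open>V\<close>-valued function.\<close>

definition weak_solution ::
    "('v::real_inner \<Rightarrow>\<^sub>L 'h::real_inner) \<Rightarrow> real set \<Rightarrow> (real \<Rightarrow> 'v \<Rightarrow> ('v \<Rightarrow>\<^sub>L real))
      \<Rightarrow> (real \<Rightarrow> 'h) \<Rightarrow> bool" where
  "weak_solution j J G y \<longleftrightarrow>
     continuous_on J y \<and>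
     (\<exists>v yd. L2_loc J v \<and> L2_loc J yd \<and>
        (AE t in lebesgue_on J. y t = j (v t)) \<and>
        weak_time_derivative j J y yd \<and>
        (AE t in lebesgue_on J. yd t = G t (v t)))"

definition exp_stable ::
    "('v::real_inner \<Rightarrow>\<^sub>L 'h::real_inner) \<Rightarrow> (real \<Rightarrow> 'v \<Rightarrow> ('v \<Rightarrow>\<^sub>L real)) \<Rightarrow> real \<Rightarrow> real \<Rightarrow> bool"
  where
  "exp_stable j G D \<mu> \<longleftrightarrow>
     (\<forall>z0 z. weak_solution j {0..} G z \<and> z 0 = z0 \<longrightarrow>
        (\<forall>t s. t \<ge> s \<and> s \<ge> 0 \<longrightarrow> norm (z t) \<le> D * exp (- \<mu> * (t - s)) * norm (z s)))"

text \<open>The operator \<open>-A - A\<^sub>r\<^sub>c\<close> with an additional right-hand side \<open>g\<close> in \<open>H\<close>, which may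
  depend on the state.\<close>

definition dynamics ::
    "('v::real_inner \<Rightarrow>\<^sub>L 'h::real_inner) \<Rightarrow> ('v \<Rightarrow>\<^sub>L ('v \<Rightarrow>\<^sub>L real)) \<Rightarrow> (real \<Rightarrow> ('v \<Rightarrow>\<^sub>L ('v \<Rightarrow>\<^sub>L real)))
      \<Rightarrow> (real \<Rightarrow> 'h \<Rightarrow> 'h) \<Rightarrow> real \<Rightarrow> 'v \<Rightarrow> ('v \<Rightarrow>\<^sub>L real)" where
  "dynamics j A Arc g t v = - A v - Arc t v + pivot_dual j (g t (j v))"

text \<open>\<open>p\<close> is the value at time \<open>t\<close> of the solution that starts at time \<open>t0\<close> from \<open>q\<close> with the
  input \<open>f\<close>.\<close>

definition predicted_state ::
    "('v::real_inner \<Rightarrow>\<^sub>L 'h::real_inner) \<Rightarrow> ('v \<Rightarrow>\<^sub>L ('v \<Rightarrow>\<^sub>L real)) \<Rightarrow> (real \<Rightarrow> ('v \<Rightarrow>\<^sub>L ('v \<Rightarrow>\<^sub>L real)))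
      \<Rightarrow> ((nat \<Rightarrow> real) \<Rightarrow> 'h) \<Rightarrow> real \<Rightarrow> real \<Rightarrow> (real \<Rightarrow> (nat \<Rightarrow> real)) \<Rightarrow> 'h \<Rightarrow> 'h \<Rightarrow> bool" where
  "predicted_state j A Arc B t0 t f q p \<longleftrightarrow>
     (\<exists>Y. weak_solution j {t0..t} (dynamics j A Arc (\<lambda>r _. B (f r))) Y \<and> Y t0 = q \<and> Y t = p)"

text \<open>A triple (state, estimate, input) that solves the coupled system. The input is required to be
  locally square integrable, so that the right-hand sides belong to the class of weak solutions.\<close>

definition closed_loop_solution ::
    "('v::real_inner \<Rightarrow>\<^sub>L 'h::real_inner) \<Rightarrow> ('v \<Rightarrow>\<^sub>L ('v \<Rightarrow>\<^sub>L real)) \<Rightarrow> (real \<Rightarrow> ('v \<Rightarrow>\<^sub>L ('v \<Rightarrow>\<^sub>L real)))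
      \<Rightarrow> nat \<Rightarrow> ((nat \<Rightarrow> real) \<Rightarrow> 'h) \<Rightarrow> ('h \<Rightarrow> (nat \<Rightarrow> real)) \<Rightarrow> ('h \<Rightarrow> (nat \<Rightarrow> real))
      \<Rightarrow> ((nat \<Rightarrow> real) \<Rightarrow> 'h) \<Rightarrow> real \<Rightarrow> 'h \<Rightarrow> 'h
      \<Rightarrow> (real \<Rightarrow> 'h) \<Rightarrow> (real \<Rightarrow> 'h) \<Rightarrow> (real \<Rightarrow> (nat \<Rightarrow> real)) \<Rightarrow> bool" where
  "closed_loop_solution j A Arc m B W K L \<tau> y0 yh0 y yh u \<longleftrightarrow>
     (\<forall>i<m. L2_loc {-\<tau>..} (\<lambda>t. u t i)) \<and>
     weak_solution j {0..} (dynamics j A Arc (\<lambda>t _. B (u (t - \<tau>)))) y \<and> y 0 = y0 \<and>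
     weak_solution j {0..}
       (dynamics j A Arc (\<lambda>t x. B (u (t - \<tau>)) + L (\<lambda>i. W x i - W (y t) i))) yh \<and> yh 0 = yh0 \<and>
     (\<forall>t\<in>{-\<tau>..<0}. u t = (\<lambda>i. 0)) \<and>
     (\<forall>t\<ge>0. \<exists>p. predicted_state j A Arc B t (t + \<tau>) (\<lambda>r. u (r - \<tau>)) (yh t) p \<and> u t = K p)"

text \<open>Extension by zero to negative times; the value at the single time \<open>0\<close> does not matter.\<close>

definition extend_by_zero :: "(real \<Rightarrow> 'a::zero) \<Rightarrow> real \<Rightarrow> 'a" where
  "extend_by_zero f t = (if t > 0 then f t else 0)"

end

theory Submission
  imports Defs
begin

text \<open>The theorem rests on one reduction. The predictor integrates the plant equation from the
  estimate \<open>yh t\<close> with the very input that the plant will receive, so predicted and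
  true state differ at time \<open>t + \<tau>\<close> by the free evolution of the estimation error
  over a time \<open>\<tau>\<close>. Hence, from time \<open>\<tau>\<close> on, the delayed input is
  \<open>K\<close> applied to the true current state plus a prediction error, and the plant obeys
  the undelayed system with operator -A - Arc + BK, forced by
  \<open>BK (pred_err h (t - \<tau>))\<close>. The estimation error solves the homogeneous equation
  with operator -A - Arc + LW whatever the input is; so it is known in advance and bounded by
  (C,0)-stability. The loop can therefore be solved explicitly: free plant on [0, \<tau>], then a
  linear equation with known forcing (\<open>closed_loopD\<close>,
  \<open>closed_loop_exists\<close>).

  The estimate combines three bounds. The energy inequality gives growth rate Crc^2 for the free
  evolution; this yields the factor exp(Crc^2 \<tau>) from estimation error to prediction error and
  the loss exp((Crc^2 + \<mu>) \<tau>) on the initial interval where no input acts. Afterwards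
  variation of constants in the (D, \<mu>)-stable system contributes a multiple of D / \<mu> times
  the bound on the forcing (\<open>duhamel_bound\<close>, \<open>state_estimate\<close>).

  Variation of constants requires decay for data prescribed at an arbitrary time, whereas stability
  is a statement about solutions that start at time 0. The gap closes because the states reachable
  at time r from time 0 are dense. By duality this density is backward uniqueness for the adjoint
  equation, which follows from a Carleman estimate with a convex weight
  (\<open>backward_uniqueness_local\<close>, \<open>dense_range_flow\<close>,
  \<open>stable_flow\<close>).

  The parabolic theory underneath is built from one device. Since V carries the scalar product of A,
  the Riesz map from V' to V is the inverse of A; applying it turns the equation into (jstar y)' = -
  v - riesz (R v) + jstar f between V-valued functions. Regularisation with the resolvents N l = (1
  + l S)^-1, where S is the inverse of A on V, gives the energy identity
  (\<open>energy_identity\<close>), hence bounds and uniqueness. Existence comes from smooth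
  approximate solutions with residual 4^-k whose lower-order term is evaluated at the previous
  iterate; in an exponentially weighted energy norm this iteration contracts
  (\<open>contraction_step\<close>, \<open>esol_exists\<close>).\<close>

section \<open>Orthogonal projection and Riesz representation\<close>

lemma nonneg_quadratic_linear_coeff:
  fixes a b :: real
  assumes "\<And>t. 0 \<le> b * t\<^sup>2 - 2 * a * t"
  shows "a = 0"
proof (rule ccontr)
  assume a: "a \<noteq> 0"
  have b: "b \<ge> 0"
  proof (rule ccontr)
    assume "\<not> b \<ge> 0"
    then show False
      using assms[of 1] assms[of "-1"] by simp
  qed
  \<comment> \<open>The point \<open>a / (b + 1)\<close> is meaningful also for
    \<open>b = 0\<close>, and at it the polynomial equals \<open>- (b + 2)\<close> times a
    square.\<close>
  have "0 \<le> b * (a / (b + 1))\<^sup>2 - 2 * a * (a / (b + 1))"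
    using assms by blast
  also have "\<dots> = (a / (b + 1))\<^sup>2 * (b - 2 * (b + 1))"
  proof -
    define q where "q = a / (b + 1)"
    have "a = q * (b + 1)" using b by (simp add: q_def)
    then show ?thesis unfolding q_def[symmetric] by (simp add: power2_eq_square algebra_simps)
  qed
  also have "\<dots> < 0"
    using a b by (intro mult_pos_neg) auto
  finally show False by simp
qed

text \<open>A sequence in \<open>M\<close> that minimises the distance to \<open>x\<close> is Cauchy
  by the parallelogram law, because midpoints stay in \<open>M\<close>. Minimality along each line
  through the limit forces orthogonality.\<close>

lemma orthogonal_projection_exists:
  fixes M :: "'a::{real_inner,banach} set"
  assumes M: "subspace M" "closed M"
  shows "\<exists>p\<in>M. \<forall>m\<in>M. (x - p) \<bullet> m = 0"
proof -
  define D where "D = (\<lambda>m. (norm (x - m))\<^sup>2) ` M"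
  define d where "d = Inf D"
  have D0: "D \<noteq> {}" "bdd_below D"
    using M(1) subspace_0 by (auto simp: D_def intro!: bdd_belowI[of _ 0])
  have d_le: "d \<le> (norm (x - m))\<^sup>2" if "m \<in> M" for m
    using D0 that by (auto simp: d_def D_def intro!: cInf_lower)
  have "\<exists>m\<in>M. (norm (x - m))\<^sup>2 < d + 1 / Suc n" for n
  proof -
    have "\<exists>r\<in>D. r < d + 1 / Suc n"
      using D0(1) unfolding d_def by (intro cInf_lessD) auto
    then show ?thesis by (auto simp: D_def)
  qed
  then obtain p where p: "\<And>n. p n \<in> M" "\<And>n. (norm (x - p n))\<^sup>2 < d + 1 / Suc n"
    by metis
  have near: "(norm (p n - p m))\<^sup>2 \<le> 2 / Suc n + 2 / Suc m" for n m
  proof -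
    have "(1/2) *\<^sub>R (p n + p m) \<in> M"
      using M(1) p(1) by (intro subspace_scale subspace_add)
    then have "d \<le> (norm (x - (1/2) *\<^sub>R (p n + p m)))\<^sup>2"
      by (rule d_le)
    moreover have "(norm (p n - p m))\<^sup>2 = 2 * (norm (x - p n))\<^sup>2 + 2 * (norm (x - p m))\<^sup>2
        - 4 * (norm (x - (1/2) *\<^sub>R (p n + p m)))\<^sup>2"
      by (simp add: power2_norm_eq_inner inner_diff inner_add inner_commute algebra_simps)
    ultimately show ?thesis
      using p(2)[of n] p(2)[of m] by simp
  qed
  have "Cauchy p"
  proof (rule metric_CauchyI)
    fix e :: real assume e: "e > 0"
    then obtain N where N: "4 / e\<^sup>2 < Suc N"
      by (metis reals_Archimedean2 less_trans of_nat_less_iff lessI)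
    have "dist (p n) (p m) < e" if "n \<ge> N" "m \<ge> N" for n m
    proof -
      have "2 / Suc n \<le> 2 / Suc N" "2 / Suc m \<le> 2 / Suc N"
        using that by (auto intro!: divide_left_mono)
      then have "(norm (p n - p m))\<^sup>2 \<le> 4 / Suc N"
        using near[of n m] by simp
      also have "\<dots> < e\<^sup>2"
        using N e by (simp add: field_simps)
      finally show ?thesis
        using e by (simp add: dist_norm power2_less_imp_less)
    qed
    then show "\<exists>N. \<forall>n\<ge>N. \<forall>m\<ge>N. dist (p n) (p m) < e" by blast
  qed
  then obtain l where l: "p \<longlonglongrightarrow> l"
    using Cauchy_convergent convergent_def by blast
  have lM: "l \<in> M"
    using M(2) p(1) l closed_sequentially by blast
  have "(\<lambda>n. (norm (x - p n))\<^sup>2) \<longlonglongrightarrow> (norm (x - l))\<^sup>2"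
    by (intro tendsto_intros l)
  moreover have "(\<lambda>n. d + 1 / Suc n) \<longlonglongrightarrow> d + 0"
    using LIMSEQ_inverse_real_of_nat by (intro tendsto_intros) (simp add: inverse_eq_divide)
  ultimately have ld: "(norm (x - l))\<^sup>2 \<le> d"
    using p(2) by (intro LIMSEQ_le[of _ _ "\<lambda>n. d + 1 / Suc n"]) (auto intro: less_imp_le exI[of _ 0])
  have "(x - l) \<bullet> m = 0" if m: "m \<in> M" for m
  proof (rule nonneg_quadratic_linear_coeff[of "(norm m)\<^sup>2"])
    fix t :: real
    have "l + t *\<^sub>R m \<in> M"
      using M(1) lM m by (intro subspace_add subspace_scale)
    then have "(norm (x - l))\<^sup>2 \<le> (norm (x - (l + t *\<^sub>R m)))\<^sup>2"
      using ld d_le order_trans by blast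
    also have "\<dots> = (norm (x - l))\<^sup>2 + ((norm m)\<^sup>2 * t\<^sup>2 - 2 * ((x - l) \<bullet> m) * t)"
      unfolding power2_norm_eq_inner
      by (simp add: inner_diff inner_add inner_commute power2_eq_square algebra_simps)
    finally show "0 \<le> (norm m)\<^sup>2 * t\<^sup>2 - 2 * ((x - l) \<bullet> m) * t" by simp
  qed
  with lM show ?thesis by blast
qed

lemma closure_subspace:
  fixes M :: "'a::real_normed_vector set"
  assumes "subspace M" shows "subspace (closure M)"
proof (rule subspaceI)
  show "0 \<in> closure M"
    using assms closure_subset subspace_0 by blast
  show "x + y \<in> closure M" if xy: "x \<in> closure M" "y \<in> closure M" for x y
  proof -
    obtain f where f: "\<forall>n. f n \<in> M" "f \<longlonglongrightarrow> x"
      using xy(1) unfolding closure_sequential by auto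
    obtain g where g: "\<forall>n. g n \<in> M" "g \<longlonglongrightarrow> y"
      using xy(2) unfolding closure_sequential by auto
    have "(\<forall>n. f n + g n \<in> M) \<and> (\<lambda>n. f n + g n) \<longlonglongrightarrow> x + y"
      using assms f g by (auto intro: subspace_add tendsto_add)
    then show ?thesis
      unfolding closure_sequential by (rule exI[of _ "\<lambda>n. f n + g n"])
  qed
  show "c *\<^sub>R x \<in> closure M" if x: "x \<in> closure M" for c x
  proof -
    obtain f where f: "\<forall>n. f n \<in> M" "f \<longlonglongrightarrow> x"
      using x unfolding closure_sequential by auto
    have "(\<forall>n. c *\<^sub>R f n \<in> M) \<and> (\<lambda>n. c *\<^sub>R f n) \<longlonglongrightarrow> c *\<^sub>R x"
      using assms f by (auto intro: subspace_scale tendsto_intros)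
    then show ?thesis
      unfolding closure_sequential by (rule exI[of _ "\<lambda>n. c *\<^sub>R f n"])
  qed
qed

lemma subspace_dense_if_orthogonal_trivial:
  fixes M :: "'a::{real_inner,banach} set"
  assumes "subspace M" and "\<And>w. (\<And>m. m \<in> M \<Longrightarrow> w \<bullet> m = 0) \<Longrightarrow> w = 0"
  shows "closure M = UNIV"
proof -
  have "x \<in> closure M" for x
  proof -
    obtain p where p: "p \<in> closure M" "\<And>m. m \<in> closure M \<Longrightarrow> (x - p) \<bullet> m = 0"
      using orthogonal_projection_exists[of "closure M" x] assms(1) closure_subspace by blast
    then have "x - p = 0"
      using assms(2)[of "x - p"] closure_subset by blast
    with p(1) show ?thesis by simp
  qed
  then show ?thesis by blast
qed

text \<open>The kernel of a nonzero \<open>F\<close> has codimension one, so the component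
  \<open>e\<close> of some \<open>x\<close> orthogonal to the kernel spans its complement; rescaling
  \<open>e\<close> gives the representing vector.\<close>

lemma riesz_representation_ex:
  fixes F :: "'a::{real_inner,banach} \<Rightarrow>\<^sub>L real"
  shows "\<exists>r. \<forall>w. F w = r \<bullet> w"
proof (cases "F = 0")
  case True
  then show ?thesis by (intro exI[of _ 0]) simp
next
  case False
  then obtain x where x: "F x \<noteq> 0"
    by (metis blinfun_eqI zero_blinfun.rep_eq)
  have "subspace {w. F w = 0}"
    by (auto simp: subspace_def blinfun.bilinear_simps)
  moreover have "closed {w. F w = 0}"
    by (intro closed_Collect_eq continuous_intros)
  ultimately obtain p where p: "F p = 0" "\<And>m. F m = 0 \<Longrightarrow> (x - p) \<bullet> m = 0"
    using orthogonal_projection_exists[of "{w. F w = 0}" x] by blast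
  define e where "e = x - p"
  have Fe: "F e = F x"
    by (simp add: e_def p(1) blinfun.bilinear_simps)
  then have e0: "e \<bullet> e \<noteq> 0"
    using x by (auto simp: blinfun.bilinear_simps)
  have "F w = ((F e / (e \<bullet> e)) *\<^sub>R e) \<bullet> w" for w
  proof -
    have "e \<bullet> (w - (F w / F e) *\<^sub>R e) = 0"
      unfolding e_def[symmetric] using p(2)[of "w - (F w / F e) *\<^sub>R e"] x
      by (simp add: Fe e_def[symmetric] blinfun.bilinear_simps)
    then show ?thesis
      using e0 x Fe by (simp add: inner_diff field_simps)
  qed
  then show ?thesis by blast
qed

text \<open>On V with the scalar product induced by \<open>A\<close>, this is the inverse of
  \<open>A\<close>, as a map from V' to V.\<close>

definition riesz :: "('a::{real_inner,banach} \<Rightarrow>\<^sub>L real) \<Rightarrow> 'a" where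
  "riesz F = (SOME r. \<forall>w. F w = r \<bullet> w)"

lemma riesz_inner: fixes F :: "'a::{real_inner,banach} \<Rightarrow>\<^sub>L real" shows "riesz F \<bullet> w = F w"
  unfolding riesz_def using someI_ex[OF riesz_representation_ex[of F], THEN spec, of w] by (rule sym)

lemma riesz_eqI: fixes F :: "'a::{real_inner,banach} \<Rightarrow>\<^sub>L real" shows "(\<And>w. r \<bullet> w = F w) \<Longrightarrow> riesz F = r"
  using riesz_inner[of F] by (metis vector_eq_ldot inner_commute)

lemma norm_riesz: "norm (riesz F) = norm F"
proof (rule antisym)
  have "norm (riesz F) * norm (riesz F) = F (riesz F)"
    using riesz_inner[of F "riesz F"] by (simp add: dot_square_norm power2_eq_square)
  also have "\<dots> \<le> norm F * norm (riesz F)"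
    using norm_blinfun[of F "riesz F"] by simp
  finally show "norm (riesz F) \<le> norm F"
    by (cases "riesz F = 0") auto
  show "norm F \<le> norm (riesz F)"
    by (rule norm_blinfun_bound) (auto simp: riesz_inner[symmetric] Cauchy_Schwarz_ineq2)
qed

lemma bounded_linear_riesz: "bounded_linear riesz"
proof
  show "riesz (F + G) = riesz F + riesz G" for F G :: "'a \<Rightarrow>\<^sub>L real"
    by (rule riesz_eqI) (simp add: inner_add riesz_inner blinfun.bilinear_simps)
  show "riesz (c *\<^sub>R F) = c *\<^sub>R riesz F" for c and F :: "'a \<Rightarrow>\<^sub>L real"
    by (rule riesz_eqI) (simp add: riesz_inner blinfun.bilinear_simps)
  show "\<exists>K. \<forall>F :: 'a \<Rightarrow>\<^sub>L real. norm (riesz F) \<le> norm F * K"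
    by (intro exI[of _ 1]) (simp add: norm_riesz)
qed

lemmas riesz_simps = bounded_linear.linear[OF bounded_linear_riesz, THEN linear_add]
  bounded_linear.linear[OF bounded_linear_riesz, THEN linear_diff]
  bounded_linear.linear[OF bounded_linear_riesz, THEN linear_neg]
  bounded_linear.linear[OF bounded_linear_riesz, THEN linear_scale]
  bounded_linear.linear[OF bounded_linear_riesz, THEN linear_0]

section \<open>The pivot embedding, the inverse of A and its resolvents\<close>

locale pivot_space =
  fixes j :: "'v::{real_inner,banach,second_countable_topology}
                \<Rightarrow>\<^sub>L 'h::{real_inner,banach,second_countable_topology}"
    and A :: "'v \<Rightarrow>\<^sub>L ('v \<Rightarrow>\<^sub>L real)"
  assumes inj_j: "inj (blinfun_apply j)"
    and dense_j: "closure (range (blinfun_apply j)) = UNIV"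
    and A_inner: "blinfun_apply (blinfun_apply A y) z = y \<bullet> z"
begin

text \<open>The inverse of \<open>A\<close> on H; equivalently, the Hilbert space adjoint of
  \<open>j\<close>.\<close>

definition jstar :: "'h \<Rightarrow> 'v" where "jstar h = riesz (pivot_dual j h)"

lemma jstar_inner: "jstar h \<bullet> w = h \<bullet> j w"
  by (simp add: jstar_def riesz_inner pivot_dual_def)

lemma jstar_eqI: "(\<And>w. r \<bullet> w = h \<bullet> j w) \<Longrightarrow> jstar h = r"
  using jstar_inner[of h] by (metis vector_eq_ldot inner_commute)

lemma norm_jstar_le: "norm (jstar h) \<le> norm j * norm h"
proof -
  have "norm (jstar h) * norm (jstar h) = h \<bullet> j (jstar h)"
    by (metis jstar_inner dot_square_norm power2_eq_square)
  also have "\<dots> \<le> norm h * norm (j (jstar h))"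
    by (rule norm_cauchy_schwarz)
  also have "\<dots> \<le> norm h * (norm j * norm (jstar h))"
    by (intro mult_left_mono norm_blinfun) auto
  finally have "norm (jstar h) * norm (jstar h) \<le> (norm j * norm h) * norm (jstar h)"
    by (simp add: mult_ac)
  then show ?thesis
    by (cases "jstar h = 0") auto
qed

lemma bounded_linear_jstar: "bounded_linear jstar"
proof
  show "jstar (g + h) = jstar g + jstar h" for g h
    by (rule jstar_eqI) (simp add: inner_add jstar_inner)
  show "jstar (c *\<^sub>R h) = c *\<^sub>R jstar h" for c h
    by (rule jstar_eqI) (simp add: jstar_inner)
  show "\<exists>K. \<forall>h. norm (jstar h) \<le> norm h * K"
    by (intro exI[of _ "norm j"] allI) (metis norm_jstar_le mult.commute)
qed

lemma jstar_zero_iff: "jstar h = 0 \<longleftrightarrow> h = 0"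
proof
  assume *: "jstar h = 0"
  have "closure (range (blinfun_apply j)) \<subseteq> {g. h \<bullet> g = 0}"
    using jstar_inner[of h] * by (intro closure_minimal closed_Collect_eq) (auto intro!: continuous_intros)
  then have "h \<bullet> h = 0"
    using dense_j by blast
  then show "h = 0" by simp
qed (simp add: bounded_linear.linear[OF bounded_linear_jstar, THEN linear_0])

text \<open>The inverse of \<open>A\<close> on V. As an adjoint after \<open>j\<close> it is
  symmetric, nonnegative and injective.\<close>

definition S :: "'v \<Rightarrow> 'v" where "S v = jstar (j v)"

lemma bounded_linear_S: "bounded_linear S"
  unfolding S_def using bounded_linear_compose[OF bounded_linear_jstar blinfun.bounded_linear_right] .

lemma S_inner: "S v \<bullet> w = j v \<bullet> j w"
  by (simp add: S_def jstar_inner)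

lemma S_sym: "S v \<bullet> w = v \<bullet> S w"
  by (metis S_inner inner_commute)

lemma S_zero_iff: "S v = 0 \<longleftrightarrow> v = 0"
  unfolding S_def jstar_zero_iff using inj_j blinfun.zero_right
  by (metis injD)

lemmas S_simps = bounded_linear.linear[OF bounded_linear_S, THEN linear_add]
  bounded_linear.linear[OF bounded_linear_S, THEN linear_diff]
  bounded_linear.linear[OF bounded_linear_S, THEN linear_neg]
  bounded_linear.linear[OF bounded_linear_S, THEN linear_scale]
  bounded_linear.linear[OF bounded_linear_S, THEN linear_0]

lemmas jstar_simps = bounded_linear.linear[OF bounded_linear_jstar, THEN linear_add]
  bounded_linear.linear[OF bounded_linear_jstar, THEN linear_diff]
  bounded_linear.linear[OF bounded_linear_jstar, THEN linear_neg]
  bounded_linear.linear[OF bounded_linear_jstar, THEN linear_scale]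
  bounded_linear.linear[OF bounded_linear_jstar, THEN linear_0]

lemma dense_range_S: "closure (range S) = UNIV"
proof (rule subspace_dense_if_orthogonal_trivial)
  show "subspace (range S)"
    using bounded_linear_S by (simp add: bounded_linear.linear linear_subspace_image)
  show "w = 0" if "\<And>m. m \<in> range S \<Longrightarrow> w \<bullet> m = 0" for w
  proof -
    have "S w \<bullet> x = 0" for x
      using that[of "S x"] by (simp add: S_sym)
    then show ?thesis
      using S_zero_iff by (metis inner_eq_zero_iff)
  qed
qed

text \<open>Nonnegativity of \<open>S\<close> makes \<open>1 + l S\<close> coercive with constant 1.
  Coercivity makes the range closed and rules out a nonzero vector orthogonal to it.\<close>

lemma resolvent_ex:
  assumes "l \<ge> 0"
  shows "\<exists>w. w + l *\<^sub>R S w = v"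
proof -
  define T where "T = (\<lambda>w. w + l *\<^sub>R S w)"
  have T: "bounded_linear T"
    unfolding T_def by (intro bounded_linear_intros bounded_linear_S
        bounded_linear_compose[OF bounded_linear_scaleR_right])
  have coer: "norm w \<le> norm (T w)" for w
  proof -
    have "norm w * norm w \<le> T w \<bullet> w"
      using assms S_inner[of w w]
      by (simp add: T_def inner_add dot_square_norm power2_eq_square[symmetric])
    also have "\<dots> \<le> norm (T w) * norm w"
      by (rule norm_cauchy_schwarz)
    finally show ?thesis
      by (cases "w = 0") auto
  qed
  have "complete (range T)"
    using coer T by (intro complete_isometric_image[of 1]) (auto simp: complete_UNIV)
  moreover have "closure (range T) = UNIV"
  proof (rule subspace_dense_if_orthogonal_trivial)
    show "subspace (range T)"
      using T by (simp add: bounded_linear.linear linear_subspace_image)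
    show "w = 0" if "\<And>m. m \<in> range T \<Longrightarrow> w \<bullet> m = 0" for w
    proof -
      have "w \<bullet> T w = 0" using that by blast
      moreover have "w \<bullet> T w \<ge> w \<bullet> w"
        using assms S_inner[of w w] by (simp add: T_def inner_add inner_commute)
      ultimately show ?thesis
        by (metis inner_ge_zero inner_eq_zero_iff order_antisym)
    qed
  qed
  ultimately have "range T = UNIV"
    by (metis closure_closed complete_imp_closed)
  then show ?thesis
    by (metis T_def surjD)
qed

text \<open>In terms of \<open>A\<close> this is A (A + l)^-1, and \<open>l\<close> times it is the
  Yosida approximation of \<open>A\<close>. By \<open>N_S\<close> below, \<open>l\<close> times
  \<open>N l\<close> inverts \<open>S\<close> up to the operator \<open>N l\<close> itself, which
  tends strongly to 0 as \<open>l\<close> grows.\<close>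

definition N :: "real \<Rightarrow> 'v \<Rightarrow> 'v" where "N l v = (SOME w. w + l *\<^sub>R S w = v)"

lemma N_eq:
  assumes "l \<ge> 0" shows "N l v + l *\<^sub>R S (N l v) = v"
  unfolding N_def using someI_ex[OF resolvent_ex[OF assms]] .

lemma resolvent_unique:
  assumes "l \<ge> 0" "w + l *\<^sub>R S w = z + l *\<^sub>R S z"
  shows "w = z"
proof -
  define d where "d = w - z"
  have "d + l *\<^sub>R S d = 0"
    using assms(2) by (simp add: d_def S_simps algebra_simps)
  then have "(d + l *\<^sub>R S d) \<bullet> d = 0" by simp
  then have "d \<bullet> d + l * (S d \<bullet> d) = 0" by (simp add: inner_add)
  moreover have "l * (S d \<bullet> d) \<ge> 0" using assms(1) by (simp add: S_inner)
  ultimately have "d \<bullet> d = 0" by (smt (verit) inner_ge_zero)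
  then show ?thesis by (simp add: d_def)
qed

lemma N_eqI: "l \<ge> 0 \<Longrightarrow> w + l *\<^sub>R S w = v \<Longrightarrow> N l v = w"
  using N_eq resolvent_unique by metis

lemma N_S_commute: "l \<ge> 0 \<Longrightarrow> N l (S v) = S (N l v)"
proof (rule N_eqI)
  assume l: "l \<ge> 0"
  have "S (N l v) + l *\<^sub>R S (S (N l v)) = S (N l v + l *\<^sub>R S (N l v))"
    by (simp add: S_simps)
  then show "S (N l v) + l *\<^sub>R S (S (N l v)) = S v"
    by (simp only: N_eq[OF l])
qed

lemma N_S: "l \<ge> 0 \<Longrightarrow> l *\<^sub>R N l (S v) = v - N l v"
  by (metis N_S_commute N_eq add_diff_cancel_left')

text \<open>The form of \<open>N l\<close> is the squared dual norm belonging to the weighted norm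
  with square \<open>(norm w)^2 + l * (norm (j w))^2\<close>; in this guise it measures lower-order
  terms in the Carleman estimate.\<close>

lemma norm_N_sq:
  assumes "l \<ge> 0"
  shows "(norm (N l v))\<^sup>2 + l * (norm (j (N l v)))\<^sup>2 = v \<bullet> N l v"
  using arg_cong[OF N_eq[OF assms, of v], of "\<lambda>z. z \<bullet> N l v"]
  by (simp add: inner_add S_inner power2_norm_eq_inner)

lemma norm_N_le:
  assumes "l \<ge> 0" shows "norm (N l v) \<le> norm v"
proof -
  have "norm (N l v) * norm (N l v) \<le> v \<bullet> N l v"
    using norm_N_sq[OF assms, of v] mult_nonneg_nonneg[OF assms zero_le_power2[of "norm (j (N l v))"]]
    by (simp only: power2_eq_square[symmetric])
  also have "\<dots> \<le> norm v * norm (N l v)"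
    by (rule norm_cauchy_schwarz)
  finally show ?thesis
    by (cases "N l v = 0") auto
qed

lemma bounded_linear_N:
  assumes "l \<ge> 0" shows "bounded_linear (N l)"
proof
  show "N l (v + w) = N l v + N l w" for v w
    using N_eq[OF assms, of v] N_eq[OF assms, of w]
    by (intro N_eqI[OF assms]) (simp add: S_simps algebra_simps)
  show "N l (c *\<^sub>R v) = c *\<^sub>R N l v" for c v
  proof (intro N_eqI[OF assms])
    have "c *\<^sub>R (N l v + l *\<^sub>R S (N l v)) = c *\<^sub>R v" using N_eq[OF assms, of v] by simp
    then show "c *\<^sub>R N l v + l *\<^sub>R S (c *\<^sub>R N l v) = c *\<^sub>R v"
      by (simp add: S_simps algebra_simps)
  qed
  show "\<exists>K. \<forall>v. norm (N l v) \<le> norm v * K"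
    by (intro exI[of _ 1]) (simp add: norm_N_le[OF assms])
qed

lemma N_sym:
  assumes "l \<ge> 0" shows "N l v \<bullet> w = v \<bullet> N l w"
proof -
  have "N l v \<bullet> w = N l v \<bullet> (N l w + l *\<^sub>R S (N l w))"
    by (simp only: N_eq[OF assms])
  also have "\<dots> = (N l v + l *\<^sub>R S (N l v)) \<bullet> N l w"
    by (simp add: inner_add_left inner_add_right S_sym[of "N l v"])
  finally show ?thesis by (simp only: N_eq[OF assms])
qed

text \<open>On the range of \<open>S\<close> the decay is of order 1/n by \<open>N_S\<close>. The
  range is dense and all \<open>N l\<close> are contractions, so convergence extends to every
  \<open>v\<close>.\<close>

lemma N_tendsto_0: "(\<lambda>n. N (real n) v) \<longlonglongrightarrow> 0"
proof (rule LIMSEQ_I)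
  fix e :: real assume e: "e > 0"
  have "v \<in> closure (range S)" by (simp add: dense_range_S)
  moreover have "e / 2 > 0" using e by simp
  ultimately obtain x where x: "dist (S x) v < e / 2"
    unfolding closure_approachable by blast
  obtain M0 where M0: "real M0 > 4 * norm x / e"
    using reals_Archimedean2 by blast
  define M where "M = Suc M0"
  have M: "real M > 4 * norm x / e" "M > 0"
    using M0 by (auto simp: M_def)
  have "norm (N n v) < e" if n: "n \<ge> M" for n
  proof -
    have n0: "real n > 0" using n M by simp
    have "real n * norm (N n (S x)) = norm (x - N n x)"
      using arg_cong[OF N_S[of "real n" x], of norm] by simp
    also have "\<dots> \<le> 2 * norm x"
      using norm_triangle_ineq4[of x "N n x"] norm_N_le[of n x] by simp
    finally have "norm (N n (S x)) \<le> 2 * norm x / n"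
      using n0 by (simp add: field_simps)
    also have "\<dots> < e / 2"
    proof -
      have "4 * norm x / e < n" using M(1) n by linarith
      then show ?thesis using e n0 by (simp add: field_simps)
    qed
    finally have 1: "norm (N n (S x)) < e / 2" .
    have "N n v = N n (S x) - N n (S x - v)"
      using bounded_linear.linear[OF bounded_linear_N[of n], THEN linear_diff, of "S x" v] by simp
    then have "norm (N n v) \<le> norm (N n (S x)) + norm (N n (S x - v))"
      using norm_triangle_ineq4 by metis
    also have "\<dots> < e"
      using 1 x norm_N_le[of n "S x - v"] by (simp add: dist_norm)
    finally show ?thesis .
  qed
  then show "\<exists>no. \<forall>n\<ge>no. norm (N (real n) v - 0) < e"
    by auto
qed

end

section \<open>Integrals over intervals and absolutely continuous functions\<close>

lemma set_borel_measurable_continuous: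
  fixes f :: "real \<Rightarrow> 'a::real_normed_vector"
  assumes "continuous_on {a..b} f"
  shows "set_borel_measurable lebesgue {a..b} f"
  using borel_measurable_continuous_on_indicator[OF _ assms]
  unfolding set_borel_measurable_def by (simp add: measurable_completion)

lemma set_borel_measurable_linear:
  assumes "set_borel_measurable M I f" "bounded_linear T"
  shows "set_borel_measurable M I (\<lambda>t. T (f t))"
proof -
  have "(\<lambda>t. T (indicator I t *\<^sub>R f t)) \<in> borel_measurable M"
    using assms(1) unfolding set_borel_measurable_def
    by (rule measurable_compose) (intro borel_measurable_continuous_onI linear_continuous_on assms(2))
  then show ?thesis
    unfolding set_borel_measurable_def
    by (simp only: linear_simps(5)[OF assms(2)])
qed

lemma set_borel_measurable_bilinear:
  fixes f :: "_ \<Rightarrow> 'a::{real_normed_vector,second_countable_topology}"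
    and g :: "_ \<Rightarrow> 'b::{real_normed_vector,second_countable_topology}"
  assumes "set_borel_measurable M I f" "set_borel_measurable M I g" "bounded_bilinear pr"
  shows "set_borel_measurable M I (\<lambda>t. pr (f t) (g t))"
proof -
  interpret bounded_bilinear pr by fact
  have "(\<lambda>t. pr (indicator I t *\<^sub>R f t) (indicator I t *\<^sub>R g t)) \<in> borel_measurable M"
    using assms(1,2) unfolding set_borel_measurable_def
    by (rule borel_measurable_continuous_Pair)
      (rule continuous_on[OF continuous_on_fst[OF continuous_on_id] continuous_on_snd[OF continuous_on_id]])
  moreover have "pr (indicator I t *\<^sub>R f t) (indicator I t *\<^sub>R g t)
      = indicator I t *\<^sub>R pr (f t) (g t)" for t
    by (cases "t \<in> I") (simp_all add: zero_left)
  ultimately show ?thesis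
    unfolding set_borel_measurable_def by simp
qed

lemma set_borel_measurable_add:
  fixes f g :: "_ \<Rightarrow> 'a::{real_normed_vector,second_countable_topology}"
  assumes "set_borel_measurable M I f" "set_borel_measurable M I g"
  shows "set_borel_measurable M I (\<lambda>t. f t + g t)"
  using borel_measurable_add[OF assms[unfolded set_borel_measurable_def]]
  by (simp add: set_borel_measurable_def scaleR_add_right)

lemma set_borel_measurable_norm:
  assumes "set_borel_measurable M I f"
  shows "set_borel_measurable M I (\<lambda>t. norm (f t))"
proof -
  have "(\<lambda>t. norm (indicat_real I t *\<^sub>R f t)) \<in> borel_measurable M"
    using assms unfolding set_borel_measurable_def by (rule measurable_compose) simp
  then show ?thesis
    by (simp add: set_borel_measurable_def)
qed

lemma set_integrable_imp_measurable:
  fixes f :: "_ \<Rightarrow> 'a::{banach,second_countable_topology}"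
  shows "set_integrable M I f \<Longrightarrow> set_borel_measurable M I f"
  by (simp add: set_integrable_def set_borel_measurable_def)

lemma set_integrable_linear:
  fixes f :: "_ \<Rightarrow> 'a::{banach,second_countable_topology}"
    and T :: "'a \<Rightarrow> 'b::{banach,second_countable_topology}"
  assumes "set_integrable M I f" "bounded_linear T"
  shows "set_integrable M I (\<lambda>t. T (f t))"
  using integrable_bounded_linear[OF assms(2) assms(1)[unfolded set_integrable_def]]
  by (simp add: set_integrable_def linear_simps[OF assms(2)])

lemma set_integral_linear:
  fixes f :: "_ \<Rightarrow> 'a::{banach,second_countable_topology}"
    and T :: "'a \<Rightarrow> 'b::{banach,second_countable_topology}"
  assumes "set_integrable M I f" "bounded_linear T"
  shows "(LINT t:I|M. T (f t)) = T (LINT t:I|M. f t)"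
  using integral_bounded_linear[OF assms(2) assms(1)[unfolded set_integrable_def]]
  by (simp add: set_lebesgue_integral_def linear_simps[OF assms(2)])

lemma set_integrable_bilinear_continuous:
  fixes f :: "real \<Rightarrow> 'a::{banach,second_countable_topology}"
    and g :: "real \<Rightarrow> 'b::{banach,second_countable_topology}"
    and pr :: "'a \<Rightarrow> 'b \<Rightarrow> 'c::{banach,second_countable_topology}"
  assumes f: "set_integrable lebesgue {a..b} f" and g: "continuous_on {a..b} g"
    and "bounded_bilinear pr"
  shows "set_integrable lebesgue {a..b} (\<lambda>t. pr (f t) (g t))"
proof -
  interpret bounded_bilinear pr by fact
  obtain K where K: "K > 0" "\<And>x y. norm (pr x y) \<le> norm x * norm y * K"
    using pos_bounded by blast
  have "bounded (g ` {a..b})"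
    using g by (intro compact_imp_bounded compact_continuous_image) auto
  then obtain G where G: "G > 0" "\<And>t. t \<in> {a..b} \<Longrightarrow> norm (g t) \<le> G"
    unfolding bounded_pos by auto
  show ?thesis
  proof (rule set_integrable_bound[of _ _ "\<lambda>t. (G * K) *\<^sub>R f t"])
    show "set_integrable lebesgue {a..b} (\<lambda>t. (G * K) *\<^sub>R f t)"
      using f by simp
    show "set_borel_measurable lebesgue {a..b} (\<lambda>t. pr (f t) (g t))"
      by (rule set_borel_measurable_bilinear[OF set_integrable_imp_measurable[OF f]
            set_borel_measurable_continuous[OF g] assms(3)])
    show "AE t in lebesgue. t \<in> {a..b} \<longrightarrow> norm (pr (f t) (g t)) \<le> norm ((G * K) *\<^sub>R f t)"
    proof (intro AE_I2 impI)
      fix t assume "t \<in> {a..b}"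
      then have "norm (f t) * norm (g t) * K \<le> norm (f t) * G * K"
        using G K by (intro mult_right_mono mult_left_mono) auto
      then show "norm (pr (f t) (g t)) \<le> norm ((G * K) *\<^sub>R f t)"
        using order_trans[OF K(2)[of "f t" "g t"]] G(1) K(1) by (simp add: mult_ac)
    qed
  qed
qed

lemma set_integrable_continuous:
  fixes g :: "real \<Rightarrow> 'b::{banach,second_countable_topology}"
  assumes "continuous_on {a..b} g"
  shows "set_integrable lebesgue {a..b} g"
proof -
  have "set_integrable lebesgue {a..b} (\<lambda>t. 1 :: real)"
    using absolutely_integrable_continuous_real[of a b "\<lambda>_. 1 :: real"] by simp
  from set_integrable_bilinear_continuous[OF this assms bounded_bilinear_scaleR]
  show ?thesis by simp
qed

lemma set_integral_combine:
  fixes f :: "real \<Rightarrow> 'a::{banach,second_countable_topology}"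
  assumes "set_integrable lebesgue {a..c} f" "a \<le> b" "b \<le> c"
  shows "(LINT r:{a..c}|lebesgue. f r) = (LINT r:{a..b}|lebesgue. f r) + (LINT r:{b..c}|lebesgue. f r)"
proof -
  have "{a..c} = {a..b} \<union> {b..c}" using assms by auto
  moreover have "AE x in lebesgue. \<not> (x \<in> {a..b} \<and> x \<in> {b..c})"
  proof (rule AE_I')
    show "{b} \<in> null_sets lebesgue" by simp
  qed auto
  moreover have "set_integrable lebesgue {a..b} f" "set_integrable lebesgue {b..c} f"
    using assms by (auto intro!: set_integrable_subset[OF assms(1)])
  ultimately show ?thesis
    using set_integral_Un_AE[of "{a..b}" "{b..c}" lebesgue f] by simp
qed

text \<open>Absolute continuity with almost-everywhere derivative \<open>\<psi>\<close>, in
  integrated form. This form makes sense for Hilbert-space values without a differentiation theorem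
  and passes to limits by dominated convergence.\<close>

definition primitive_on ::
    "real \<Rightarrow> real \<Rightarrow> (real \<Rightarrow> 'a::{banach,second_countable_topology}) \<Rightarrow> (real \<Rightarrow> 'a) \<Rightarrow> bool" where
  "primitive_on a b x \<psi> \<longleftrightarrow> set_integrable lebesgue {a..b} \<psi> \<and>
     (\<forall>s t. a \<le> s \<longrightarrow> s \<le> t \<longrightarrow> t \<le> b \<longrightarrow> x t - x s = (LINT r:{s..t}|lebesgue. \<psi> r))"

lemma primitive_onD:
  assumes "primitive_on a b x \<psi>"
  shows "set_integrable lebesgue {a..b} \<psi>"
    and "\<And>s t. a \<le> s \<Longrightarrow> s \<le> t \<Longrightarrow> t \<le> b \<Longrightarrow> x t - x s = (LINT r:{s..t}|lebesgue. \<psi> r)"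
    and "\<And>s t. a \<le> s \<Longrightarrow> t \<le> b \<Longrightarrow> set_integrable lebesgue {s..t} \<psi>"
  using assms by (auto simp: primitive_on_def intro: set_integrable_subset)

lemma primitive_on_subset:
  assumes "primitive_on a b x \<psi>" "a \<le> a'" "b' \<le> b"
  shows "primitive_on a' b' x \<psi>"
  using primitive_onD[OF assms(1)] assms(2,3) by (auto simp: primitive_on_def)

lemma primitive_on_linear:
  fixes T :: "'a::{banach,second_countable_topology} \<Rightarrow> 'b::{banach,second_countable_topology}"
  assumes "primitive_on a b x \<psi>" "bounded_linear T"
  shows "primitive_on a b (\<lambda>t. T (x t)) (\<lambda>t. T (\<psi> t))"
  using primitive_onD[OF assms(1)] assms(2)
  by (simp add: primitive_on_def set_integrable_linear set_integral_linear linear_simps(2)[symmetric])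

lemma primitive_on_add:
  assumes "primitive_on a b x \<psi>" "primitive_on a b y \<eta>"
  shows "primitive_on a b (\<lambda>t. x t + y t) (\<lambda>t. \<psi> t + \<eta> t)"
  unfolding primitive_on_def
proof (intro conjI allI impI)
  show "set_integrable lebesgue {a..b} (\<lambda>t. \<psi> t + \<eta> t)"
    using primitive_onD(1)[OF assms(1)] primitive_onD(1)[OF assms(2)] by simp
  fix s t assume st: "a \<le> s" "s \<le> t" "t \<le> b"
  then show "x t + y t - (x s + y s) = (LINT r:{s..t}|lebesgue. \<psi> r + \<eta> r)"
    using primitive_onD(2,3)[OF assms(1), of s t] primitive_onD(2,3)[OF assms(2), of s t]
    by (simp add: set_integral_add algebra_simps)
qed

lemma primitive_on_norm_le:
  assumes "primitive_on a b x \<psi>" "a \<le> s" "s \<le> t" "t \<le> b"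
  shows "norm (x t - x s) \<le> (LINT r:{s..t}|lebesgue. norm (\<psi> r))"
  using set_integral_norm_bound[OF primitive_onD(3)[OF assms(1,2,4)]] primitive_onD(2)[OF assms]
  by simp

lemma set_integral_continuous_upper:
  fixes f :: "real \<Rightarrow> real"
  assumes "set_integrable lebesgue {a..b} f"
  shows "continuous_on {a..b} (\<lambda>t. LINT r:{a..t}|lebesgue. f r)"
proof -
  have "continuous_on {a..b} (\<lambda>t. integral {a..t} f)"
    using set_lebesgue_integral_eq_integral(1)[OF assms] by (rule indefinite_integral_continuous_1)
  moreover have "integral {a..t} f = (LINT r:{a..t}|lebesgue. f r)" if "t \<in> {a..b}" for t
    using that by (intro set_lebesgue_integral_eq_integral(2)[symmetric] set_integrable_subset[OF assms]) auto
  ultimately show ?thesis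
    by (rule continuous_on_eq)
qed

text \<open>Increments of \<open>x\<close> are dominated by those of the scalar primitive of
  \<open>norm \<psi>\<close>, which is continuous.\<close>

lemma primitive_on_continuous:
  assumes "primitive_on a b x \<psi>"
  shows "continuous_on {a..b} x"
proof -
  define \<Phi> where "\<Phi> t = (LINT r:{a..t}|lebesgue. norm (\<psi> r))" for t
  have int: "set_integrable lebesgue {a..b} (\<lambda>r. norm (\<psi> r))"
    using primitive_onD(1)[OF assms] by (simp add: set_integrable_norm)
  have le: "norm (x t - x s) \<le> \<Phi> t - \<Phi> s" if "a \<le> s" "s \<le> t" "t \<le> b" for s t
    using primitive_on_norm_le[OF assms that] set_integral_combine[of a t "\<lambda>r. norm (\<psi> r)" s]
      set_integrable_subset[OF int, of "{a..t}"] that by (simp add: \<Phi>_def)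
  have cont: "continuous_on {a..b} \<Phi>"
    unfolding \<Phi>_def using int by (rule set_integral_continuous_upper)
  show ?thesis
    unfolding continuous_on_iff
  proof (intro ballI allI impI)
    fix s e :: real assume s: "s \<in> {a..b}" and e: "0 < e"
    obtain d where d: "d > 0" "\<And>t. t \<in> {a..b} \<Longrightarrow> dist t s < d \<Longrightarrow> dist (\<Phi> t) (\<Phi> s) < e"
      using cont s e unfolding continuous_on_iff by blast
    have "dist (x t) (x s) < e" if t: "t \<in> {a..b}" "dist t s < d" for t
    proof -
      have "dist (x t) (x s) \<le> dist (\<Phi> t) (\<Phi> s)"
        using le[of s t] le[of t s] s t
        by (cases "s \<le> t") (auto simp: dist_norm norm_minus_commute)
      then show ?thesis using d(2)[OF t] by simp
    qed
    then show "\<exists>d>0. \<forall>t\<in>{a..b}. dist t s < d \<longrightarrow> dist (x t) (x s) < e"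
      using d(1) by blast
  qed
qed

text \<open>Replaces the argument that a function with zero derivative is constant: for each
  \<open>e\<close> the local bounds add up along a bisection to the bound
  \<open>e * (\<Phi> b - \<Phi> a)\<close>, and \<open>e\<close> is arbitrary.\<close>

lemma eq_if_locally_small_increments:
  fixes F :: "real \<Rightarrow> 'a::real_normed_vector"
  assumes ab: "a \<le> b"
    and small: "\<And>e. e > 0 \<Longrightarrow> \<exists>d>0. \<forall>s t. a \<le> s \<longrightarrow> s \<le> t \<longrightarrow> t \<le> b \<longrightarrow> t - s < d \<longrightarrow>
                  norm (F t - F s) \<le> e * (\<Phi> t - \<Phi> s)"
  shows "F b = F a"
proof -
  have le: "norm (F b - F a) \<le> e * (\<Phi> b - \<Phi> a)" if e: "e > 0" for e
  proof -
    define P where "P s t \<longleftrightarrow> (a \<le> s \<longrightarrow> s \<le> t \<longrightarrow> t \<le> b \<longrightarrow> norm (F t - F s) \<le> e * (\<Phi> t - \<Phi> s))" for s t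
    have "P a b"
    proof (rule Bolzano[OF ab])
      fix s t u assume "P s t" "P t u" and stu: "s \<le> t" "t \<le> u"
      show "P s u"
        unfolding P_def
      proof (intro impI)
        assume su: "a \<le> s" "s \<le> u" "u \<le> b"
        have "norm (F u - F s) \<le> norm (F u - F t) + norm (F t - F s)"
          by (metis norm_triangle_ineq diff_add_cancel add_diff_eq)
        also have "\<dots> \<le> e * (\<Phi> u - \<Phi> t) + e * (\<Phi> t - \<Phi> s)"
          using \<open>P s t\<close> \<open>P t u\<close> su stu by (intro add_mono) (auto simp: P_def)
        finally show "norm (F u - F s) \<le> e * (\<Phi> u - \<Phi> s)"
          by (simp add: algebra_simps)
      qed
    next
      fix x
      from small[OF e] obtain d where "d > 0" "\<And>s t. t - s < d \<Longrightarrow> P s t"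
        unfolding P_def by blast
      then show "\<exists>d>0. \<forall>s t. s \<le> x \<and> x \<le> t \<and> t - s < d \<longrightarrow> P s t"
        by blast
    qed
    then show ?thesis using ab by (simp add: P_def)
  qed
  have "norm (F b - F a) \<le> 0"
  proof (rule field_le_epsilon)
    fix e :: real assume e: "e > 0"
    have "norm (F b - F a) \<le> (e / (\<bar>\<Phi> b - \<Phi> a\<bar> + 1)) * (\<Phi> b - \<Phi> a)"
      using e by (intro le) auto
    also have "\<dots> \<le> (e / (\<bar>\<Phi> b - \<Phi> a\<bar> + 1)) * (\<bar>\<Phi> b - \<Phi> a\<bar> + 1)"
      using e by (intro mult_left_mono) auto
    finally show "norm (F b - F a) \<le> 0 + e" by simp
  qed
  then show ?thesis by simp
qed

text \<open>On a short interval [p,q] the increment of the product is exactly the integral of the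
  derivative with \<open>y\<close> frozen at \<open>q\<close> and \<open>x\<close> frozen at
  \<open>p\<close>. By uniform continuity, freezing costs at most \<open>e\<close> times the
  integral of \<open>norm \<psi> + norm \<eta>\<close>, so
  \<open>eq_if_locally_small_increments\<close> applies to the difference of both sides.\<close>

lemma primitive_on_bilinear:
  fixes x \<psi> :: "real \<Rightarrow> 'a::{banach,second_countable_topology}"
    and y \<eta> :: "real \<Rightarrow> 'b::{banach,second_countable_topology}"
    and pr :: "'a \<Rightarrow> 'b \<Rightarrow> 'c::{banach,second_countable_topology}"
  assumes x: "primitive_on a b x \<psi>" and y: "primitive_on a b y \<eta>" and pr: "bounded_bilinear pr"
  shows "primitive_on a b (\<lambda>t. pr (x t) (y t)) (\<lambda>t. pr (\<psi> t) (y t) + pr (x t) (\<eta> t))"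
proof -
  interpret bounded_bilinear pr by fact
  define \<Xi> where "\<Xi> = (\<lambda>t. pr (\<psi> t) (y t) + pr (x t) (\<eta> t))"
  obtain K where K: "K > 0" "\<And>x y. norm (pr x y) \<le> norm x * norm y * K"
    using pos_bounded by blast
  have cx: "continuous_on {a..b} x" and cy: "continuous_on {a..b} y"
    using x y by (auto intro: primitive_on_continuous)
  have i1: "set_integrable lebesgue {a..b} (\<lambda>t. pr (\<psi> t) (y t))"
    using set_integrable_bilinear_continuous[OF primitive_onD(1)[OF x] cy pr] .
  have i2: "set_integrable lebesgue {a..b} (\<lambda>t. pr (x t) (\<eta> t))"
    using set_integrable_bilinear_continuous[OF primitive_onD(1)[OF y] cx flip] .
  have \<Xi>: "set_integrable lebesgue {a..b} \<Xi>"
    unfolding \<Xi>_def using i1 i2 by simp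
  have sub: "set_integrable lebesgue {s..t} f"
    if "set_integrable lebesgue {a..b} f" "a \<le> s" "t \<le> b" for s t
      and f :: "real \<Rightarrow> 'd::{banach,second_countable_topology}"
    using that by (auto intro: set_integrable_subset)
  define n where "n t = norm (\<psi> t) + norm (\<eta> t)" for t
  have n: "set_integrable lebesgue {a..b} n"
    unfolding n_def using primitive_onD(1)[OF x] primitive_onD(1)[OF y]
    by (simp add: set_integrable_norm)
  have main: "pr (x t) (y t) - pr (x s) (y s) = (LINT r:{s..t}|lebesgue. \<Xi> r)"
    if st: "a \<le> s" "s \<le> t" "t \<le> b" for s t
  proof -
    define F where "F t = pr (x t) (y t) - (LINT r:{s..t}|lebesgue. \<Xi> r)" for t
    define \<Phi> where "\<Phi> t = (LINT r:{s..t}|lebesgue. n r)" for t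
    have "F t = F s"
    proof (rule eq_if_locally_small_increments[OF st(2)])
      fix e :: real assume e: "e > 0"
      have ux: "uniformly_continuous_on {a..b} x" and uy: "uniformly_continuous_on {a..b} y"
        using cx cy by (auto intro: compact_uniformly_continuous)
      \<comment> \<open>The constant \<open>K\<close> of the bilinear map multiplies the modulus of
        continuity in the final bound.\<close>
      define e' where "e' = e / K"
      have e': "e' > 0" "K * e' = e" using e K by (auto simp: e'_def)
      obtain d1 where d1: "d1 > 0" "\<And>p q. p \<in> {a..b} \<Longrightarrow> q \<in> {a..b} \<Longrightarrow> dist p q < d1 \<Longrightarrow> dist (x p) (x q) < e'"
        using ux e' unfolding uniformly_continuous_on_def by blast
      obtain d2 where d2: "d2 > 0" "\<And>p q. p \<in> {a..b} \<Longrightarrow> q \<in> {a..b} \<Longrightarrow> dist p q < d2 \<Longrightarrow> dist (y p) (y q) < e'"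
        using uy e' unfolding uniformly_continuous_on_def by blast
      have "norm (F q - F p) \<le> e * (\<Phi> q - \<Phi> p)"
        if pq: "s \<le> p" "p \<le> q" "q \<le> t" "q - p < min d1 d2" for p q
      proof -
        have ap: "a \<le> p" "q \<le> b" using pq st by auto
        have 1: "F q - F p = (pr (x q) (y q) - pr (x p) (y p)) - (LINT r:{p..q}|lebesgue. \<Xi> r)"
          using set_integral_combine[OF sub[OF \<Xi>, of s q], of p] pq st by (simp add: F_def)
        have 2: "pr (x q) (y q) - pr (x p) (y p)
            = (LINT r:{p..q}|lebesgue. pr (\<psi> r) (y q) + pr (x p) (\<eta> r))"
        proof -
          have "pr (x q) (y q) - pr (x p) (y p) = pr (x q - x p) (y q) + pr (x p) (y q - y p)"
            by (simp add: diff_left diff_right)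
          also have "\<dots> = (LINT r:{p..q}|lebesgue. pr (\<psi> r) (y q)) + (LINT r:{p..q}|lebesgue. pr (x p) (\<eta> r))"
            using primitive_onD(2,3)[OF x, of p q] primitive_onD(2,3)[OF y, of p q] ap pq
              set_integral_linear[OF _ bounded_linear_left[of "y q"], of lebesgue "{p..q}" \<psi>]
              set_integral_linear[OF _ bounded_linear_right[of "x p"], of lebesgue "{p..q}" \<eta>]
            by (simp only:)
          also have "\<dots> = (LINT r:{p..q}|lebesgue. pr (\<psi> r) (y q) + pr (x p) (\<eta> r))"
            using primitive_onD(3)[OF x, of p q] primitive_onD(3)[OF y, of p q] ap
            by (intro set_integral_add(2)[symmetric] set_integrable_linear[OF _ bounded_linear_left]
                 set_integrable_linear[OF _ bounded_linear_right])
          finally show ?thesis .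
        qed
        have i3: "set_integrable lebesgue {p..q} (\<lambda>r. pr (\<psi> r) (y q) + pr (x p) (\<eta> r))"
          using primitive_onD(3)[OF x, of p q] primitive_onD(3)[OF y, of p q] ap
          by (intro set_integral_add(1) set_integrable_linear[OF _ bounded_linear_left]
                 set_integrable_linear[OF _ bounded_linear_right])
        have "F q - F p = (LINT r:{p..q}|lebesgue. pr (\<psi> r) (y q) + pr (x p) (\<eta> r) - \<Xi> r)"
          unfolding 1 2 using i3 sub[OF \<Xi>, of p q] ap by simp
        also have "norm \<dots> \<le> (LINT r:{p..q}|lebesgue. norm (pr (\<psi> r) (y q) + pr (x p) (\<eta> r) - \<Xi> r))"
          using i3 sub[OF \<Xi>, of p q] ap by (intro set_integral_norm_bound) simp
        also have "\<dots> \<le> (LINT r:{p..q}|lebesgue. e * n r)"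
        proof (rule set_integral_mono)
          show "set_integrable lebesgue {p..q} (\<lambda>r. norm (pr (\<psi> r) (y q) + pr (x p) (\<eta> r) - \<Xi> r))"
            using i3 sub[OF \<Xi>, of p q] ap by (intro set_integrable_norm) simp
          show "set_integrable lebesgue {p..q} (\<lambda>r. e * n r)"
            using sub[OF n, of p q] ap by simp
          fix r assume r: "r \<in> {p..q}"
          have dr: "norm (y q - y r) \<le> e'" "norm (x p - x r) \<le> e'"
            using d1(2)[of p r] d2(2)[of q r] r ap pq by (auto simp: dist_norm less_imp_le)
          have "pr (\<psi> r) (y q) + pr (x p) (\<eta> r) - \<Xi> r = pr (\<psi> r) (y q - y r) + pr (x p - x r) (\<eta> r)"
            by (simp add: \<Xi>_def diff_left diff_right)
          also have "norm \<dots> \<le> norm (\<psi> r) * norm (y q - y r) * K + norm (x p - x r) * norm (\<eta> r) * K"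
            by (intro norm_triangle_mono K)
          also have "\<dots> \<le> norm (\<psi> r) * e' * K + e' * norm (\<eta> r) * K"
            using dr K by (intro add_mono mult_right_mono mult_left_mono) auto
          also have "\<dots> = (K * e') * n r"
            by (simp add: n_def algebra_simps)
          finally show "norm (pr (\<psi> r) (y q) + pr (x p) (\<eta> r) - \<Xi> r) \<le> e * n r"
            by (simp add: e')
        qed
        also have "\<dots> = e * (\<Phi> q - \<Phi> p)"
          using set_integral_combine[OF sub[OF n, of s q], of p] pq st by (simp add: \<Phi>_def)
        finally show ?thesis .
      qed
      then show "\<exists>d>0. \<forall>p q. s \<le> p \<longrightarrow> p \<le> q \<longrightarrow> q \<le> t \<longrightarrow> q - p < d \<longrightarrow>
          norm (F q - F p) \<le> e * (\<Phi> q - \<Phi> p)"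
        using d1(1) d2(1) by (intro exI[of _ "min d1 d2"]) auto
    qed
    moreover have "(LINT r:{s..s}|lebesgue. \<Xi> r) = 0"
      using set_integral_combine[OF sub[OF \<Xi>, of s s], of s] st by simp
    ultimately show ?thesis by (simp add: F_def algebra_simps)
  qed
  show ?thesis
    using \<Xi> main unfolding primitive_on_def \<Xi>_def by blast
qed

lemma primitive_on_cong_AE:
  assumes x: "primitive_on a b x \<psi>" and \<eta>: "set_borel_measurable lebesgue {a..b} \<eta>"
    and ae: "AE t in lebesgue. t \<in> {a..b} \<longrightarrow> \<psi> t = \<eta> t"
  shows "primitive_on a b x \<eta>"
proof -
  have "set_integrable lebesgue {a..b} \<eta>"
    using ae by (intro set_integrable_bound[OF primitive_onD(1)[OF x] \<eta>]) auto
  moreover have "(LINT r:{s..t}|lebesgue. \<psi> r) = (LINT r:{s..t}|lebesgue. \<eta> r)"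
    if "a \<le> s" "t \<le> b" for s t
    unfolding set_lebesgue_integral_def
  proof (rule integral_cong_AE)
    show "(\<lambda>r. indicator {s..t} r *\<^sub>R \<psi> r) \<in> borel_measurable lebesgue"
      using primitive_onD(3)[OF x that] by (simp add: set_integrable_def)
    show "(\<lambda>r. indicator {s..t} r *\<^sub>R \<eta> r) \<in> borel_measurable lebesgue"
      using set_borel_measurable_subset[OF \<eta>, of "{s..t}"] that by (simp add: set_borel_measurable_def)
    show "AE r in lebesgue. indicator {s..t} r *\<^sub>R \<psi> r = indicator {s..t} r *\<^sub>R \<eta> r"
      using ae that by (auto simp: indicator_def)
  qed
  ultimately show ?thesis
    using primitive_onD(2)[OF x] by (simp add: primitive_on_def)
qed

lemma primitive_on_C1_real:
  fixes f :: "real \<Rightarrow> real"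
  assumes "\<And>t. t \<in> {a..b} \<Longrightarrow> (f has_vector_derivative f' t) (at t within {a..b})"
    and "continuous_on {a..b} f'"
  shows "primitive_on a b f f'"
  unfolding primitive_on_def
proof (intro conjI allI impI)
  show int: "set_integrable lebesgue {a..b} f'"
    using assms(2) by (rule set_integrable_continuous)
  fix s t assume st: "a \<le> s" "s \<le> t" "t \<le> b"
  have "(f' has_integral (f t - f s)) {s..t}"
    using st assms(1) by (intro fundamental_theorem_of_calculus)
      (auto intro!: has_vector_derivative_within_subset[of f _ _ "{a..b}" "{s..t}"])
  then show "f t - f s = (LINT r:{s..t}|lebesgue. f' r)"
    using set_lebesgue_integral_eq_integral(2)[OF set_integrable_subset[OF int, of "{s..t}"]] st
    by (simp add: integral_unique)
qed

text \<open>Vector identities are tested against all \<open>w\<close>; in this way scalar calculus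
  and the weak formulation, both tested, yield statements about vector integrals.\<close>

lemma primitive_on_inner_iff:
  fixes x \<psi> :: "real \<Rightarrow> 'a::{real_inner,banach,second_countable_topology}"
  assumes "set_integrable lebesgue {a..b} \<psi>"
    and "\<And>w. primitive_on a b (\<lambda>t. x t \<bullet> w) (\<lambda>t. \<psi> t \<bullet> w)"
  shows "primitive_on a b x \<psi>"
  unfolding primitive_on_def
proof (intro conjI allI impI assms(1))
  fix s t assume st: "a \<le> s" "s \<le> t" "t \<le> b"
  have "(x t - x s) \<bullet> w = (LINT r:{s..t}|lebesgue. \<psi> r) \<bullet> w" for w
  proof -
    have "(x t - x s) \<bullet> w = (LINT r:{s..t}|lebesgue. \<psi> r \<bullet> w)"
      using primitive_onD(2)[OF assms(2) st] by (simp add: inner_diff_left)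
    also have "\<dots> = (LINT r:{s..t}|lebesgue. \<psi> r) \<bullet> w"
      using st by (intro set_integral_linear bounded_linear_inner_left
          set_integrable_subset[OF assms(1)]) auto
    finally show ?thesis .
  qed
  then show "x t - x s = (LINT r:{s..t}|lebesgue. \<psi> r)"
    using vector_eq_rdot by blast
qed

lemma distr_lebesgue_reflect: "distr lebesgue lebesgue (\<lambda>x. c - x) = (lebesgue :: real measure)"
  using lebesgue_real_affine[of "-1" c] by (simp add: density_1)

lemma measurable_lebesgue_reflect: "(\<lambda>x. c - x) \<in> lebesgue \<rightarrow>\<^sub>M (lebesgue :: real measure)"
  using lebesgue_affine_measurable[where c="\<lambda>x::real. -1" and t=c] by simp

lemma integrable_lebesgue_reflect:
  fixes f :: "real \<Rightarrow> 'a::{banach,second_countable_topology}"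
  assumes "integrable lebesgue f"
  shows "integrable lebesgue (\<lambda>x. f (c - x))"
  using assms distr_lebesgue_reflect[of c] measurable_lebesgue_reflect[of c]
  by (metis integrable_distr)

lemma integral_lebesgue_reflect:
  fixes f :: "real \<Rightarrow> 'a::{banach,second_countable_topology}"
  assumes "f \<in> borel_measurable lebesgue"
  shows "(LINT x|lebesgue. f (c - x)) = (LINT x|lebesgue. f x)"
  using integral_distr[OF measurable_lebesgue_reflect assms, of c]
  by (simp add: distr_lebesgue_reflect)

lemma primitive_on_reflect:
  assumes "primitive_on a b x \<psi>"
  shows "primitive_on (c - b) (c - a) (\<lambda>t. x (c - t)) (\<lambda>t. - \<psi> (c - t))"
proof -
  have ind: "indicat_real {s..t} (c - r) = indicat_real {c - t..c - s} r" for s t r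
    by (auto simp: indicator_def)
  have reflect: "set_integrable lebesgue {c - t..c - s} (\<lambda>r. \<psi> (c - r))"
    "(LINT r:{c - t..c - s}|lebesgue. \<psi> (c - r)) = (LINT r:{s..t}|lebesgue. \<psi> r)"
    if "set_integrable lebesgue {s..t} \<psi>" for s t
    using integrable_lebesgue_reflect[OF that[unfolded set_integrable_def], of c]
      integral_lebesgue_reflect[OF borel_measurable_integrable[OF that[unfolded set_integrable_def]], of c] that
    by (simp_all add: ind set_integrable_def set_lebesgue_integral_def)
  have int: "set_integrable lebesgue {c - b..c - a} (\<lambda>t. \<psi> (c - t))"
    using reflect(1)[OF primitive_onD(1)[OF assms]] .
  have "x (c - t) - x (c - s) = (LINT r:{s..t}|lebesgue. - \<psi> (c - r))"
    if st: "c - b \<le> s" "s \<le> t" "t \<le> c - a" for s t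
  proof -
    have "x (c - s) - x (c - t) = (LINT r:{s..t}|lebesgue. \<psi> (c - r))"
      using primitive_onD(2)[OF assms, of "c - t" "c - s"] reflect(2)[of "c - t" "c - s"]
        primitive_onD(3)[OF assms, of "c - t" "c - s"] st by simp
    then show ?thesis
      using set_integral_uminus[OF set_integrable_subset[OF int, of "{s..t}"]] st
      by (simp add: algebra_simps)
  qed
  then show ?thesis
    using int set_integrable_scaleR_right[of "-1" lebesgue "{c - b..c - a}" "\<lambda>t. \<psi> (c - t)"]
    by (simp add: primitive_on_def)
qed

lemma primitive_on_mono:
  fixes F :: "real \<Rightarrow> real"
  assumes F: "primitive_on a b F \<psi>" and st: "a \<le> s" "s \<le> t" "t \<le> b"
    and g: "set_integrable lebesgue {s..t} g"
    and le: "AE r in lebesgue. r \<in> {s..t} \<longrightarrow> \<psi> r \<le> g r"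
  shows "F t - F s \<le> (LINT r:{s..t}|lebesgue. g r)"
  using primitive_onD(2)[OF F st] set_integral_mono_AE[OF primitive_onD(3)[OF F st(1,3)] g le]
  by simp

lemma primitive_on_antimono:
  fixes F :: "real \<Rightarrow> real"
  assumes F: "primitive_on a b F \<psi>" and st: "a \<le> s" "s \<le> t" "t \<le> b"
    and le: "AE r in lebesgue. r \<in> {a..b} \<longrightarrow> \<psi> r \<le> 0"
  shows "F t \<le> F s"
proof -
  have "AE r in lebesgue. r \<in> {s..t} \<longrightarrow> \<psi> r \<le> 0"
    using le st by (auto elim: eventually_mono)
  then show ?thesis
    using primitive_on_mono[OF F st, of "\<lambda>_. 0"] by simp
qed

section \<open>Almost-everywhere arguments and square integrable functions\<close>

text \<open>Lebesgue measure is complete, so every preimage changes only by a subset of a null set,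
  which is itself measurable.\<close>

lemma borel_measurable_lebesgue_cong_AE:
  fixes f g :: "real \<Rightarrow> 'a::topological_space"
  assumes f: "f \<in> borel_measurable lebesgue" and ae: "AE x in lebesgue. f x = g x"
  shows "g \<in> borel_measurable lebesgue"
proof (rule measurableI)
  fix B :: "'a set" assume B: "B \<in> sets borel"
  obtain Z where Z: "Z \<in> null_sets lebesgue" "\<And>x. x \<notin> Z \<Longrightarrow> f x = g x"
    using ae unfolding completion.AE_iff_null_sets by auto
  have eq: "g -` B = (f -` B - Z) \<union> (g -` B \<inter> Z)"
    using Z(2) by auto
  have "f -` B \<in> sets lebesgue"
    using measurable_sets[OF f B] by simp
  moreover have "g -` B \<inter> Z \<in> sets lebesgue"
    using Z(1) null_sets_completion_subset[of "g -` B \<inter> Z" Z lborel] by (auto simp: null_setsD2)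
  ultimately have "(f -` B - Z) \<union> (g -` B \<inter> Z) \<in> sets lebesgue"
    by (intro sets.Un sets.Diff null_setsD2[OF Z(1)])
  then have "g -` B \<in> sets lebesgue"
    by (subst eq)
  then show "g -` B \<inter> space lebesgue \<in> sets lebesgue"
    by simp
qed auto

lemma set_borel_measurable_cong_AE:
  fixes f g :: "real \<Rightarrow> 'a::real_normed_vector"
  assumes "set_borel_measurable lebesgue I f" "AE t in lebesgue. t \<in> I \<longrightarrow> f t = g t"
  shows "set_borel_measurable lebesgue I g"
  using assms(1) unfolding set_borel_measurable_def
  by (rule borel_measurable_lebesgue_cong_AE) (use assms(2) in \<open>auto simp: indicator_def\<close>)

lemma set_integral_dominated_convergence:
  fixes f :: "real \<Rightarrow> 'a::{banach,second_countable_topology}"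
  assumes f: "set_borel_measurable lebesgue I f" and s: "\<And>n. set_borel_measurable lebesgue I (s n)"
    and w: "set_integrable lebesgue I w"
    and lim: "AE t in lebesgue. t \<in> I \<longrightarrow> (\<lambda>n. s n t) \<longlonglongrightarrow> f t"
    and bound: "\<And>n. AE t in lebesgue. t \<in> I \<longrightarrow> norm (s n t) \<le> w t"
  shows "(\<lambda>n. LINT t:I|lebesgue. s n t) \<longlonglongrightarrow> (LINT t:I|lebesgue. f t)"
  unfolding set_lebesgue_integral_def
proof (rule integral_dominated_convergence)
  show "(\<lambda>t. indicat_real I t *\<^sub>R f t) \<in> borel_measurable lebesgue"
    and "(\<lambda>t. indicat_real I t *\<^sub>R s n t) \<in> borel_measurable lebesgue" for n
    using f s by (auto simp: set_borel_measurable_def)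
  show "integrable lebesgue (\<lambda>t. indicat_real I t *\<^sub>R w t)"
    using w by (simp add: set_integrable_def)
  show "AE t in lebesgue. (\<lambda>n. indicat_real I t *\<^sub>R s n t) \<longlonglongrightarrow> indicat_real I t *\<^sub>R f t"
    using lim by (rule AE_mp) (auto intro!: AE_I2 simp: indicator_def)
  show "AE t in lebesgue. norm (indicat_real I t *\<^sub>R s n t) \<le> indicat_real I t *\<^sub>R w t" for n
    using bound[of n] by (rule AE_mp) (auto intro!: AE_I2 simp: indicator_def)
qed

definition sq_integrable :: "real set \<Rightarrow> (real \<Rightarrow> 'a::real_normed_vector) \<Rightarrow> bool" where
  "sq_integrable I f \<longleftrightarrow> set_borel_measurable lebesgue I f \<and>
     set_integrable lebesgue I (\<lambda>t. (norm (f t))\<^sup>2)"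

lemma L2_loc_iff: "L2_loc J f \<longleftrightarrow> (\<forall>a b. {a..b} \<subseteq> J \<longrightarrow> sq_integrable {a..b} f)"
  by (simp add: L2_loc_def sq_integrable_def borel_measurable_restrict_space_iff
      integrable_restrict_space set_borel_measurable_def set_integrable_def)

lemma sq_integrable_subset:
  fixes f :: "real \<Rightarrow> 'a::{banach,second_countable_topology}"
  assumes "sq_integrable I f" "I' \<subseteq> I" "I' \<in> sets lebesgue"
  shows "sq_integrable I' f"
  using assms set_borel_measurable_subset[of lebesgue I f I']
    set_integrable_subset[of lebesgue I "\<lambda>t. (norm (f t))\<^sup>2" I']
  by (auto simp: sq_integrable_def)

lemma set_borel_measurable_norm_sq:
  "set_borel_measurable M I f \<Longrightarrow> set_borel_measurable M I (\<lambda>t. (norm (f t))\<^sup>2)"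
  using set_borel_measurable_bilinear[OF set_borel_measurable_norm set_borel_measurable_norm
      bounded_bilinear_mult] by (simp add: power2_eq_square)

lemma sq_integrable_bound:
  assumes "set_borel_measurable lebesgue I f" "set_integrable lebesgue I g"
    and "AE t in lebesgue. t \<in> I \<longrightarrow> (norm (f t))\<^sup>2 \<le> g t"
  shows "sq_integrable I f"
  unfolding sq_integrable_def
proof (intro conjI assms(1))
  show "set_integrable lebesgue I (\<lambda>t. (norm (f t))\<^sup>2)"
    by (rule set_integrable_bound[OF assms(2) set_borel_measurable_norm_sq[OF assms(1)]])
      (use assms(3) in \<open>auto elim!: eventually_mono\<close>)
qed

lemma sq_integrable_linear:
  assumes "sq_integrable I f" "bounded_linear T"
  shows "sq_integrable I (\<lambda>t. T (f t))"
proof -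
  obtain K where K: "K > 0" "\<And>x. norm (T x) \<le> norm x * K"
    using bounded_linear.pos_bounded[OF assms(2)] by blast
  show ?thesis
  proof (rule sq_integrable_bound[of _ _ "\<lambda>t. K\<^sup>2 * (norm (f t))\<^sup>2"])
    show "set_borel_measurable lebesgue I (\<lambda>t. T (f t))"
      using assms set_borel_measurable_linear by (auto simp: sq_integrable_def)
    show "set_integrable lebesgue I (\<lambda>t. K\<^sup>2 * (norm (f t))\<^sup>2)"
      using assms(1) by (simp add: sq_integrable_def)
    show "AE t in lebesgue. t \<in> I \<longrightarrow> (norm (T (f t)))\<^sup>2 \<le> K\<^sup>2 * (norm (f t))\<^sup>2"
      using K by (intro AE_I2 impI) (metis norm_ge_zero power_mono power_mult_distrib mult.commute)
  qed
qed

lemma sq_integrable_add: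
  fixes f g :: "real \<Rightarrow> 'a::{banach,second_countable_topology}"
  assumes "sq_integrable I f" "sq_integrable I g"
  shows "sq_integrable I (\<lambda>t. f t + g t)"
proof (rule sq_integrable_bound[of _ _ "\<lambda>t. 2 * (norm (f t))\<^sup>2 + 2 * (norm (g t))\<^sup>2"])
  show "set_borel_measurable lebesgue I (\<lambda>t. f t + g t)"
    using assms by (auto simp: sq_integrable_def intro: set_borel_measurable_add)
  show "set_integrable lebesgue I (\<lambda>t. 2 * (norm (f t))\<^sup>2 + 2 * (norm (g t))\<^sup>2)"
    using assms by (auto simp: sq_integrable_def)
  have "(norm (f t + g t))\<^sup>2 \<le> 2 * (norm (f t))\<^sup>2 + 2 * (norm (g t))\<^sup>2" for t
  proof -
    have "(norm (f t + g t))\<^sup>2 \<le> (norm (f t) + norm (g t))\<^sup>2"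
      by (intro power_mono norm_triangle_ineq) auto
    also have "\<dots> \<le> 2 * (norm (f t))\<^sup>2 + 2 * (norm (g t))\<^sup>2"
      using sum_squares_bound[of "norm (f t)" "norm (g t)"] by (simp add: power2_sum)
    finally show ?thesis .
  qed
  then show "AE t in lebesgue. t \<in> I \<longrightarrow> (norm (f t + g t))\<^sup>2 \<le> 2 * (norm (f t))\<^sup>2 + 2 * (norm (g t))\<^sup>2"
    by simp
qed

lemma sq_integrable_bilinear:
  fixes f :: "real \<Rightarrow> 'a::{real_normed_vector,second_countable_topology}"
    and g :: "real \<Rightarrow> 'b::{real_normed_vector,second_countable_topology}"
    and pr :: "'a \<Rightarrow> 'b \<Rightarrow> 'c::{banach,second_countable_topology}"
  assumes "sq_integrable I f" "sq_integrable I g" "bounded_bilinear pr"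
  shows "set_integrable lebesgue I (\<lambda>t. pr (f t) (g t))"
proof -
  obtain K where K: "K > 0" "\<And>x y. norm (pr x y) \<le> norm x * norm y * K"
    using bounded_bilinear.pos_bounded[OF assms(3)] by blast
  show ?thesis
  proof (rule set_integrable_bound[of _ _ "\<lambda>t. ((norm (f t))\<^sup>2 + (norm (g t))\<^sup>2) * K"])
    show "set_integrable lebesgue I (\<lambda>t. ((norm (f t))\<^sup>2 + (norm (g t))\<^sup>2) * K)"
      using assms by (auto simp: sq_integrable_def)
    show "set_borel_measurable lebesgue I (\<lambda>t. pr (f t) (g t))"
      using assms set_borel_measurable_bilinear[of lebesgue I f g pr] by (auto simp: sq_integrable_def)
    have "norm (pr (f t) (g t)) \<le> norm (((norm (f t))\<^sup>2 + (norm (g t))\<^sup>2) * K)" for t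
    proof -
      have "norm (f t) * norm (g t) \<le> (norm (f t))\<^sup>2 + (norm (g t))\<^sup>2"
        using sum_squares_bound[of "norm (f t)" "norm (g t)"]
          mult_nonneg_nonneg[OF norm_ge_zero[of "f t"] norm_ge_zero[of "g t"]] by linarith
      then have "norm (f t) * norm (g t) * K \<le> ((norm (f t))\<^sup>2 + (norm (g t))\<^sup>2) * K"
        using K(1) by (intro mult_right_mono) auto
      then show ?thesis
        using order_trans[OF K(2)[of "f t" "g t"]] K(1) by simp
    qed
    then show "AE t in lebesgue. t \<in> I \<longrightarrow>
        norm (pr (f t) (g t)) \<le> norm (((norm (f t))\<^sup>2 + (norm (g t))\<^sup>2) * K)"
      by simp
  qed
qed

lemma sq_integrable_cong_AE:
  fixes f g :: "real \<Rightarrow> 'a::{banach,second_countable_topology}"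
  assumes "sq_integrable I f" "AE t in lebesgue. t \<in> I \<longrightarrow> f t = g t"
  shows "sq_integrable I g"
proof (rule sq_integrable_bound[of _ _ "\<lambda>t. (norm (f t))\<^sup>2"])
  show "set_borel_measurable lebesgue I g"
    using assms set_borel_measurable_cong_AE by (auto simp: sq_integrable_def)
  show "set_integrable lebesgue I (\<lambda>t. (norm (f t))\<^sup>2)"
    using assms(1) by (simp add: sq_integrable_def)
  show "AE t in lebesgue. t \<in> I \<longrightarrow> (norm (g t))\<^sup>2 \<le> (norm (f t))\<^sup>2"
    using assms(2) by (auto elim: eventually_mono)
qed

lemma sq_integrable_continuous:
  fixes f :: "real \<Rightarrow> 'a::{banach,second_countable_topology}"
  assumes "continuous_on {a..b} f"
  shows "sq_integrable {a..b} f"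
  unfolding sq_integrable_def
  using assms by (auto intro!: set_borel_measurable_continuous set_integrable_continuous continuous_intros)

lemma sq_integrable_imp_integrable:
  fixes f :: "real \<Rightarrow> 'a::{banach,second_countable_topology}"
  assumes "sq_integrable {a..b} f"
  shows "set_integrable lebesgue {a..b} f"
  using sq_integrable_bilinear[OF sq_integrable_continuous[of a b "\<lambda>_. 1 :: real"] assms
      bounded_bilinear_scaleR] by simp

lemma sq_integrable_Un:
  fixes f :: "real \<Rightarrow> 'a::{banach,second_countable_topology}"
  assumes "sq_integrable {a..b} f" "sq_integrable {b..c} f" "a \<le> b" "b \<le> c"
  shows "sq_integrable {a..c} f"
proof -
  have eq: "{a..c} = {a..b} \<union> {b..c}" using assms(3,4) by auto
  have "set_borel_measurable lebesgue {a..c} f"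
  proof -
    \<comment> \<open>The second interval is half open so that the common endpoint \<open>b\<close>
      is counted once.\<close>
    have "(\<lambda>t. indicat_real {a..b} t *\<^sub>R f t + indicat_real {b<..c} t *\<^sub>R f t) \<in> borel_measurable lebesgue"
    proof (rule borel_measurable_add)
      have "{b<..c} \<subseteq> {b..c}" by auto
      then show "(\<lambda>t. indicat_real {b<..c} t *\<^sub>R f t) \<in> borel_measurable lebesgue"
        using set_borel_measurable_subset[of lebesgue "{b..c}" f "{b<..c}"] assms(2)
        by (simp add: sq_integrable_def set_borel_measurable_def)
    qed (use assms(1) in \<open>simp add: sq_integrable_def set_borel_measurable_def\<close>)
    moreover have "indicat_real {a..b} t *\<^sub>R f t + indicat_real {b<..c} t *\<^sub>R f t = indicat_real {a..c} t *\<^sub>R f t" for t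
      using assms(3,4) by (auto simp: indicator_def)
    ultimately show ?thesis
      by (simp add: set_borel_measurable_def)
  qed
  moreover have "set_integrable lebesgue {a..c} (\<lambda>t. (norm (f t))\<^sup>2)"
    unfolding eq using assms by (intro set_integrable_Un) (auto simp: sq_integrable_def)
  ultimately show ?thesis by (simp add: sq_integrable_def)
qed

lemma primitive_on_combine:
  assumes "primitive_on a b x \<psi>" "primitive_on b c x \<psi>" "a \<le> b" "b \<le> c"
  shows "primitive_on a c x \<psi>"
proof -
  have eq: "{a..c} = {a..b} \<union> {b..c}" using assms(3,4) by auto
  have int: "set_integrable lebesgue {a..c} \<psi>"
    unfolding eq using assms by (intro set_integrable_Un) (auto simp: primitive_on_def)
  have "x t - x s = (LINT r:{s..t}|lebesgue. \<psi> r)" if st: "a \<le> s" "s \<le> t" "t \<le> c" for s t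
  proof -
    consider "t \<le> b" | "b \<le> s" | "s \<le> b" "b \<le> t" by linarith
    then show ?thesis
    proof cases
      case 3
      then show ?thesis
        using primitive_onD(2)[OF assms(1), of s b] primitive_onD(2)[OF assms(2), of b t] st assms(3,4)
          set_integral_combine[OF set_integrable_subset[OF int, of "{s..t}"], of b]
        by (simp add: algebra_simps)
    qed (use st primitive_onD(2)[OF assms(1)] primitive_onD(2)[OF assms(2)] in auto)
  qed
  then show ?thesis using int by (simp add: primitive_on_def)
qed

section \<open>The energy identity\<close>

context pivot_space
begin

text \<open>The class of functions in L^2 with values in V and time derivative in L^2 with values in
  V'. The derivative is stored as its Riesz representative \<open>\<psi>\<close>, so
  \<open>jstar y\<close> is absolutely continuous in V.\<close>

definition regular :: "real \<Rightarrow> real \<Rightarrow> (real \<Rightarrow> 'h) \<Rightarrow> (real \<Rightarrow> 'v) \<Rightarrow> (real \<Rightarrow> 'v) \<Rightarrow> bool" where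
  "regular a b y v \<psi> \<longleftrightarrow> continuous_on {a..b} y \<and> sq_integrable {a..b} v \<and> sq_integrable {a..b} \<psi> \<and>
     (AE t in lebesgue. t \<in> {a..b} \<longrightarrow> y t = j (v t)) \<and> primitive_on a b (\<lambda>t. jstar (y t)) \<psi>"

lemma regularD:
  assumes "regular a b y v \<psi>"
  shows "continuous_on {a..b} y" "sq_integrable {a..b} v" "sq_integrable {a..b} \<psi>"
    "AE t in lebesgue. t \<in> {a..b} \<longrightarrow> y t = j (v t)" "primitive_on a b (\<lambda>t. jstar (y t)) \<psi>"
  using assms by (auto simp: regular_def)

lemma bounded_bilinear_inner_N:
  assumes "l \<ge> 0" shows "bounded_bilinear (\<lambda>x y. x \<bullet> N l y)"
  by (rule bounded_bilinear.comp[OF bounded_bilinear_inner bounded_linear_ident bounded_linear_N[OF assms]])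

lemma primitive_on_inner_N:
  assumes x: "primitive_on a b x \<psi>" and l: "l \<ge> 0"
  shows "primitive_on a b (\<lambda>t. x t \<bullet> N l (x t)) (\<lambda>t. 2 * (\<psi> t \<bullet> N l (x t)))"
proof -
  have "x t \<bullet> N l (\<psi> t) = \<psi> t \<bullet> N l (x t)" for t
    using N_sym[OF l, of "\<psi> t" "x t"] by (metis inner_commute)
  then show ?thesis
    using primitive_on_bilinear[OF x x bounded_bilinear_inner_N[OF l]] by simp
qed

text \<open>Only \<open>jstar y\<close> can be differentiated, so the square of the H-norm is
  approximated by \<open>F n\<close>, a quadratic form in \<open>jstar y\<close> with
  \<open>n\<close> times \<open>N n\<close> standing in for the inverse of \<open>S\<close>. Where
  \<open>y = j v\<close>, \<open>N_S\<close> rewrites both \<open>F n\<close> and its derivative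
  through \<open>v - N n v\<close>, which tends to \<open>v\<close> and is bounded by
  \<open>2 * norm v\<close>. Dominated convergence gives the identity between any two such times;
  these are dense, and continuity of \<open>y\<close> does the rest.\<close>

lemma energy_identity:
  assumes reg: "regular a b y v \<psi>"
  shows "primitive_on a b (\<lambda>t. y t \<bullet> y t) (\<lambda>t. 2 * (\<psi> t \<bullet> v t))"
proof -
  note r = regularD[OF reg]
  have int: "set_integrable lebesgue {a..b} (\<lambda>t. 2 * (\<psi> t \<bullet> v t))"
    using sq_integrable_bilinear[OF r(3) r(2) bounded_bilinear_inner] by simp
  have good: "y t \<bullet> y t - y s \<bullet> y s = (LINT r:{s..t}|lebesgue. 2 * (\<psi> r \<bullet> v r))"
    if st: "a \<le> s" "s \<le> t" "t \<le> b" and y: "y s = j (v s)" "y t = j (v t)" for s t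
  proof -
    define F where "F n t = real n * (jstar (y t) \<bullet> N (real n) (jstar (y t)))" for n t
    have meas: "set_borel_measurable lebesgue {s..t} v" "set_borel_measurable lebesgue {s..t} \<psi>"
      using st sq_integrable_subset[OF r(2), of "{s..t}"] sq_integrable_subset[OF r(3), of "{s..t}"]
      by (auto simp: sq_integrable_def)
    have F_lim: "(\<lambda>n. F n r) \<longlonglongrightarrow> y r \<bullet> y r" if "y r = j (v r)" for r
    proof -
      have "F n r = S (v r) \<bullet> (v r - N (real n) (v r))" for n
        unfolding F_def that S_def[symmetric]
        using N_S[of "real n" "v r"] by (metis inner_scaleR_right of_nat_0_le_iff)
      moreover have "(\<lambda>n. S (v r) \<bullet> (v r - N (real n) (v r))) \<longlonglongrightarrow> S (v r) \<bullet> (v r - 0)"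
        by (intro tendsto_intros N_tendsto_0)
      ultimately show ?thesis
        using that by (simp add: S_inner)
    qed
    have F_diff: "F n t - F n s = (LINT r:{s..t}|lebesgue. 2 * (\<psi> r \<bullet> (v r - N (real n) (v r))))" for n
    proof -
      have "primitive_on a b (\<lambda>t. F n t) (\<lambda>t. real n * (2 * (\<psi> t \<bullet> N (real n) (jstar (y t)))))"
        unfolding F_def
        by (rule primitive_on_linear[OF primitive_on_inner_N[OF r(5)] bounded_linear_mult_right]) simp
      then have "F n t - F n s = (LINT r:{s..t}|lebesgue. real n * (2 * (\<psi> r \<bullet> N (real n) (jstar (y r)))))"
        using st by (rule primitive_onD(2))
      also have "\<dots> = (LINT r:{s..t}|lebesgue. 2 * (\<psi> r \<bullet> (v r - N (real n) (v r))))"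
        unfolding set_lebesgue_integral_def
      proof (rule integral_cong_AE)
        show "(\<lambda>r. indicat_real {s..t} r *\<^sub>R (real n * (2 * (\<psi> r \<bullet> N (real n) (jstar (y r)))))) \<in> borel_measurable lebesgue"
          using primitive_onD(3)[OF \<open>primitive_on a b (\<lambda>t. F n t) _\<close> st(1,3)]
          by (simp add: set_integrable_def)
        have "set_borel_measurable lebesgue {s..t} (\<lambda>r. \<psi> r \<bullet> (v r - N (real n) (v r)))"
          by (intro set_borel_measurable_bilinear[OF meas(2) _ bounded_bilinear_inner]
              set_borel_measurable_linear[OF meas(1)] bounded_linear_sub bounded_linear_ident
              bounded_linear_N) simp
        from set_borel_measurable_linear[OF this bounded_linear_mult_right[of 2]]
        show "(\<lambda>r. indicat_real {s..t} r *\<^sub>R (2 * (\<psi> r \<bullet> (v r - N (real n) (v r))))) \<in> borel_measurable lebesgue"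
          by (simp add: set_borel_measurable_def)
        have *: "real n * (\<psi> r \<bullet> N (real n) (jstar (j (v r)))) = \<psi> r \<bullet> (v r - N (real n) (v r))" for r
          using N_S[of "real n" "v r"] unfolding S_def by (metis inner_scaleR_right of_nat_0_le_iff)
        have "AE r in lebesgue. r \<in> {s..t} \<longrightarrow> y r = j (v r)"
          using r(4) st by (auto elim: eventually_mono)
        then show "AE r in lebesgue. indicat_real {s..t} r *\<^sub>R (real n * (2 * (\<psi> r \<bullet> N (real n) (jstar (y r)))))
            = indicat_real {s..t} r *\<^sub>R (2 * (\<psi> r \<bullet> (v r - N (real n) (v r))))"
          by (rule eventually_mono) (auto simp: indicator_def *[symmetric])
      qed
      finally show ?thesis .
    qed
    have "(\<lambda>n. LINT r:{s..t}|lebesgue. 2 * (\<psi> r \<bullet> (v r - N (real n) (v r))))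
        \<longlonglongrightarrow> (LINT r:{s..t}|lebesgue. 2 * (\<psi> r \<bullet> v r))"
    proof (rule set_integral_dominated_convergence[where w="\<lambda>r. 4 * (norm (\<psi> r) * norm (v r))"])
      show "set_borel_measurable lebesgue {s..t} (\<lambda>r. 2 * (\<psi> r \<bullet> v r))"
        using set_integrable_subset[OF int, of "{s..t}"] st by (intro set_integrable_imp_measurable) auto
      show "set_borel_measurable lebesgue {s..t} (\<lambda>r. 2 * (\<psi> r \<bullet> (v r - N (real n) (v r))))" for n
        by (intro set_borel_measurable_linear[OF _ bounded_linear_mult_right]
              set_borel_measurable_bilinear[OF meas(2) _ bounded_bilinear_inner]
              set_borel_measurable_linear[OF meas(1)] bounded_linear_sub bounded_linear_ident
              bounded_linear_N) simp
      have "sq_integrable {s..t} (\<lambda>r. norm (\<psi> r))" "sq_integrable {s..t} (\<lambda>r. norm (v r))"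
        using st sq_integrable_subset[OF r(2), of "{s..t}"] sq_integrable_subset[OF r(3), of "{s..t}"]
        by (auto simp: sq_integrable_def set_borel_measurable_norm)
      from sq_integrable_bilinear[OF this bounded_bilinear_mult]
      show "set_integrable lebesgue {s..t} (\<lambda>r. 4 * (norm (\<psi> r) * norm (v r)))"
        by simp
      have "(\<lambda>n. 2 * (\<psi> r \<bullet> (v r - N (real n) (v r)))) \<longlonglongrightarrow> 2 * (\<psi> r \<bullet> (v r - 0))" for r
        by (intro tendsto_intros N_tendsto_0)
      then show "AE r in lebesgue. r \<in> {s..t} \<longrightarrow>
          (\<lambda>n. 2 * (\<psi> r \<bullet> (v r - N (real n) (v r)))) \<longlonglongrightarrow> 2 * (\<psi> r \<bullet> v r)"
        by simp
      have "\<bar>\<psi> r \<bullet> (v r - N (real n) (v r))\<bar> \<le> 2 * (norm (\<psi> r) * norm (v r))" for n r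
      proof -
        have "\<bar>\<psi> r \<bullet> (v r - N (real n) (v r))\<bar> \<le> norm (\<psi> r) * norm (v r - N (real n) (v r))"
          by (rule Cauchy_Schwarz_ineq2)
        also have "\<dots> \<le> norm (\<psi> r) * (2 * norm (v r))"
          using norm_triangle_ineq4[of "v r" "N (real n) (v r)"] norm_N_le[of "real n" "v r"]
          by (intro mult_left_mono) auto
        finally show ?thesis by simp
      qed
      then show "AE r in lebesgue. r \<in> {s..t} \<longrightarrow>
          norm (2 * (\<psi> r \<bullet> (v r - N (real n) (v r)))) \<le> 4 * (norm (\<psi> r) * norm (v r))" for n
        by (intro AE_I2 impI) (simp add: abs_mult)
    qed
    moreover have "(\<lambda>n. F n t - F n s) \<longlonglongrightarrow> y t \<bullet> y t - y s \<bullet> y s"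
      by (intro tendsto_diff F_lim y)
    ultimately show ?thesis
      unfolding F_diff by (rule LIMSEQ_unique[rotated])
  qed
  define G where "G t = y t \<bullet> y t - (LINT r:{a..t}|lebesgue. 2 * (\<psi> r \<bullet> v r))" for t
  have contG: "continuous_on {a..b} G"
    unfolding G_def using r(1) int by (intro continuous_intros set_integral_continuous_upper)
  have sub: "(LINT r:{a..t}|lebesgue. 2 * (\<psi> r \<bullet> v r)) = (LINT r:{a..s}|lebesgue. 2 * (\<psi> r \<bullet> v r))
      + (LINT r:{s..t}|lebesgue. 2 * (\<psi> r \<bullet> v r))" if "a \<le> s" "s \<le> t" "t \<le> b" for s t
    using that by (intro set_integral_combine set_integrable_subset[OF int]) auto
  have G_eq: "G t = G s" if "a \<le> s" "s \<le> t" "t \<le> b" "y s = j (v s)" "y t = j (v t)" for s t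
    using good[OF that] sub[OF that(1-3)] by (simp add: G_def)
  have "G t = G s" if st: "a \<le> s" "s < t" "t \<le> b" for s t
  proof -
    \<comment> \<open>Otherwise almost every point of a nonempty open interval would lie in the
      closed set \<open>{}\<close>.\<close>
    have "\<exists>q\<in>{a<..<b}. y q = j (v q)"
    proof (rule ccontr)
      assume "\<not> ?thesis"
      then have "AE q \<in> {a<..<b} in lebesgue. q \<in> {}"
        using r(4) by (intro eventually_mono[OF r(4)]) auto
      then have "(a + b) / 2 \<in> {}"
        by (rule mem_closed_if_AE_lebesgue_open[OF open_greaterThanLessThan closed_empty])
          (use st in auto)
      then show False by simp
    qed
    then obtain q where q: "q \<in> {a<..<b}" "y q = j (v q)" by blast
    \<comment> \<open>A closed set containing almost every point of the open interval contains all
      of it, and then also its closure.\<close>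
    define C where "C = {r \<in> {a..b}. G r = G q}"
    have C: "closed C"
      unfolding C_def using contG by (intro continuous_closed_preimage_constant) auto
    have ae: "AE r \<in> {a<..<b} in lebesgue. r \<in> C"
      using r(4)
    proof (rule eventually_mono, intro impI)
      fix r assume *: "r \<in> {a..b} \<longrightarrow> y r = j (v r)" "r \<in> {a<..<b}"
      then show "r \<in> C"
        using G_eq[of r q] G_eq[of q r] q by (cases "r \<le> q") (auto simp: C_def)
    qed
    have "{a<..<b} \<subseteq> C"
      using mem_closed_if_AE_lebesgue_open[OF _ C ae] by auto
    then have "closure {a<..<b} \<subseteq> C"
      using C by (rule closure_minimal)
    then have "{a..b} \<subseteq> C"
      using st by (simp add: closure_greaterThanLessThan)
    then have "s \<in> C" "t \<in> C"
      using st by auto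
    then show ?thesis
      by (simp add: C_def)
  qed
  then have "y t \<bullet> y t - y s \<bullet> y s = (LINT r:{s..t}|lebesgue. 2 * (\<psi> r \<bullet> v r))"
    if "a \<le> s" "s \<le> t" "t \<le> b" for s t
  proof (cases "s = t")
    case True
    then show ?thesis using sub[of s s] that by simp
  next
    case False
    then have "G t = G s" using \<open>\<And>s t. a \<le> s \<Longrightarrow> s < t \<Longrightarrow> t \<le> b \<Longrightarrow> G t = G s\<close> that by simp
    then show ?thesis using sub[OF that] by (simp add: G_def)
  qed
  then show ?thesis
    using int by (simp add: primitive_on_def)
qed


section \<open>Weak solutions in V, energy bounds and uniqueness\<close>

text \<open>What a bound in L(V,H) + L(H,V') gives for the bilinear form of \<open>R t\<close>: in
  each term one of the two factors is measured only in H, so the perturbation is of lower order than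
  \<open>A\<close>.\<close>

definition rel_bounded :: "real \<Rightarrow> (real \<Rightarrow> 'v \<Rightarrow>\<^sub>L ('v \<Rightarrow>\<^sub>L real)) \<Rightarrow> real set \<Rightarrow> bool" where
  "rel_bounded C R I \<longleftrightarrow> (\<forall>t\<in>I. \<forall>v w. \<bar>R t v w\<bar> \<le> C * (norm v * norm (j w) + norm (j v) * norm w))"

lemma rel_boundedD:
  "rel_bounded C R I \<Longrightarrow> t \<in> I \<Longrightarrow> \<bar>R t v w\<bar> \<le> C * (norm v * norm (j w) + norm (j v) * norm w)"
  by (simp add: rel_bounded_def)

lemma rel_bounded_subset: "rel_bounded C R I \<Longrightarrow> I' \<subseteq> I \<Longrightarrow> rel_bounded C R I'"
  by (auto simp: rel_bounded_def)

abbreviation rhs :: "(real \<Rightarrow> 'v \<Rightarrow>\<^sub>L ('v \<Rightarrow>\<^sub>L real)) \<Rightarrow> (real \<Rightarrow> 'h) \<Rightarrow> real \<Rightarrow> 'v \<Rightarrow> 'v" where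
  "rhs R f t v \<equiv> - v - riesz (R t v) + jstar (f t)"

text \<open>The weak equation after application of the inverse of \<open>A\<close>: in
  \<open>rhs\<close> the operator \<open>A\<close> has become the identity of V, and all terms live
  in V.\<close>

definition esol :: "(real \<Rightarrow> 'v \<Rightarrow>\<^sub>L ('v \<Rightarrow>\<^sub>L real)) \<Rightarrow> (real \<Rightarrow> 'h) \<Rightarrow> real \<Rightarrow> real \<Rightarrow> (real \<Rightarrow> 'h) \<Rightarrow> bool" where
  "esol R f a b y \<longleftrightarrow> (\<exists>v \<psi>. regular a b y v \<psi> \<and>
     (AE t in lebesgue. t \<in> {a..b} \<longrightarrow> \<psi> t = rhs R f t (v t)))"

lemma regular_subset:
  assumes "regular a b y v \<psi>" "{p..q} \<subseteq> {a..b}"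
  shows "regular p q y v \<psi>"
proof -
  note r = regularD[OF assms(1)]
  have "primitive_on p q (\<lambda>t. jstar (y t)) \<psi>"
  proof (cases "p \<le> q")
    case True
    then show ?thesis using assms(2) primitive_on_subset[OF r(5)] by auto
  next
    case False
    then show ?thesis by (auto simp: primitive_on_def)
  qed
  moreover have "AE t in lebesgue. t \<in> {p..q} \<longrightarrow> y t = j (v t)"
    using assms(2) by (intro eventually_mono[OF r(4)]) auto
  ultimately show ?thesis
    unfolding regular_def
    using sq_integrable_subset[OF r(2) assms(2)] sq_integrable_subset[OF r(3) assms(2)]
      continuous_on_subset[OF r(1) assms(2)] by auto
qed

lemma regular_cong_AE:
  assumes "regular a b y v \<psi>"
    and v: "AE t in lebesgue. t \<in> {a..b} \<longrightarrow> v t = v' t"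
    and \<psi>: "AE t in lebesgue. t \<in> {a..b} \<longrightarrow> \<psi> t = \<psi>' t"
  shows "regular a b y v' \<psi>'"
proof -
  note r = regularD[OF assms(1)]
  have s: "sq_integrable {a..b} v'" "sq_integrable {a..b} \<psi>'"
    using sq_integrable_cong_AE[OF r(2) v] sq_integrable_cong_AE[OF r(3) \<psi>] .
  have "AE t in lebesgue. t \<in> {a..b} \<longrightarrow> y t = j (v' t)"
    using r(4) v by eventually_elim auto
  moreover have "primitive_on a b (\<lambda>t. jstar (y t)) \<psi>'"
    using s(2) by (intro primitive_on_cong_AE[OF r(5) _ \<psi>]) (simp add: sq_integrable_def)
  ultimately show ?thesis
    using s r(1) by (simp add: regular_def)
qed

lemma esol_subset:
  assumes "esol R f a b y" "{p..q} \<subseteq> {a..b}"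
  shows "esol R f p q y"
proof -
  obtain v \<psi> where *: "regular a b y v \<psi>" "AE t in lebesgue. t \<in> {a..b} \<longrightarrow> \<psi> t = rhs R f t (v t)"
    using assms(1) unfolding esol_def by blast
  have "AE t in lebesgue. t \<in> {p..q} \<longrightarrow> \<psi> t = rhs R f t (v t)"
    using assms(2) by (intro eventually_mono[OF *(2)]) auto
  then show ?thesis
    unfolding esol_def using regular_subset[OF *(1) assms(2)] by blast
qed

lemma esol_continuous: "esol R f a b y \<Longrightarrow> continuous_on {a..b} y"
  by (auto simp: esol_def regular_def)

text \<open>A V-valued version that depends on \<open>y\<close> alone; the value 0 is taken only
  where \<open>y\<close> is outside V, for a solution a null set of times. Every witness
  \<open>v\<close> agrees with it almost everywhere, which allows solutions on adjacent or growing
  intervals to be glued.\<close>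

definition vrep :: "(real \<Rightarrow> 'h) \<Rightarrow> real \<Rightarrow> 'v" where
  "vrep y t = (if y t \<in> range (blinfun_apply j) then the_inv (blinfun_apply j) (y t) else 0)"

lemma vrep_eq: "y t = j v \<Longrightarrow> vrep y t = v"
  by (simp add: vrep_def the_inv_f_f[OF inj_j])

lemma esol_canonical:
  assumes "esol R f a b y"
  shows "regular a b y (vrep y) (\<lambda>t. rhs R f t (vrep y t))"
proof -
  obtain v \<psi> where *: "regular a b y v \<psi>" "AE t in lebesgue. t \<in> {a..b} \<longrightarrow> \<psi> t = rhs R f t (v t)"
    using assms unfolding esol_def by blast
  have v: "AE t in lebesgue. t \<in> {a..b} \<longrightarrow> v t = vrep y t"
    by (rule eventually_mono[OF regularD(4)[OF *(1)]]) (simp add: vrep_eq)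
  moreover have "AE t in lebesgue. t \<in> {a..b} \<longrightarrow> \<psi> t = rhs R f t (vrep y t)"
    using v *(2) by eventually_elim auto
  ultimately show ?thesis
    by (rule regular_cong_AE[OF *(1)])
qed

lemma esolI_canonical:
  "regular a b y (vrep y) (\<lambda>t. rhs R f t (vrep y t)) \<Longrightarrow> esol R f a b y"
  unfolding esol_def by (intro exI[of _ "vrep y"] exI[of _ "\<lambda>t. rhs R f t (vrep y t)"]) simp

lemma esol_combine:
  assumes "esol R f a b y" "esol R f b c y" "a \<le> b" "b \<le> c"
  shows "esol R f a c y"
proof (rule esolI_canonical)
  note r1 = regularD[OF esol_canonical[OF assms(1)]] and r2 = regularD[OF esol_canonical[OF assms(2)]]
  have eq: "{a..c} = {a..b} \<union> {b..c}" using assms(3,4) by auto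
  show "regular a c y (vrep y) (\<lambda>t. rhs R f t (vrep y t))"
    unfolding regular_def
  proof (intro conjI)
    show "continuous_on {a..c} y"
      unfolding eq using r1(1) r2(1) by (intro continuous_on_closed_Un) auto
    show "sq_integrable {a..c} (vrep y)"
      using sq_integrable_Un[OF r1(2) r2(2) assms(3,4)] .
    show "sq_integrable {a..c} (\<lambda>t. rhs R f t (vrep y t))"
      using sq_integrable_Un[OF r1(3) r2(3) assms(3,4)] .
    show "AE t in lebesgue. t \<in> {a..c} \<longrightarrow> y t = j (vrep y t)"
      using r1(4) r2(4) unfolding eq by eventually_elim auto
    show "primitive_on a c (\<lambda>t. jstar (y t)) (\<lambda>t. rhs R f t (vrep y t))"
      using primitive_on_combine[OF r1(5) r2(5) assms(3,4)] .
  qed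
qed

lemma esol_cong:
  assumes "esol R f a b y"
    and eq: "AE t in lebesgue. t \<in> {a..b} \<longrightarrow> (\<forall>v. y t = j v \<longrightarrow> rhs R f t v = rhs R' f' t v)"
  shows "esol R' f' a b y"
proof -
  obtain v \<psi> where *: "regular a b y v \<psi>" "AE t in lebesgue. t \<in> {a..b} \<longrightarrow> \<psi> t = rhs R f t (v t)"
    using assms(1) unfolding esol_def by blast
  have "AE t in lebesgue. t \<in> {a..b} \<longrightarrow> \<psi> t = rhs R' f' t (v t)"
    using *(2) eq regularD(4)[OF *(1)] by eventually_elim auto
  then show ?thesis
    unfolding esol_def using *(1) by blast
qed

lemma regular_lin:
  assumes "regular a b y v \<psi>" "regular a b z w \<phi>"
  shows "regular a b (\<lambda>t. y t + c *\<^sub>R z t) (\<lambda>t. v t + c *\<^sub>R w t) (\<lambda>t. \<psi> t + c *\<^sub>R \<phi> t)"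
proof -
  note r1 = regularD[OF assms(1)] and r2 = regularD[OF assms(2)]
  show ?thesis
    unfolding regular_def
  proof (intro conjI)
    show "continuous_on {a..b} (\<lambda>t. y t + c *\<^sub>R z t)"
      using r1(1) r2(1) by (intro continuous_intros)
    show "sq_integrable {a..b} (\<lambda>t. v t + c *\<^sub>R w t)" "sq_integrable {a..b} (\<lambda>t. \<psi> t + c *\<^sub>R \<phi> t)"
      by (intro sq_integrable_add r1 sq_integrable_linear[OF r2(2)] sq_integrable_linear[OF r2(3)]
          bounded_linear_scaleR_right)+
    show "AE t in lebesgue. t \<in> {a..b} \<longrightarrow> y t + c *\<^sub>R z t = j (v t + c *\<^sub>R w t)"
      using r1(4) r2(4) by eventually_elim (auto simp: blinfun.bilinear_simps)
    show "primitive_on a b (\<lambda>t. jstar (y t + c *\<^sub>R z t)) (\<lambda>t. \<psi> t + c *\<^sub>R \<phi> t)"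
      using primitive_on_add[OF r1(5) primitive_on_linear[OF r2(5) bounded_linear_scaleR_right[of c]]]
      by (simp add: jstar_simps)
  qed
qed

lemma esol_lin:
  assumes "esol R f a b y" "esol R g a b z"
  shows "esol R (\<lambda>t. f t + c *\<^sub>R g t) a b (\<lambda>t. y t + c *\<^sub>R z t)"
proof -
  obtain v \<psi> where 1: "regular a b y v \<psi>" "AE t in lebesgue. t \<in> {a..b} \<longrightarrow> \<psi> t = rhs R f t (v t)"
    using assms(1) unfolding esol_def by blast
  obtain w \<phi> where 2: "regular a b z w \<phi>" "AE t in lebesgue. t \<in> {a..b} \<longrightarrow> \<phi> t = rhs R g t (w t)"
    using assms(2) unfolding esol_def by blast
  have "AE t in lebesgue. t \<in> {a..b} \<longrightarrow>
      \<psi> t + c *\<^sub>R \<phi> t = rhs R (\<lambda>t. f t + c *\<^sub>R g t) t (v t + c *\<^sub>R w t)"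
    using 1(2) 2(2) by eventually_elim
      (auto simp: blinfun.bilinear_simps jstar_simps riesz_simps scaleR_add_right scaleR_diff_right)
  then show ?thesis
    unfolding esol_def using regular_lin[OF 1(1) 2(1)] by blast
qed

lemma primitive_on_const: "primitive_on a b (\<lambda>t. k * t) (\<lambda>_. k :: real)"
  by (rule primitive_on_C1_real) (auto intro!: derivative_eq_intros)

lemma set_integral_const:
  assumes "s \<le> t" shows "(LINT r:{s..t}|lebesgue. k :: real) = k * (t - s)"
  using primitive_onD(2)[OF primitive_on_const[of s t k], of s t] assms by (simp add: algebra_simps)

lemma primitive_on_exp_weight:
  fixes F :: "real \<Rightarrow> real"
  assumes "primitive_on a b F \<phi>"
  shows "primitive_on a b (\<lambda>t. exp (k * (t - c)) * F t) (\<lambda>t. exp (k * (t - c)) * (k * F t + \<phi> t))"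
proof -
  have "primitive_on a b (\<lambda>t. exp (k * (t - c))) (\<lambda>t. exp (k * (t - c)) * k)"
    by (rule primitive_on_C1_real)
      (auto intro!: derivative_eq_intros continuous_intros simp flip: has_real_derivative_iff_has_vector_derivative)
  from primitive_on_bilinear[OF this assms bounded_bilinear_mult]
  show ?thesis by (simp add: algebra_simps)
qed

text \<open>In the energy identity, Young's inequality absorbs the perturbation into the coercive
  term \<open>- (norm v)^2\<close> and leaves \<open>C^2\<close> times the squared H-norm. The
  exponential weight turns the Gronwall argument into a plain integration.\<close>

lemma energy_le:
  assumes sol: "esol R f a b y" and R: "rel_bounded C R {a..b}"
    and st: "a \<le> s" "s \<le> t" "t \<le> b"
    and f: "\<And>r. r \<in> {s..t} \<Longrightarrow> f r \<bullet> y r \<le> \<kappa>" and \<kappa>: "\<kappa> \<ge> 0"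
  shows "exp (- 2 * C\<^sup>2 * (t - s)) * (norm (y t))\<^sup>2 \<le> (norm (y s))\<^sup>2 + 2 * \<kappa> * (t - s)"
proof -
  obtain v \<psi> where *: "regular a b y v \<psi>" "AE t in lebesgue. t \<in> {a..b} \<longrightarrow> \<psi> t = rhs R f t (v t)"
    using sol unfolding esol_def by blast
  note prim = primitive_on_exp_weight[OF energy_identity[OF *(1)], of "- 2 * C\<^sup>2" s]
  have "AE r in lebesgue. r \<in> {s..t} \<longrightarrow>
      exp (- 2 * C\<^sup>2 * (r - s)) * (- 2 * C\<^sup>2 * (y r \<bullet> y r) + 2 * (\<psi> r \<bullet> v r)) \<le> 2 * \<kappa>"
    using *(2) regularD(4)[OF *(1)]
  proof (eventually_elim, intro impI)
    fix r assume r1: "r \<in> {a..b} \<longrightarrow> \<psi> r = rhs R f r (v r)" "r \<in> {a..b} \<longrightarrow> y r = j (v r)" and r: "r \<in> {s..t}"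
    then have rab: "r \<in> {a..b}" using st by auto
    have "\<psi> r \<bullet> v r = - (v r \<bullet> v r) - R r (v r) (v r) + f r \<bullet> y r"
      using r1 rab by (simp add: inner_add_left inner_diff_left riesz_inner jstar_inner)
    moreover have "- R r (v r) (v r) \<le> 2 * (norm (v r) * (C * norm (y r)))"
      using rel_boundedD[OF R rab, of "v r" "v r"] r1 rab by (auto simp: algebra_simps)
    moreover have "2 * (norm (v r) * (C * norm (y r))) \<le> (norm (v r))\<^sup>2 + (C * norm (y r))\<^sup>2"
      using sum_squares_bound[of "norm (v r)" "C * norm (y r)"] by (simp add: mult_ac)
    ultimately have "\<psi> r \<bullet> v r \<le> C\<^sup>2 * (y r \<bullet> y r) + f r \<bullet> y r"
      by (simp add: power2_norm_eq_inner[symmetric] power_mult_distrib)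
    then have "- 2 * C\<^sup>2 * (y r \<bullet> y r) + 2 * (\<psi> r \<bullet> v r) \<le> 2 * \<kappa>"
      using f[OF r] by simp
    then have "exp (- 2 * C\<^sup>2 * (r - s)) * (- 2 * C\<^sup>2 * (y r \<bullet> y r) + 2 * (\<psi> r \<bullet> v r))
        \<le> exp (- 2 * C\<^sup>2 * (r - s)) * (2 * \<kappa>)"
      by (intro mult_left_mono) auto
    also have "\<dots> \<le> 1 * (2 * \<kappa>)"
      using r \<kappa> by (intro mult_right_mono) auto
    finally show "exp (- 2 * C\<^sup>2 * (r - s)) * (- 2 * C\<^sup>2 * (y r \<bullet> y r) + 2 * (\<psi> r \<bullet> v r)) \<le> 2 * \<kappa>"
      by simp
  qed
  from primitive_on_mono[OF prim st _ this]
  have "exp (- 2 * C\<^sup>2 * (t - s)) * (y t \<bullet> y t) - exp (- 2 * C\<^sup>2 * (s - s)) * (y s \<bullet> y s)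
      \<le> (LINT r:{s..t}|lebesgue. 2 * \<kappa>)"
    by (simp add: set_integrable_continuous)
  then show ?thesis
    unfolding set_integral_const[OF st(2)] by (simp add: power2_norm_eq_inner)
qed

lemma exp_minus_mult_le:
  fixes k p q :: real
  assumes "exp (- k) * p \<le> q" shows "p \<le> exp k * q"
  using assms by (simp add: exp_minus field_simps)

lemma energy_free:
  assumes sol: "esol R (\<lambda>_. 0) a b y" and R: "rel_bounded C R {a..b}"
    and st: "a \<le> s" "s \<le> t" "t \<le> b"
  shows "norm (y t) \<le> exp (C\<^sup>2 * (t - s)) * norm (y s)"
proof -
  have "exp (- 2 * C\<^sup>2 * (t - s)) * (norm (y t))\<^sup>2 \<le> (norm (y s))\<^sup>2"
    using energy_le[OF sol R st, of 0] by simp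
  then have "(norm (y t))\<^sup>2 \<le> exp (2 * C\<^sup>2 * (t - s)) * (norm (y s))\<^sup>2"
    by (intro exp_minus_mult_le) simp
  also have "\<dots> = (exp (C\<^sup>2 * (t - s)) * norm (y s))\<^sup>2"
    by (simp add: power_mult_distrib exp_double[symmetric] mult_ac)
  finally show ?thesis
    by (rule power2_le_imp_le) simp
qed

text \<open>Taking the energy bound at the time \<open>q\<close> where \<open>norm y\<close> is
  largest bounds the power of the forcing by \<open>M * norm (y q)\<close>; one factor
  \<open>norm (y q)\<close> then cancels. The result is linear in the length of the interval, which
  the increments in \<open>duhamel_bound\<close> depend on.\<close>

lemma energy_forced:
  assumes sol: "esol R f a b y" and R: "rel_bounded C R {a..b}"
    and f: "\<And>r. r \<in> {a..b} \<Longrightarrow> norm (f r) \<le> M" and y: "y a = 0" and t: "t \<in> {a..b}"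
  shows "norm (y t) \<le> 2 * M * (b - a) * exp (2 * C\<^sup>2 * (b - a))"
proof -
  have M: "M \<ge> 0" using f[OF t] norm_ge_zero order_trans by blast
  have "\<exists>q\<in>{a..b}. \<forall>r\<in>{a..b}. norm (y r) \<le> norm (y q)"
    using t by (intro continuous_attains_sup continuous_on_norm esol_continuous[OF sol]) auto
  then obtain q where q: "q \<in> {a..b}" "\<And>r. r \<in> {a..b} \<Longrightarrow> norm (y r) \<le> norm (y q)"
    by blast
  have "f r \<bullet> y r \<le> M * norm (y q)" if "r \<in> {a..q}" for r
    using that q f[of r] M by (intro order_trans[OF norm_cauchy_schwarz] mult_mono) auto
  then have *: "exp (- 2 * C\<^sup>2 * (q - a)) * (norm (y q))\<^sup>2 \<le> 2 * (M * norm (y q)) * (q - a)"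
    using energy_le[OF sol R order_refl, of q "M * norm (y q)"] q M y by auto
  have "norm (y q) \<le> 2 * M * (b - a) * exp (2 * C\<^sup>2 * (b - a))"
  proof (cases "y q = 0")
    case True
    then show ?thesis using M t by simp
  next
    case False
    then have "exp (- 2 * C\<^sup>2 * (q - a)) * norm (y q) \<le> 2 * M * (q - a)"
      using * by (simp add: power2_eq_square)
    then have "norm (y q) \<le> exp (2 * C\<^sup>2 * (q - a)) * (2 * M * (q - a))"
      by (intro exp_minus_mult_le) simp
    also have "\<dots> \<le> exp (2 * C\<^sup>2 * (b - a)) * (2 * M * (b - a))"
      using q M by (intro mult_mono) (auto intro!: mult_left_mono)
    finally show ?thesis by (simp add: mult_ac)
  qed
  then show ?thesis using q(2)[OF t] by simp
qed

lemma esol_unique: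
  assumes "esol R f a b y" "esol R f a b z" "rel_bounded C R {a..b}" "y a = z a" "t \<in> {a..b}"
  shows "y t = z t"
proof -
  have "esol R (\<lambda>_. 0) a b (\<lambda>t. y t + (- 1) *\<^sub>R z t)"
    using esol_lin[OF assms(1,2), of "- 1"] by simp
  from energy_free[OF this assms(3), of a t] show ?thesis
    using assms(4,5) by simp
qed

text \<open>Testing the derivative in V' with \<open>w\<close> is pairing its Riesz representative
  with \<open>w\<close>, so the tested equation determines the primitive of
  \<open>jstar y\<close>.\<close>

lemma weak_solution_imp_esol:
  fixes R :: "real \<Rightarrow> 'v \<Rightarrow>\<^sub>L ('v \<Rightarrow>\<^sub>L real)"
  assumes "weak_solution j J (\<lambda>t v. - A v - R t v + pivot_dual j (f t)) y"
    and pq: "{p..q} \<subseteq> J" and J: "J \<in> sets lebesgue"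
  shows "esol R f p q y"
proof -
  obtain v yd where *: "continuous_on J y" "L2_loc J v" "L2_loc J yd"
      "AE t in lebesgue_on J. y t = j (v t)" "weak_time_derivative j J y yd"
      "AE t in lebesgue_on J. yd t = - A (v t) - R t (v t) + pivot_dual j (f t)"
    using assms(1) unfolding weak_solution_def by blast
  define \<psi> where "\<psi> t = riesz (yd t)" for t
  have sq: "sq_integrable {p..q} v" "sq_integrable {p..q} \<psi>"
    using *(2,3) pq unfolding \<psi>_def L2_loc_iff
    by (auto intro: sq_integrable_linear bounded_linear_riesz)
  have int: "set_integrable lebesgue {p..q} \<psi>"
    using sq(2) by (rule sq_integrable_imp_integrable)
  have "primitive_on p q (\<lambda>t. jstar (y t)) \<psi>"
  proof (rule primitive_on_inner_iff[OF int])
    fix w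
    have "jstar (y t) \<bullet> w - jstar (y s) \<bullet> w = (LINT r:{s..t}|lebesgue. \<psi> r \<bullet> w)"
      if st: "p \<le> s" "s \<le> t" "t \<le> q" for s t
    proof -
      have "{s..t} \<subseteq> J" using st pq by force
      then have "y t \<bullet> j w - y s \<bullet> j w = (LINT r|lebesgue_on {s..t}. yd r w)"
        using *(5) st by (simp add: weak_time_derivative_def)
      then show ?thesis
        by (simp add: jstar_inner \<psi>_def riesz_inner integral_restrict_space set_lebesgue_integral_def)
    qed
    then show "primitive_on p q (\<lambda>t. jstar (y t) \<bullet> w) (\<lambda>t. \<psi> t \<bullet> w)"
      using set_integrable_linear[OF int bounded_linear_inner_left] by (simp add: primitive_on_def)
  qed
  moreover have "AE t in lebesgue. t \<in> {p..q} \<longrightarrow> y t = j (v t)"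
    using *(4) pq J by (auto simp: AE_restrict_space_iff elim!: eventually_mono)
  moreover have "AE t in lebesgue. t \<in> {p..q} \<longrightarrow> \<psi> t = rhs R f t (v t)"
  proof -
    have r: "riesz (A w) = w" for w
      by (rule riesz_eqI) (simp add: A_inner)
    show ?thesis
      using *(6) pq J by (auto simp: AE_restrict_space_iff \<psi>_def riesz_simps r jstar_def elim!: eventually_mono)
  qed
  ultimately show ?thesis
    unfolding esol_def regular_def using continuous_on_subset[OF *(1) pq] sq by blast
qed

lemma weak_solutionI_local:
  fixes R :: "real \<Rightarrow> 'v \<Rightarrow>\<^sub>L ('v \<Rightarrow>\<^sub>L real)"
  assumes cont: "continuous_on J y" and ae: "AE t in lebesgue. t \<in> J \<longrightarrow> y t = j (vrep y t)"
    and sol: "\<And>p q. {p..q} \<subseteq> J \<Longrightarrow> esol R f p q y" and J: "J \<in> sets lebesgue"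
  shows "weak_solution j J (\<lambda>t v. - A v - R t v + pivot_dual j (f t)) y"
proof -
  define \<psi> where "\<psi> t = rhs R f t (vrep y t)" for t
  have reg: "regular p q y (vrep y) \<psi>" if "{p..q} \<subseteq> J" for p q
    using esol_canonical[OF sol[OF that]] unfolding \<psi>_def .
  have A: "A (\<psi> t) = - A (vrep y t) - R t (vrep y t) + pivot_dual j (f t)" for t
    by (rule blinfun_eqI) (simp add: \<psi>_def A_inner blinfun.bilinear_simps inner_add_left
        inner_diff_left riesz_inner jstar_inner pivot_dual_def)
  have "L2_loc J (vrep y)" "L2_loc J (\<lambda>t. A (\<psi> t))"
    unfolding L2_loc_iff using regularD(2,3)[OF reg]
    by (auto intro: sq_integrable_linear blinfun.bounded_linear_right)
  moreover have "weak_time_derivative j J y (\<lambda>t. A (\<psi> t))"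
    unfolding weak_time_derivative_def
  proof (intro allI impI)
    fix w s t assume st: "s \<le> t \<and> {s..t} \<subseteq> J"
    have prim: "primitive_on s t (\<lambda>t. jstar (y t) \<bullet> w) (\<lambda>t. \<psi> t \<bullet> w)"
      using regularD(5)[OF reg, of s t] st by (intro primitive_on_linear[OF _ bounded_linear_inner_left]) auto
    show "y t \<bullet> j w - y s \<bullet> j w = (LINT r|lebesgue_on {s..t}. A (\<psi> r) w)"
      using primitive_onD(2)[OF prim, of s t] st
      by (simp add: jstar_inner A_inner integral_restrict_space set_lebesgue_integral_def)
  qed
  ultimately show ?thesis
    unfolding weak_solution_def using cont ae J A
    by (intro conjI exI[of _ "vrep y"] exI[of _ "\<lambda>t. A (\<psi> t)"]) (auto simp: AE_restrict_space_iff)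
qed

lemma esol_imp_weak_solution:
  assumes "esol R f a b y"
  shows "weak_solution j {a..b} (\<lambda>t v. - A v - R t v + pivot_dual j (f t)) y"
  using regularD(1,4)[OF esol_canonical[OF assms]] esol_subset[OF assms]
  by (intro weak_solutionI_local) auto

lemma esol_imp_weak_solution_atLeast:
  assumes sol: "\<And>b. b \<ge> a \<Longrightarrow> esol R f a b y"
  shows "weak_solution j {a..} (\<lambda>t v. - A v - R t v + pivot_dual j (f t)) y"
proof (rule weak_solutionI_local)
  show "continuous_on {a..} y"
    unfolding continuous_on_eq_continuous_within
  proof
    fix t assume t: "t \<in> {a..}"
    have "continuous (at t within {a..t + 1}) y"
      using esol_continuous[OF sol[of "t + 1"]] t by (auto simp: continuous_on_eq_continuous_within)
    moreover have "at t within {a..} = at t within {a..t + 1}"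
      by (rule at_within_nhd[of _ "{..<t + 1}"]) auto
    ultimately show "continuous (at t within {a..}) y" by simp
  qed
  \<comment> \<open>Countably many intervals exhaust the half line, so the exceptional sets still
    have a null union.\<close>
  have "AE t in lebesgue. \<forall>n::nat. t \<in> {a..a + n} \<longrightarrow> y t = j (vrep y t)"
    using regularD(4)[OF esol_canonical[OF sol]] by (subst AE_all_countable) auto
  then show "AE t in lebesgue. t \<in> {a..} \<longrightarrow> y t = j (vrep y t)"
  proof (rule eventually_mono, intro impI)
    fix t assume *: "\<forall>n::nat. t \<in> {a..a + n} \<longrightarrow> y t = j (vrep y t)" "t \<in> {a..}"
    obtain n :: nat where "t - a \<le> n" using real_arch_simple by blast
    then have "t \<in> {a..a + n}" using *(2) by simp
    then show "y t = j (vrep y t)" using *(1) by blast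
  qed
  show "esol R f p q y" if "{p..q} \<subseteq> {a..}" for p q
  proof (cases "p \<le> q")
    case True
    then show ?thesis using that esol_subset[OF sol[of q], of p q] by auto
  next
    case False
    then show ?thesis using esol_subset[OF sol[of a], of p q] by auto
  qed
qed auto


section \<open>Backward uniqueness by a Carleman estimate\<close>

lemma weighted_norm_add_le:
  assumes "l \<ge> 0"
  shows "(norm (v + w))\<^sup>2 + l * (norm (j (v + w)))\<^sup>2
    \<le> 2 * ((norm v)\<^sup>2 + l * (norm (j v))\<^sup>2) + 2 * ((norm w)\<^sup>2 + l * (norm (j w))\<^sup>2)"
proof -
  have sq: "(norm (p + q))\<^sup>2 \<le> 2 * (norm p)\<^sup>2 + 2 * (norm q)\<^sup>2" for p q :: "'c::real_inner"
  proof -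
    have "0 \<le> (norm (p - q))\<^sup>2" by simp
    then show ?thesis
      by (simp add: power2_norm_eq_inner inner_add inner_diff inner_commute)
  qed
  have "l * (norm (j (v + w)))\<^sup>2 \<le> l * (2 * (norm (j v))\<^sup>2 + 2 * (norm (j w))\<^sup>2)"
    using assms sq[of "j v" "j w"] by (intro mult_left_mono) (simp_all add: blinfun.bilinear_simps)
  then show ?thesis
    using sq[of v w] by (simp add: algebra_simps)
qed

text \<open>The bound on \<open>\<phi>\<close> is tested with \<open>w = N l \<phi>\<close>. By
  \<open>norm_N_sq\<close> the weighted norm of this vector is again the form on the left, so
  Young's inequality produces a quarter of the left-hand side, which is absorbed.\<close>

lemma N_form_lower_order_le:
  assumes l: "l > 0" and \<phi>: "\<And>w. \<bar>\<phi> \<bullet> w\<bar> \<le> C * (norm v * norm (j w) + norm (j v) * norm w)"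
  shows "l * (\<phi> \<bullet> N l \<phi>) \<le> 2 * C\<^sup>2 * ((norm v)\<^sup>2 + l * (norm (j v))\<^sup>2)"
proof -
  define \<nu> m where "\<nu> = N l \<phi>" and "m = \<phi> \<bullet> N l \<phi>"
  have m: "(norm \<nu>)\<^sup>2 + l * (norm (j \<nu>))\<^sup>2 = m"
    using norm_N_sq[of l \<phi>] l by (simp add: \<nu>_def m_def)
  have 1: "(C * norm v) * (l * norm (j \<nu>)) \<le> (C * norm v)\<^sup>2 + (l * norm (j \<nu>))\<^sup>2 / 4"
    using sum_squares_bound[of "C * norm v" "l * norm (j \<nu>) / 2"] by (simp add: power_divide)
  have "(C * norm (j v)) * norm \<nu> \<le> (C * norm (j v))\<^sup>2 + (norm \<nu>)\<^sup>2 / 4"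
    using sum_squares_bound[of "C * norm (j v)" "norm \<nu> / 2"] by (simp add: power_divide)
  then have 2: "l * ((C * norm (j v)) * norm \<nu>) \<le> l * ((C * norm (j v))\<^sup>2 + (norm \<nu>)\<^sup>2 / 4)"
    using l by (intro mult_left_mono) auto
  have "l * m \<le> l * (C * (norm v * norm (j \<nu>) + norm (j v) * norm \<nu>))"
    using \<phi>[of \<nu>] l by (intro mult_left_mono) (auto simp: m_def \<nu>_def)
  also have "\<dots> = (C * norm v) * (l * norm (j \<nu>)) + l * ((C * norm (j v)) * norm \<nu>)"
    by (simp add: algebra_simps)
  also have "\<dots> \<le> (C * norm v)\<^sup>2 + (l * norm (j \<nu>))\<^sup>2 / 4 + l * ((C * norm (j v))\<^sup>2 + (norm \<nu>)\<^sup>2 / 4)"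
    using 1 2 by (rule add_mono)
  also have "\<dots> = C\<^sup>2 * ((norm v)\<^sup>2 + l * (norm (j v))\<^sup>2) + l * m / 4"
    by (simp add: m[symmetric] power2_eq_square algebra_simps)
  finally have "3 / 4 * (l * m) \<le> C\<^sup>2 * ((norm v)\<^sup>2 + l * (norm (j v))\<^sup>2)"
    by simp
  moreover have "0 \<le> C\<^sup>2 * ((norm v)\<^sup>2 + l * (norm (j v))\<^sup>2)"
    using l by (intro mult_nonneg_nonneg add_nonneg_nonneg) auto
  ultimately show ?thesis
    unfolding m_def[symmetric] by linarith
qed

text \<open>With \<open>p\<close> the slope of the weight, \<open>x = S v\<close> and \<open>\<psi> = x'\<close>, completing the square in the quadratic
  form of \<open>N l\<close> splits the equation into the skew part \<open>\<psi> + l p x\<close> and the symmetric part \<open>v - l p x\<close>.\<close>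

lemma carleman_pointwise:
  assumes \<phi>: "\<And>w. \<bar>(\<psi> + v) \<bullet> w\<bar> \<le> C * (norm v * norm (j w) + norm (j v) * norm w)"
    and \<kappa>: "\<kappa> = 18 * (2 * C\<^sup>2 + 1)" and l: "l \<ge> \<kappa> / 9" and p: "1 \<le> p" "p \<le> 2"
  shows "2 * l * p * ((norm (j v))\<^sup>2 - l * (1 + p) * (S v \<bullet> N l (S v))) + 2 * (\<psi> \<bullet> v)
      - l * \<kappa> * (S v \<bullet> N l (S v)) - 2 * l * (1 + p) * (\<psi> \<bullet> N l (S v)) \<le> - (norm (j v))\<^sup>2"
    (is "?lhs \<le> _")
proof -
  have \<kappa>0: "\<kappa> > 0" unfolding \<kappa> by (intro mult_pos_pos add_nonneg_pos) auto
  with l have l0: "l > 0" by linarith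
  then have l0': "l \<ge> 0" by simp
  define x q u where "x = S v" and "q = v - (l * p) *\<^sub>R x" and "u = \<psi> + (l * p) *\<^sub>R x"
  define X D V where "X = x \<bullet> N l x" and "D = q \<bullet> N l q" and "V = (norm v)\<^sup>2 + l * (norm (j v))\<^sup>2"
  note Nl = linear_simps[OF bounded_linear_N[OF l0']]
  have Nq: "N l q = v - (l * (1 + p)) *\<^sub>R N l x"
  proof -
    have "N l v = v - l *\<^sub>R N l x"
      using N_S[OF l0', of v] by (simp add: x_def algebra_simps)
    then show ?thesis
      by (simp add: q_def Nl algebra_simps)
  qed
  have xv: "x \<bullet> v = (norm (j v))\<^sup>2"
    by (simp add: x_def S_inner power2_norm_eq_inner)
  have lhs: "?lhs = 2 * (u \<bullet> N l q) - l * \<kappa> * X"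
    by (simp add: Nq u_def inner_add_left inner_diff_right xv X_def x_def[symmetric] algebra_simps)
  have "u \<bullet> N l u \<ge> 0"
    using norm_N_sq[OF l0', of u] l0 by (metis add_nonneg_nonneg mult_nonneg_nonneg zero_le_power2 l0')
  moreover have "\<psi> + v = u + q" by (simp add: u_def q_def)
  then have "(\<psi> + v) \<bullet> N l (\<psi> + v) = u \<bullet> N l u + 2 * (u \<bullet> N l q) + D"
    using N_sym[OF l0', of u q] by (simp add: Nl inner_add_left inner_add_right D_def inner_commute)
  \<comment> \<open>The square of the part \<open>u\<close> is discarded; the square
    \<open>D\<close> of the part \<open>q\<close> is kept to control \<open>v\<close>.\<close>
  ultimately have "2 * (u \<bullet> N l q) \<le> (\<psi> + v) \<bullet> N l (\<psi> + v) - D"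
    by simp
  then have "l * ?lhs \<le> l * ((\<psi> + v) \<bullet> N l (\<psi> + v) - D - l * \<kappa> * X)"
    unfolding lhs using l0 by (intro mult_left_mono) auto
  also have "\<dots> \<le> 2 * C\<^sup>2 * V - l * D - l\<^sup>2 * \<kappa> * X"
    using N_form_lower_order_le[OF l0 \<phi>] by (simp add: V_def power2_eq_square algebra_simps)
  finally have 1: "l * ?lhs \<le> 2 * C\<^sup>2 * V - l * D - l\<^sup>2 * \<kappa> * X" .
  have X0: "X \<ge> 0" and D0: "D \<ge> 0"
    unfolding X_def D_def using norm_N_sq[OF l0'] l0'
    by (metis add_nonneg_nonneg mult_nonneg_nonneg zero_le_power2)+
  \<comment> \<open>\<open>v\<close> is recovered from \<open>N l q\<close> and
    \<open>N l x\<close>, so its weighted norm \<open>V\<close> is controlled by \<open>D\<close>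
    and \<open>X\<close>. Since \<open>1 + p \<le> 3\<close>, the factor in front of
    \<open>l^2 * X\<close> is 2 * 9 = 18, the source of the 18 in \<open>\<kappa>\<close>; the
    condition \<open>l \<ge> \<kappa> / 9\<close> matches the factor 2 in front of
    \<open>D\<close>.\<close>
  have "v = N l q + (l * (1 + p)) *\<^sub>R N l x"
    by (simp add: Nq)
  then have "V \<le> 2 * ((norm (N l q))\<^sup>2 + l * (norm (j (N l q)))\<^sup>2)
      + 2 * ((norm ((l * (1 + p)) *\<^sub>R N l x))\<^sup>2 + l * (norm (j ((l * (1 + p)) *\<^sub>R N l x)))\<^sup>2)"
    unfolding V_def using weighted_norm_add_le[OF l0', of "N l q" "(l * (1 + p)) *\<^sub>R N l x"] by simp
  also have "(norm ((l * (1 + p)) *\<^sub>R N l x))\<^sup>2 + l * (norm (j ((l * (1 + p)) *\<^sub>R N l x)))\<^sup>2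
      = (l * (1 + p))\<^sup>2 * ((norm (N l x))\<^sup>2 + l * (norm (j (N l x)))\<^sup>2)"
    by (simp add: blinfun.bilinear_simps power_mult_distrib distrib_left mult.left_commute)
  also have "2 * ((norm (N l q))\<^sup>2 + l * (norm (j (N l q)))\<^sup>2)
      + 2 * ((l * (1 + p))\<^sup>2 * ((norm (N l x))\<^sup>2 + l * (norm (j (N l x)))\<^sup>2)) = 2 * D + 2 * (l * (1 + p))\<^sup>2 * X"
    unfolding norm_N_sq[OF l0'] D_def X_def by simp
  also have "\<dots> \<le> 2 * D + 18 * l\<^sup>2 * X"
  proof -
    have "(1 + p)\<^sup>2 \<le> 3\<^sup>2" using p by (intro power_mono) auto
    then have "l\<^sup>2 * (1 + p)\<^sup>2 * X \<le> l\<^sup>2 * 9 * X"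
      using X0 by (intro mult_right_mono mult_left_mono) auto
    moreover have "2 * (l * (1 + p))\<^sup>2 * X = 2 * (l\<^sup>2 * (1 + p)\<^sup>2 * X)" "18 * l\<^sup>2 * X = 2 * (l\<^sup>2 * 9 * X)"
      by (simp_all add: power_mult_distrib)
    ultimately show ?thesis by linarith
  qed
  finally have "(\<kappa> / 18) * V \<le> (\<kappa> / 18) * (2 * D + 18 * l\<^sup>2 * X)"
    using \<kappa>0 by (intro mult_left_mono) auto
  also have "\<dots> = (\<kappa> / 9) * D + l\<^sup>2 * \<kappa> * X"
    by (simp add: algebra_simps)
  also have "\<dots> \<le> l * D + l\<^sup>2 * \<kappa> * X"
    using l D0 by (intro add_right_mono mult_right_mono)
  finally have "\<kappa> / 18 * V \<le> l * D + l\<^sup>2 * \<kappa> * X" .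
  moreover have "\<kappa> / 18 = 2 * C\<^sup>2 + 1" by (simp add: \<kappa>)
  ultimately have "(2 * C\<^sup>2 + 1) * V \<le> l * D + l\<^sup>2 * \<kappa> * X" by (simp only:)
  with 1 have "l * ?lhs \<le> - V"
    by (simp add: algebra_simps)
  also have "\<dots> \<le> l * (- (norm (j v))\<^sup>2)"
    by (simp add: V_def)
  finally show ?thesis
    using l0 by (simp only: mult_le_cancel_left_pos)
qed

text \<open>With the convex weight \<open>E\<close>, the pointwise inequality says that
  \<open>E * \<Phi>\<close> decreases at least at the rate \<open>E * (norm y)^2\<close>. If
  \<open>y\<close> vanishes at \<open>b\<close>, the integral of \<open>E * (norm y)^2\<close> is
  thus at most \<open>\<Phi> a\<close>, hence at most \<open>(norm (y a))^2\<close>, independently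
  of \<open>l\<close>. But if \<open>y a\<close> is nonzero, \<open>norm y\<close> stays above half
  its initial value for a while, and there the weight grows without bound with \<open>l\<close>. The
  length restriction keeps the slope \<open>p\<close> of the weight between 1 and 2.\<close>

lemma backward_uniqueness_local:
  assumes sol: "esol R (\<lambda>_. 0) a b y" and R: "rel_bounded C R {a..b}" and ab: "a < b"
    and short: "18 * (2 * C\<^sup>2 + 1) * (b - a) \<le> 1" and yb: "y b = 0"
  shows "y a = 0"
proof (rule ccontr)
  assume ya: "y a \<noteq> 0"
  define \<kappa> where "\<kappa> = 18 * (2 * C\<^sup>2 + 1)"
  have \<kappa>0: "\<kappa> > 0" unfolding \<kappa>_def by (intro mult_pos_pos add_nonneg_pos) auto
  define c where "c = norm (y a)"
  have c0: "c > 0" using ya by (simp add: c_def)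
  have "continuous_on {a..b} y" using sol by (rule esol_continuous)
  then obtain d0 where d0: "d0 > 0" "\<And>t. t \<in> {a..b} \<Longrightarrow> dist t a < d0 \<Longrightarrow> dist (y t) (y a) < c / 2"
    unfolding continuous_on_iff using ab c0 by (metis atLeastAtMost_iff half_gt_zero less_imp_le order_refl)
  define d where "d = min (d0 / 2) (b - a)"
  have d: "d > 0" "d < d0" "a + d \<le> b" using d0 ab by (auto simp: d_def)
  have y_ge: "c / 2 \<le> norm (y t)" if "t \<in> {a..a + d}" for t
  proof -
    have "dist (y t) (y a) < c / 2" using that d by (intro d0(2)) (auto simp: dist_norm)
    then show ?thesis
      using norm_triangle_ineq2[of "y a" "y t"] by (simp add: dist_norm norm_minus_commute c_def)
  qed
  \<comment> \<open>The first bound is the hypothesis of \<open>carleman_pointwise\<close>; the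
    second contradicts \<open>l * d^2 \<le> 8\<close>, the outcome of the integration.\<close>
  define l where "l = max (\<kappa> / 9) (16 / d\<^sup>2)"
  have l: "l \<ge> \<kappa> / 9" "l \<ge> 16 / d\<^sup>2" by (auto simp: l_def)
  have l0: "l > 0" using l(1) \<kappa>0 by linarith
  then have l0': "l \<ge> 0" by simp
  obtain v \<psi> where *: "regular a b y v \<psi>" "AE t in lebesgue. t \<in> {a..b} \<longrightarrow> \<psi> t = rhs R (\<lambda>_. 0) t (v t)"
    using sol unfolding esol_def by blast
  note r = regularD[OF *(1)]
  define p where "p t = 1 + \<kappa> * (t - a)" for t
  define E where "E t = exp (2 * l * ((t - a) + \<kappa> * (t - a)\<^sup>2 / 2))" for t
  define X where "X t = jstar (y t) \<bullet> N l (jstar (y t))" for t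
  define \<Phi> where "\<Phi> t = y t \<bullet> y t + (- l * (1 + p t)) * X t" for t
  define \<rho> where "\<rho> t = 2 * (\<psi> t \<bullet> v t) + (- l * \<kappa> * X t + (- l * (1 + p t)) * (2 * (\<psi> t \<bullet> N l (jstar (y t)))))" for t
  have primX: "primitive_on a b X (\<lambda>t. 2 * (\<psi> t \<bullet> N l (jstar (y t))))"
    unfolding X_def by (rule primitive_on_inner_N[OF r(5) l0'])
  have primp: "primitive_on a b (\<lambda>t. - l * (1 + p t)) (\<lambda>t. - l * \<kappa>)"
    unfolding p_def by (rule primitive_on_C1_real) (auto intro!: derivative_eq_intros
        simp flip: has_real_derivative_iff_has_vector_derivative)
  have prim\<Phi>: "primitive_on a b \<Phi> \<rho>"
    unfolding \<Phi>_def \<rho>_def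
    by (intro primitive_on_add energy_identity[OF *(1)] primitive_on_bilinear[OF primp primX bounded_bilinear_mult])
  have primE: "primitive_on a b E (\<lambda>t. E t * (2 * l * p t))"
    unfolding E_def p_def
    by (rule primitive_on_C1_real) (auto intro!: derivative_eq_intros continuous_intros
        simp: algebra_simps simp flip: has_real_derivative_iff_has_vector_derivative)
  have prim: "primitive_on a b (\<lambda>t. E t * \<Phi> t) (\<lambda>t. E t * (2 * l * p t * \<Phi> t + \<rho> t))"
    using primitive_on_bilinear[OF primE prim\<Phi> bounded_bilinear_mult] by (simp add: algebra_simps)
  have le: "AE t in lebesgue. t \<in> {a..b} \<longrightarrow> E t * (2 * l * p t * \<Phi> t + \<rho> t) \<le> - (E t * (norm (y t))\<^sup>2)"
    using *(2) r(4)
  proof (eventually_elim, intro impI)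
    fix t assume t: "t \<in> {a..b} \<longrightarrow> \<psi> t = rhs R (\<lambda>_. 0) t (v t)" "t \<in> {a..b} \<longrightarrow> y t = j (v t)" "t \<in> {a..b}"
    have "p t \<le> 1 + \<kappa> * (b - a)" unfolding p_def using t(3) \<kappa>0 by (intro add_left_mono mult_left_mono) auto
    moreover have "\<kappa> * (b - a) \<le> 1" using short by (simp only: \<kappa>_def)
    moreover have "0 \<le> \<kappa> * (t - a)" using t(3) \<kappa>0 by simp
    ultimately have p: "1 \<le> p t" "p t \<le> 2"
      unfolding p_def by linarith+
    have "\<bar>(\<psi> t + v t) \<bullet> w\<bar> \<le> C * (norm (v t) * norm (j w) + norm (j (v t)) * norm w)" for w
      using rel_boundedD[OF R t(3), of "v t" w] t by (simp add: jstar_simps riesz_inner)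
    from carleman_pointwise[OF this \<kappa>_def l(1) p]
    have "2 * l * p t * \<Phi> t + \<rho> t \<le> - (norm (y t))\<^sup>2"
      using t unfolding \<Phi>_def \<rho>_def X_def
      by (simp add: S_def power2_norm_eq_inner algebra_simps)
    then have "E t * (2 * l * p t * \<Phi> t + \<rho> t) \<le> E t * (- (norm (y t))\<^sup>2)"
      by (intro mult_left_mono) (auto simp: E_def)
    then show "E t * (2 * l * p t * \<Phi> t + \<rho> t) \<le> - (E t * (norm (y t))\<^sup>2)"
      by simp
  qed
  have E0: "E t > 0" for t by (simp add: E_def)
  have neg: "AE t in lebesgue. t \<in> {a..b} \<longrightarrow> E t * (2 * l * p t * \<Phi> t + \<rho> t) \<le> 0"
    using le by (rule eventually_mono) (metis E0 less_imp_le mult_nonneg_nonneg neg_le_0_iff_le order_trans zero_le_power2)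
  \<comment> \<open>A lower bound for \<open>E * (norm y)^2\<close> on the second half of
    [a, a + d]: there the exponent of the weight is at least \<open>l * d\<close>, the exponential
    exceeds its exponent, and \<open>norm y\<close> is at least \<open>c / 2\<close>.\<close>
  define k where "k = l * d * (c / 2)\<^sup>2"
  have "E (a + d) * \<Phi> (a + d) - E (a + d / 2) * \<Phi> (a + d / 2) \<le> (LINT t:{a + d / 2..a + d}|lebesgue. - k)"
  proof (rule primitive_on_mono[OF prim])
    show "AE t in lebesgue. t \<in> {a + d / 2..a + d} \<longrightarrow> E t * (2 * l * p t * \<Phi> t + \<rho> t) \<le> - k"
      using le
    proof (rule eventually_mono, intro impI)
      fix t assume t1: "t \<in> {a..b} \<longrightarrow> E t * (2 * l * p t * \<Phi> t + \<rho> t) \<le> - (E t * (norm (y t))\<^sup>2)"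
        and t: "t \<in> {a + d / 2..a + d}"
      have "l * d \<le> 2 * l * ((t - a) + \<kappa> * (t - a)\<^sup>2 / 2)"
      proof -
        have "d \<le> 2 * (t - a)" using t by simp
        also have "\<dots> \<le> 2 * ((t - a) + \<kappa> * (t - a)\<^sup>2 / 2)" using \<kappa>0 by simp
        finally show ?thesis using l0 by (simp add: mult.left_commute mult.assoc)
      qed
      also have "\<dots> \<le> E t" unfolding E_def by (rule order_trans[OF _ exp_ge_add_one_self]) simp
      finally have "l * d * (c / 2)\<^sup>2 \<le> E t * (norm (y t))\<^sup>2"
        using y_ge[of t] t d c0 l0 less_imp_le[OF E0[of t]] by (intro mult_mono power_mono) auto
      moreover have "t \<in> {a..b}" using t d by auto
      ultimately show "E t * (2 * l * p t * \<Phi> t + \<rho> t) \<le> - k"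
        using t1 by (simp add: k_def)
    qed
  qed (use d in \<open>auto intro!: set_integrable_continuous\<close>)
  then have "E (a + d) * \<Phi> (a + d) - E (a + d / 2) * \<Phi> (a + d / 2) \<le> - k * (d / 2)"
    using set_integral_const[of "a + d / 2" "a + d" "- k"] d by simp
  moreover have "E b * \<Phi> b \<le> E (a + d) * \<Phi> (a + d)" "E (a + d / 2) * \<Phi> (a + d / 2) \<le> E a * \<Phi> a"
    using primitive_on_antimono[OF prim _ _ _ neg, of "a + d" b]
      primitive_on_antimono[OF prim _ _ _ neg, of a "a + d / 2"] d ab by auto
  moreover have "\<Phi> b = 0" "E a = 1"
    using yb by (auto simp: \<Phi>_def X_def E_def jstar_simps)
  moreover have "\<Phi> a \<le> c\<^sup>2"
  proof -
    have "X a \<ge> 0"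
      unfolding X_def using norm_N_sq[OF l0'] l0'
      by (metis add_nonneg_nonneg mult_nonneg_nonneg zero_le_power2)
    then show ?thesis using l0 by (simp add: \<Phi>_def p_def c_def power2_norm_eq_inner)
  qed
  ultimately have "k * (d / 2) \<le> c\<^sup>2" by simp
  moreover have "k * (d / 2) = (l * d\<^sup>2) * c\<^sup>2 / 8" by (simp add: k_def power2_eq_square)
  ultimately have "(l * d\<^sup>2) * c\<^sup>2 \<le> 8 * c\<^sup>2" by linarith
  then have "l * d\<^sup>2 \<le> 8" using c0 by simp
  moreover have "16 \<le> l * d\<^sup>2" using l(2) d by (simp add: field_simps)
  ultimately show False by simp
qed

text \<open>The zero is carried back from \<open>b\<close> in steps of length \<open>h\<close> with
  \<open>\<kappa> * h \<le> 1\<close>, the range of the local result.\<close>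

lemma backward_uniqueness:
  assumes sol: "esol R (\<lambda>_. 0) a b y" and R: "rel_bounded C R {a..b}" and ab: "a \<le> b" and yb: "y b = 0"
  shows "y a = 0"
proof (cases "a = b")
  case False
  define \<kappa> where "\<kappa> = 18 * (2 * C\<^sup>2 + 1)"
  have \<kappa>0: "\<kappa> > 0" unfolding \<kappa>_def by (intro mult_pos_pos add_nonneg_pos) auto
  obtain n :: nat where n: "\<kappa> * (b - a) < n" using reals_Archimedean2 by blast
  have n0: "n > 0"
  proof (rule ccontr)
    assume "\<not> n > 0"
    then have "\<kappa> * (b - a) < 0" using n by simp
    then show False using \<kappa>0 ab by (simp add: mult_less_0_iff)
  qed
  define h where "h = (b - a) / n"
  have h: "h > 0" "\<kappa> * h \<le> 1" "real n * h = b - a"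
    using n n0 False ab by (auto simp: h_def field_simps)
  have "y (b - real i * h) = 0" if "i \<le> n" for i
    using that
  proof (induction i)
    case (Suc i)
    have "real (Suc i) * h \<le> real n * h" using Suc.prems h by (intro mult_right_mono) auto
    then have sub: "{b - real (Suc i) * h..b - real i * h} \<subseteq> {a..b}"
      using h by (auto simp: algebra_simps)
    show ?case
    proof (rule backward_uniqueness_local[OF esol_subset[OF sol sub] rel_bounded_subset[OF R sub]])
      show "18 * (2 * C\<^sup>2 + 1) * (b - real i * h - (b - real (Suc i) * h)) \<le> 1"
      proof -
        have "b - real i * h - (b - real (Suc i) * h) = h" by (simp add: algebra_simps)
        then show ?thesis using h(2) by (simp only: \<kappa>_def)
      qed
      show "b - real (Suc i) * h < b - real i * h" using h by (simp add: algebra_simps)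
      show "y (b - real i * h) = 0" using Suc by simp
    qed
  qed (simp add: yb)
  from this[of n] show ?thesis using h(3) by simp
qed (use yb in simp)

end

section \<open>Continuously differentiable functions and bounded generators\<close>

definition C1_pair :: "(real \<Rightarrow> 'a::real_normed_vector) \<Rightarrow> (real \<Rightarrow> 'a) \<Rightarrow> bool" where
  "C1_pair u u' \<longleftrightarrow> (\<forall>t. (u has_vector_derivative u' t) (at t)) \<and> continuous_on UNIV u'"

lemma C1_pair_continuous:
  assumes "C1_pair u u'"
  shows "continuous_on I u" "continuous_on I u'"
proof -
  show "continuous_on I u"
    using assms unfolding C1_pair_def
    by (auto intro!: continuous_at_imp_continuous_on has_vector_derivative_continuous)
  show "continuous_on I u'"
    using assms unfolding C1_pair_def by (auto intro: continuous_on_subset)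
qed

lemma C1_pair_linear:
  assumes "C1_pair u u'" "bounded_linear T"
  shows "C1_pair (\<lambda>t. T (u t)) (\<lambda>t. T (u' t))"
  using assms bounded_linear.has_vector_derivative[OF assms(2)]
  by (auto simp: C1_pair_def intro: bounded_linear.continuous_on)

lemma C1_pair_add:
  assumes "C1_pair u u'" "C1_pair w w'"
  shows "C1_pair (\<lambda>t. u t + w t) (\<lambda>t. u' t + w' t)"
  using assms by (auto simp: C1_pair_def intro: has_vector_derivative_add continuous_on_add)

lemma C1_pair_diff:
  assumes "C1_pair u u'" "C1_pair w w'"
  shows "C1_pair (\<lambda>t. u t - w t) (\<lambda>t. u' t - w' t)"
  using assms by (auto simp: C1_pair_def intro: has_vector_derivative_diff continuous_on_diff)

lemma C1_pair_const: "C1_pair (\<lambda>_. c) (\<lambda>_. 0)"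
  by (simp add: C1_pair_def)

lemma C1_pair_shift:
  assumes "C1_pair u u'"
  shows "C1_pair (\<lambda>t. u (t - a)) (\<lambda>t. u' (t - a))"
  unfolding C1_pair_def
proof (intro conjI allI)
  fix t
  have "((\<lambda>t. t - a) has_vector_derivative 1) (at t)"
    by (auto intro!: derivative_eq_intros)
  moreover have "(u has_vector_derivative u' (t - a)) (at (t - a))"
    using assms by (simp add: C1_pair_def)
  ultimately have "((u \<circ> (\<lambda>t. t - a)) has_vector_derivative 1 *\<^sub>R u' (t - a)) (at t)"
    by (rule vector_diff_chain_at)
  then show "((\<lambda>t. u (t - a)) has_vector_derivative u' (t - a)) (at t)"
    by (simp add: o_def)
next
  show "continuous_on UNIV (\<lambda>t. u' (t - a))"
    by (rule continuous_on_compose2[OF C1_pair_continuous(2)[OF assms, of UNIV]])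
      (auto intro!: continuous_intros)
qed

lemma C1_pair_primitive:
  fixes u :: "real \<Rightarrow> 'a::{real_inner,banach,second_countable_topology}"
  assumes "C1_pair u u'"
  shows "primitive_on a b u u'"
proof (rule primitive_on_inner_iff)
  show "set_integrable lebesgue {a..b} u'"
    by (rule set_integrable_continuous[OF C1_pair_continuous(2)[OF assms]])
  fix w
  have "C1_pair (\<lambda>t. u t \<bullet> w) (\<lambda>t. u' t \<bullet> w)"
    by (rule C1_pair_linear[OF assms bounded_linear_inner_left])
  then show "primitive_on a b (\<lambda>t. u t \<bullet> w) (\<lambda>t. u' t \<bullet> w)"
    by (intro primitive_on_C1_real) (auto simp: C1_pair_def intro: has_vector_derivative_at_within continuous_on_subset)
qed

text \<open>The exponential series of \<open>T\<close> applied to \<open>x\<close>, differentiated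
  term by term; both series converge uniformly on bounded intervals.\<close>

lemma linear_ode_exists:
  fixes T :: "'a::banach \<Rightarrow> 'a"
  assumes T: "bounded_linear T"
  shows "\<exists>w. w 0 = x \<and> C1_pair w (\<lambda>t. T (w t))"
proof -
  obtain K where K: "K > 0" "\<And>x. norm (T x) \<le> norm x * K"
    using bounded_linear.pos_bounded[OF T] by blast
  note Tl = linear_simps[OF T]
  define p where "p n = (T ^^ n) x" for n
  have p_bound: "norm (p n) \<le> K ^ n * norm x" for n
  proof (induction n)
    case (Suc n)
    have "norm (p (Suc n)) \<le> norm (p n) * K"
      using K(2)[of "p n"] by (simp add: p_def)
    also have "\<dots> \<le> K ^ n * norm x * K"
      using Suc K(1) by (intro mult_right_mono) auto
    finally show ?case by (simp add: mult_ac)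
  qed (simp add: p_def)
  define F where "F n t = (t ^ n / fact n) *\<^sub>R p n" for n and t :: real
  define w where "w t = (\<Sum>n. F n t)" for t
  have F_bound: "norm (F n t) \<le> ((r * K) ^ n / fact n) * norm x" if "\<bar>t\<bar> \<le> r" for n t r
  proof -
    have "norm (F n t) = \<bar>t\<bar> ^ n / fact n * norm (p n)"
      by (simp add: F_def power_abs)
    also have "\<dots> \<le> r ^ n / fact n * (K ^ n * norm x)"
      using that p_bound[of n] by (intro mult_mono divide_right_mono power_mono) auto
    finally show ?thesis by (simp add: power_mult_distrib mult_ac)
  qed
  have sum_bound: "summable (\<lambda>n. ((r * K) ^ n / fact n) * norm x)" for r
    using summable_exp_generic[of "r * K"] by (intro summable_mult2) (simp add: field_simps)
  have sums: "(\<lambda>n. F n t) sums w t" for t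
  proof -
    have "summable (\<lambda>n. F n t)"
      by (rule summable_comparison_test'[OF sum_bound[of "\<bar>t\<bar>"]]) (rule F_bound, simp)
    then show ?thesis by (simp add: w_def summable_sums)
  qed
  have unif: "uniform_limit {-r..r} (\<lambda>n t. \<Sum>i<n. F i t) w sequentially" for r
    unfolding w_def by (rule Weierstrass_m_test[OF F_bound sum_bound[of r]]) auto
  \<comment> \<open>The derivative of term \<open>n\<close> is \<open>T\<close> of term
    \<open>n - 1\<close>, and 0 for \<open>n = 0\<close>; so the first \<open>n\<close> derivatives
    add up to \<open>T\<close> of the first \<open>n - 1\<close> terms, which is why
    \<open>n - 1\<close> appears in the uniform estimate below.\<close>
  define F' where "F' n t = (case n of 0 \<Rightarrow> 0 | Suc m \<Rightarrow> T (F m t))" for n t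
  have der: "(w has_vector_derivative T (w t)) (at t)" for t
  proof -
    define r where "r = \<bar>t\<bar> + 1"
    have cvx: "convex {-r..r}" and t: "t \<in> {-r..r}" by (auto simp: r_def)
    have "\<exists>g. \<forall>s\<in>{-r..r}. (\<lambda>n. F n s) sums g s \<and> (g has_derivative (\<lambda>h. h *\<^sub>R T (w s))) (at s within {-r..r})"
    proof (rule has_derivative_series[OF cvx _ _ t sums])
      show "(F n has_derivative (\<lambda>h. h *\<^sub>R F' n s)) (at s within {-r..r})" for n s
      proof (cases n)
        case 0
        have "F 0 = (\<lambda>t. p 0)" by (simp add: F_def fun_eq_iff)
        then show ?thesis unfolding 0 by (simp add: F'_def)
      next
        case (Suc m)
        have "((\<lambda>t. t ^ n / fact n) has_vector_derivative s ^ m / fact m) (at s within {-r..r})"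
        proof -
          have "((\<lambda>t. t ^ Suc m / fact (Suc m)) has_real_derivative (real (Suc m) * s ^ m) / fact (Suc m)) (at s within {-r..r})"
            using DERIV_cdivide[OF DERIV_pow[of "Suc m" s "{-r..r}"], of "fact (Suc m)"] by simp
          moreover have "(real (Suc m) * s ^ m) / fact (Suc m) = s ^ m / fact m"
            unfolding fact_Suc of_nat_mult by (rule nonzero_mult_divide_mult_cancel_left) simp
          ultimately show ?thesis
            unfolding Suc has_real_derivative_iff_has_vector_derivative[symmetric] by (simp only:)
        qed
        then have "((\<lambda>t. (t ^ n / fact n) *\<^sub>R p n) has_vector_derivative (s ^ m / fact m) *\<^sub>R p n) (at s within {-r..r})"
          by (rule bounded_linear.has_vector_derivative[OF bounded_linear_scaleR_left])
        moreover have "(s ^ m / fact m) *\<^sub>R p n = F' n s"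
          using Suc by (simp add: F'_def F_def p_def Tl)
        moreover have "F n = (\<lambda>t. (t ^ n / fact n) *\<^sub>R p n)"
          by (simp add: F_def fun_eq_iff)
        ultimately show ?thesis
          by (simp add: has_vector_derivative_def)
      qed
      fix e :: real assume e: "e > 0"
      have "\<forall>\<^sub>F n in sequentially. \<forall>s\<in>{-r..r}. dist (\<Sum>i<n. F i s) (w s) < e / K"
        using unif[of r] e K(1) unfolding uniform_limit_iff by simp
      then obtain n0 where n0: "\<And>n. n \<ge> n0 \<Longrightarrow> \<forall>s\<in>{-r..r}. dist (\<Sum>i<n. F i s) (w s) < e / K"
        unfolding eventually_sequentially by blast
      have "\<forall>\<^sub>F n in sequentially. \<forall>s\<in>{-r..r}. dist (\<Sum>i<n - 1. F i s) (w s) < e / K"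
        using eventually_ge_at_top[of "Suc n0"] by (rule eventually_mono) (rule n0, simp)
      then show "\<forall>\<^sub>F n in sequentially. \<forall>s\<in>{-r..r}. \<forall>h.
          norm ((\<Sum>i<n. h *\<^sub>R F' i s) - h *\<^sub>R T (w s)) \<le> e * norm h"
      proof (rule eventually_mono, intro ballI allI)
        fix n s and h :: real
        assume *: "\<forall>s\<in>{-r..r}. dist (\<Sum>i<n - 1. F i s) (w s) < e / K" "s \<in> {-r..r}"
        have F'_sum: "(\<Sum>i<n. F' i s) = T (\<Sum>i<n - 1. F i s)"
        proof (cases n)
          case (Suc m)
          then show ?thesis
            unfolding Suc sum.lessThan_Suc_shift
            by (simp add: F'_def linear_sum[OF bounded_linear.linear[OF T]])
        qed (simp add: Tl)
        have "norm ((\<Sum>i<n. h *\<^sub>R F' i s) - h *\<^sub>R T (w s)) = \<bar>h\<bar> * norm (T ((\<Sum>i<n - 1. F i s) - w s))"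
          by (simp add: F'_sum Tl scaleR_sum_right[symmetric] scaleR_diff_right[symmetric])
        also have "\<dots> \<le> \<bar>h\<bar> * (norm ((\<Sum>i<n - 1. F i s) - w s) * K)"
          by (intro mult_left_mono K) auto
        also have "\<dots> \<le> \<bar>h\<bar> * (e / K * K)"
          using * K(1) by (intro mult_left_mono mult_right_mono) (auto simp: dist_norm less_imp_le)
        finally show "norm ((\<Sum>i<n. h *\<^sub>R F' i s) - h *\<^sub>R T (w s)) \<le> e * norm h"
          using K(1) by (simp add: mult_ac)
      qed
    qed
    then obtain g where g: "\<And>s. s \<in> {-r..r} \<Longrightarrow> (\<lambda>n. F n s) sums g s"
      "\<And>s. s \<in> {-r..r} \<Longrightarrow> (g has_derivative (\<lambda>h. h *\<^sub>R T (w s))) (at s within {-r..r})"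
      by blast
    have gw: "g s = w s" if "s \<in> {-r..r}" for s
      using g(1)[OF that] sums[of s] sums_unique2 by blast
    have "(w has_derivative (\<lambda>h. h *\<^sub>R T (w t))) (at t within {-r..r})"
      by (rule has_derivative_transform[OF t _ g(2)[OF t]]) (simp add: gw)
    moreover have "at t within {-r..r} = at t"
      by (rule at_within_interior) (auto simp: r_def)
    ultimately show ?thesis
      by (simp add: has_vector_derivative_def)
  qed
  have "continuous_on UNIV w"
    using der by (auto intro!: continuous_at_imp_continuous_on has_vector_derivative_continuous)
  then have "C1_pair w (\<lambda>t. T (w t))"
    unfolding C1_pair_def using der by (auto intro: bounded_linear.continuous_on[OF T])
  moreover have "w 0 = x"
  proof -
    have "(\<lambda>n. F n 0) sums (\<Sum>n\<in>{0}. F n 0)"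
      by (rule sums_finite) (auto simp: F_def)
    then show ?thesis
      using sums_unique2[OF sums[of 0]] by (simp add: F_def p_def)
  qed
  ultimately show ?thesis by blast
qed

section \<open>Approximate solutions of S u' + u = g\<close>

context pivot_space
begin

text \<open>The solution for \<open>t ^ Suc k\<close> has as derivative \<open>Suc k\<close> times
  the solution for \<open>t ^ k\<close>. Inserting this into the equation expresses it
  algebraically, with only the bounded operator \<open>S\<close> involved.\<close>

lemma exact_solution_monomial:
  "\<exists>u u'. C1_pair u u' \<and> (\<forall>t. S (u' t) + u t = t ^ k *\<^sub>R c)"
proof (induction k)
  case 0
  then show ?case
    by (intro exI[of _ "\<lambda>_. c"] exI[of _ "\<lambda>_. 0"]) (simp add: C1_pair_const S_simps)
next
  case (Suc k)
  then obtain u u' where u: "C1_pair u u'" "\<And>t. S (u' t) + u t = t ^ k *\<^sub>R c" by blast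
  define w w' where "w t = t ^ Suc k *\<^sub>R c - real (Suc k) *\<^sub>R S (u t)"
    and "w' t = (real (Suc k) * t ^ k) *\<^sub>R c - real (Suc k) *\<^sub>R S (u' t)" for t
  have "C1_pair (\<lambda>t. t ^ Suc k *\<^sub>R c) (\<lambda>t. (real (Suc k) * t ^ k) *\<^sub>R c)"
    unfolding C1_pair_def
  proof (intro conjI allI)
    fix t
    have "((\<lambda>t. t ^ Suc k) has_vector_derivative real (Suc k) * t ^ k) (at t)"
      using DERIV_pow[of "Suc k" t] by (simp add: has_real_derivative_iff_has_vector_derivative)
    then show "((\<lambda>t. t ^ Suc k *\<^sub>R c) has_vector_derivative (real (Suc k) * t ^ k) *\<^sub>R c) (at t)"
      by (rule bounded_linear.has_vector_derivative[OF bounded_linear_scaleR_left])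
  qed (intro continuous_intros)
  moreover have "C1_pair (\<lambda>t. real (Suc k) *\<^sub>R S (u t)) (\<lambda>t. real (Suc k) *\<^sub>R S (u' t))"
    by (intro C1_pair_linear[OF C1_pair_linear[OF u(1) bounded_linear_S] bounded_linear_scaleR_right])
  ultimately have "C1_pair w w'"
    unfolding w_def w'_def by (rule C1_pair_diff)
  moreover have "S (w' t) + w t = t ^ Suc k *\<^sub>R c" for t
  proof -
    have "S (w' t) + w t = t ^ Suc k *\<^sub>R c + real (Suc k) *\<^sub>R S (t ^ k *\<^sub>R c - (S (u' t) + u t))"
      by (simp only: w_def w'_def S_simps scaleR_scaleR scaleR_add_right scaleR_diff_right)
        (simp add: algebra_simps)
    then show ?thesis by (simp only: u(2)) (simp add: S_simps)
  qed
  ultimately show ?case by blast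
qed

lemma exact_solution_sum:
  assumes "finite I" "\<And>i. i \<in> I \<Longrightarrow> \<exists>u u'. C1_pair u u' \<and> (\<forall>t. S (u' t) + u t = g i t)"
  shows "\<exists>u u'. C1_pair u u' \<and> (\<forall>t. S (u' t) + u t = (\<Sum>i\<in>I. g i t))"
  using assms
proof (induction I)
  case empty
  then show ?case
    by (intro exI[of _ "\<lambda>_. 0"]) (simp add: C1_pair_const S_simps)
next
  case (insert i I)
  then obtain u u' w w' where *: "C1_pair u u'" "\<forall>t. S (u' t) + u t = g i t"
    "C1_pair w w'" "\<forall>t. S (w' t) + w t = (\<Sum>i\<in>I. g i t)" by blast
  have "\<forall>t. S (u' t + w' t) + (u t + w t) = (\<Sum>i\<in>insert i I. g i t)"
    using * insert.hyps by (simp add: S_simps algebra_simps)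
  then show ?case
    using C1_pair_add[OF *(1,3)] by blast
qed

lemma exact_solution_polynomial:
  assumes "real_polynomial_function (q :: real \<Rightarrow> real)"
  shows "\<exists>u u'. C1_pair u u' \<and> (\<forall>t. S (u' t) + u t = q t *\<^sub>R c)"
proof -
  obtain p n where q: "q = (\<lambda>t. \<Sum>i\<le>n. p i * t ^ i)"
    using assms unfolding real_polynomial_function_iff_sum by blast
  have "\<exists>u u'. C1_pair u u' \<and> (\<forall>t. S (u' t) + u t = (\<Sum>i\<in>{..n}. t ^ i *\<^sub>R (p i *\<^sub>R c)))"
    by (rule exact_solution_sum[OF finite_atMost exact_solution_monomial])
  moreover have "(\<Sum>i\<in>{..n}. t ^ i *\<^sub>R (p i *\<^sub>R c)) = q t *\<^sub>R c" for t
    unfolding q scaleR_sum_left by (rule sum.cong[OF refl]) (simp only: scaleR_scaleR mult.commute)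
  ultimately show ?thesis by (simp only:)
qed

text \<open>A partition of unity made of hat functions on small balls replaces \<open>g\<close> by a
  finite combination of its own values with scalar coefficients, at cost \<open>e / 2\<close>. Each
  coefficient is then approximated by a polynomial; \<open>B\<close> scales these errors to
  \<open>e / 2\<close> in total.\<close>

lemma approx_by_polynomials:
  fixes g :: "real \<Rightarrow> 'a::real_normed_vector"
  assumes g: "continuous_on {a..b} g" and e: "e > 0"
  shows "\<exists>(I :: real set) q. finite I \<and> (\<forall>i\<in>I. real_polynomial_function (q i)) \<and>
    (\<forall>t\<in>{a..b}. norm (g t - (\<Sum>i\<in>I. q i t *\<^sub>R g i)) \<le> e)"
proof -
  have uc: "uniformly_continuous_on {a..b} g"
    using compact_uniformly_continuous[OF g compact_Icc] .
  have pos: "e / 2 > 0" using e by simp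
  obtain d where d: "d > 0" "\<forall>s\<in>{a..b}. \<forall>t\<in>{a..b}. dist t s < d \<longrightarrow> dist (g t) (g s) < e / 2"
    using uc[unfolded uniformly_continuous_on_def, rule_format, OF pos] by (elim exE conjE) (rule that)
  have cover: "{a..b} \<subseteq> (\<Union>i\<in>{a..b}. ball i d)"
    using d(1) centre_in_ball by blast
  obtain I where I: "I \<subseteq> {a..b}" "finite I" "{a..b} \<subseteq> (\<Union>i\<in>I. ball i d)"
    by (rule compactE_image[OF compact_Icc _ cover]) (rule open_ball)
  define \<psi> where "\<psi> i t = max 0 (d - \<bar>t - i\<bar>)" for i t
  define Z where "Z t = (\<Sum>i\<in>I. \<psi> i t)" for t
  have Z: "Z t > 0" if t: "t \<in> {a..b}" for t
  proof -
    obtain i where "i \<in> I" "\<bar>t - i\<bar> < d"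
      using I(3) t unfolding subset_iff UN_iff mem_ball dist_real_def by (metis abs_minus_commute)
    then show ?thesis
      unfolding Z_def \<psi>_def by (intro sum_pos2[OF I(2)]) (simp_all add: less_max_iff_disj)
  qed
  define B where "B = (\<Sum>i\<in>I. norm (g i)) + 1"
  have B: "B > 0" unfolding B_def by (intro add_nonneg_pos sum_nonneg) auto
  have c\<psi>: "continuous_on {a..b} (\<psi> i)" for i
    unfolding \<psi>_def by (intro continuous_intros)
  have cZ: "continuous_on {a..b} Z"
    unfolding Z_def by (rule continuous_on_sum) (rule c\<psi>)
  have nz: "\<forall>t\<in>{a..b}. Z t \<noteq> 0"
    by (intro ballI less_imp_neq[symmetric] Z)
  have c: "continuous_on {a..b} (\<lambda>t. \<psi> i t / Z t)" for i
    by (rule continuous_on_divide[OF c\<psi> cZ nz])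
  have "\<exists>q. real_polynomial_function q \<and> (\<forall>t\<in>{a..b}. \<bar>\<psi> i t / Z t - q t\<bar> < e / (2 * B))" for i
  proof -
    have pos: "e / (2 * B) > 0" using e B by simp
    obtain q where "real_polynomial_function q" "\<And>t. t \<in> {a..b} \<Longrightarrow> \<bar>\<psi> i t / Z t - q t\<bar> < e / (2 * B)"
      by (rule Stone_Weierstrass_real_polynomial_function[OF compact_Icc c[of i] pos]) blast
    then show ?thesis by (intro exI[of _ q]) simp
  qed
  then obtain q where q: "\<And>i. real_polynomial_function (q i)"
    "\<And>i t. t \<in> {a..b} \<Longrightarrow> \<bar>\<psi> i t / Z t - q i t\<bar> < e / (2 * B)"
    by metis
  have "norm (g t - (\<Sum>i\<in>I. q i t *\<^sub>R g i)) \<le> e" if t: "t \<in> {a..b}" for t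
  proof -
    have one: "(\<Sum>i\<in>I. \<psi> i t / Z t) = 1"
      using Z[OF t] by (simp add: sum_divide_distrib[symmetric] Z_def)
    have eq: "g t - (\<Sum>i\<in>I. q i t *\<^sub>R g i)
        = (\<Sum>i\<in>I. (\<psi> i t / Z t) *\<^sub>R (g t - g i)) + (\<Sum>i\<in>I. (\<psi> i t / Z t - q i t) *\<^sub>R g i)"
      by (simp add: scaleR_diff_right scaleR_diff_left sum_subtractf scaleR_sum_left[symmetric] one)
    have "norm (g t - (\<Sum>i\<in>I. q i t *\<^sub>R g i))
        \<le> (\<Sum>i\<in>I. (\<psi> i t / Z t) * (e / 2)) + (\<Sum>i\<in>I. e / (2 * B) * norm (g i))"
      unfolding eq
    proof (intro norm_triangle_mono sum_norm_le)
      fix i assume i: "i \<in> I"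
      show "norm ((\<psi> i t / Z t) *\<^sub>R (g t - g i)) \<le> \<psi> i t / Z t * (e / 2)"
      proof (cases "\<bar>t - i\<bar> < d")
        case True
        then have le: "norm (g t - g i) \<le> e / 2"
          using d(2)[rule_format, of i t] t i I(1) by (simp add: dist_norm subset_iff less_imp_le)
        have nn: "0 \<le> \<psi> i t / Z t"
          using Z[OF t] by (simp add: \<psi>_def)
        show ?thesis
          unfolding norm_scaleR abs_of_nonneg[OF nn] by (rule mult_left_mono[OF le nn])
      qed (simp add: \<psi>_def)
      show "norm ((\<psi> i t / Z t - q i t) *\<^sub>R g i) \<le> e / (2 * B) * norm (g i)"
        unfolding norm_scaleR by (rule mult_right_mono[OF less_imp_le[OF q(2)[OF t]] norm_ge_zero])
    qed
    also have "\<dots> = e / 2 + e / (2 * B) * (B - 1)"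
    proof -
      have "(\<Sum>i\<in>I. (\<psi> i t / Z t) * (e / 2)) = e / 2"
        by (subst sum_distrib_right[symmetric]) (simp only: one mult_1)
      moreover have "(\<Sum>i\<in>I. e / (2 * B) * norm (g i)) = e / (2 * B) * (B - 1)"
        by (subst sum_distrib_left[symmetric]) (simp only: B_def add_diff_cancel_right')
      ultimately show ?thesis by (simp only:)
    qed
    also have "\<dots> \<le> e / 2 + e / (2 * B) * B"
      using e B by (intro add_left_mono mult_left_mono) auto
    also have "\<dots> = e" using B by simp
    finally show ?thesis by simp
  qed
  then show ?thesis using I(2) q(1) by (intro exI[of _ I] exI[of _ q]) simp
qed

lemma N_form_nonneg:
  assumes "l \<ge> 0" shows "0 \<le> v \<bullet> N l v"
  unfolding norm_N_sq[OF assms, symmetric] using assms by simp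

text \<open>\<open>M\<close>, the Yosida approximation of \<open>A\<close>, generates the evolution
  \<open>w\<close>. The residual of the exact equation along \<open>w\<close> is
  \<open>M w / l\<close>. Since \<open>M\<close> is nonnegative, \<open>norm (M w)\<close> does not
  increase, and it starts from \<open>x - N l x\<close> because the initial value \<open>S x\<close>
  lies in the range of \<open>S\<close>.\<close>

lemma homogeneous_approx:
  assumes l: "l > 0"
  shows "\<exists>w w'. C1_pair w w' \<and> w 0 = S x \<and> (\<forall>t\<ge>0. norm (S (w' t) + w t) \<le> 2 * norm x / l)"
proof -
  have l0: "l \<ge> 0" using l by simp
  define M where "M v = l *\<^sub>R N l v" for v
  have M: "bounded_linear M"
    unfolding M_def by (rule bounded_linear_compose[OF bounded_linear_scaleR_right bounded_linear_N[OF l0]])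
  then have nM: "bounded_linear (\<lambda>v. - M v)" by (rule bounded_linear_minus)
  obtain w where w: "w 0 = S x" "C1_pair w (\<lambda>t. - M (w t))"
    using linear_ode_exists[OF nM, of "S x"] by blast
  define z where "z t = M (w t)" for t
  have z: "C1_pair z (\<lambda>t. - M (z t))"
    using C1_pair_linear[OF w(2) M] unfolding z_def by (simp add: linear_simps[OF M])
  have mono: "z t \<bullet> z t \<le> z 0 \<bullet> z 0" if "t \<ge> 0" for t
  proof (rule DERIV_nonpos_imp_nonincreasing[OF that])
    fix s
    have zd: "(z has_vector_derivative - M (z s)) (at s)" using z by (simp add: C1_pair_def)
    have "((\<lambda>t. z t \<bullet> z t) has_real_derivative - 2 * (M (z s) \<bullet> z s)) (at s)"
      unfolding has_real_derivative_iff_has_vector_derivative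
      using bounded_bilinear.has_vector_derivative[OF bounded_bilinear_inner zd zd]
      by (simp add: inner_commute)
    moreover have "M (z s) \<bullet> z s \<ge> 0"
      using N_form_nonneg[OF l0, of "z s"] l0 by (simp add: M_def inner_commute)
    ultimately show "\<exists>y. ((\<lambda>t. z t \<bullet> z t) has_real_derivative y) (at s) \<and> y \<le> 0"
      by (intro exI conjI) auto
  qed
  have z0: "norm (z 0) \<le> 2 * norm x"
    using norm_triangle_ineq4[of x "N l x"] norm_N_le[OF l0, of x]
    by (simp add: z_def w(1) M_def N_S[OF l0])
  have "norm (S (- M (w t)) + w t) \<le> 2 * norm x / l" if "t \<ge> 0" for t
  proof -
    have "S (M (w t)) = w t - N l (w t)"
      unfolding M_def using N_eq[OF l0, of "w t"] by (simp add: S_simps algebra_simps)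
    then have "S (- M (w t)) + w t = (1 / l) *\<^sub>R z t"
      using l by (simp add: S_simps z_def M_def)
    moreover have "norm (z t) \<le> 2 * norm x"
      using mono[OF that] z0 norm_le[of "z t" "z 0"] by linarith
    ultimately show ?thesis
      using l by (simp add: divide_right_mono)
  qed
  then show ?thesis using w by blast
qed

text \<open>Superposition of an exact solution for a polynomial approximation of \<open>g\<close>
  and a nearly homogeneous solution that corrects the initial value. The correction must start in
  the range of \<open>S\<close>; this range is dense in V, and V is dense in H.\<close>

lemma approx_solution:
  assumes g: "continuous_on {a..b} g" and e: "e > 0"
  shows "\<exists>v v'. C1_pair v v' \<and> norm (j (v a) - h) \<le> e \<and>
    (\<forall>t\<in>{a..b}. norm (S (v' t) + v t - g t) \<le> e)"
proof -
  have e2: "e / 2 > 0" using e by simp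
  obtain I q where Iq: "finite I" "\<forall>i\<in>I. real_polynomial_function (q i)"
    "\<forall>t\<in>{a..b}. norm (g t - (\<Sum>i\<in>I. q i t *\<^sub>R g i)) \<le> e / 2"
    using approx_by_polynomials[OF g e2] by (elim exE conjE) (rule that)
  have "\<exists>u u'. C1_pair u u' \<and> (\<forall>t. S (u' t) + u t = (\<Sum>i\<in>I. q i t *\<^sub>R g i))"
    by (rule exact_solution_sum[OF Iq(1) exact_solution_polynomial[OF bspec[OF Iq(2)]]])
  then obtain u u' where u: "C1_pair u u'" "\<forall>t. S (u' t) + u t = (\<Sum>i\<in>I. q i t *\<^sub>R g i)"
    by (elim exE conjE) (rule that)
  have "h - j (u a) \<in> closure (range (blinfun_apply j))" by (simp add: dense_j)
  moreover have "e / 2 > 0" using e by simp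
  ultimately obtain v1 where v1: "dist (j v1) (h - j (u a)) < e / 2"
    unfolding closure_approachable by blast
  have "v1 \<in> closure (range S)" by (simp add: dense_range_S)
  moreover have d: "e / (2 * (norm j + 1)) > 0"
    using e by (intro divide_pos_pos mult_pos_pos add_nonneg_pos) auto
  ultimately obtain x where x: "dist (S x) v1 < e / (2 * (norm j + 1))"
    unfolding closure_approachable by blast
  define l where "l = 4 * (norm x + 1) / e"
  have l: "l > 0" "2 * norm x / l \<le> e / 2"
  proof -
    have n1: "norm x + 1 > 0" by (simp add: add_nonneg_pos)
    then show "l > 0" using e by (simp add: l_def)
    have "2 * p / (4 * n / e) = (e / 2) * (p / n)" for p n :: real
      by simp
    then have "2 * norm x / l = (e / 2) * (norm x / (norm x + 1))"
      unfolding l_def .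
    also have "\<dots> \<le> (e / 2) * 1"
      using n1 e by (intro mult_left_mono) auto
    finally show "2 * norm x / l \<le> e / 2" by simp
  qed
  obtain w w' where w: "C1_pair w w'" "w 0 = S x" "\<And>t. t \<ge> 0 \<Longrightarrow> norm (S (w' t) + w t) \<le> 2 * norm x / l"
    using homogeneous_approx[OF l(1), of x] by blast
  define v v' where "v t = u t + w (t - a)" and "v' t = u' t + w' (t - a)" for t
  have "C1_pair v v'"
    unfolding v_def v'_def by (intro C1_pair_add C1_pair_shift u w)
  moreover have "norm (j (v a) - h) \<le> e"
  proof -
    have eq: "j (v a) - h = j (S x - v1) + (j v1 - (h - j (u a)))"
      by (simp add: v_def w(2) blinfun.bilinear_simps)
    have "norm (j (v a) - h) \<le> norm j * norm (S x - v1) + e / 2"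
      unfolding eq using v1 by (intro norm_triangle_mono norm_blinfun) (simp add: dist_norm)
    also have "\<dots> \<le> (norm j + 1) * (e / (2 * (norm j + 1))) + e / 2"
      using x by (intro add_right_mono mult_mono) (auto simp: dist_norm)
    also have "\<dots> = e"
    proof -
      have "n * (e / (2 * n)) + e / 2 = e" if "n \<noteq> 0" for n :: real
        using that by simp
      then show ?thesis using norm_ge_zero[of j] by (metis add_nonneg_pos less_irrefl zero_less_one)
    qed
    finally show ?thesis .
  qed
  moreover have "norm (S (v' t) + v t - g t) \<le> e" if t: "t \<in> {a..b}" for t
  proof -
    have eq: "S (v' t) + v t - g t = (S (w' (t - a)) + w (t - a)) - (g t - (\<Sum>i\<in>I. q i t *\<^sub>R g i))"
      using u(2)[rule_format, of t, symmetric] by (simp add: v_def v'_def S_simps)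
    have "norm (S (v' t) + v t - g t)
        \<le> norm (S (w' (t - a)) + w (t - a)) + norm (g t - (\<Sum>i\<in>I. q i t *\<^sub>R g i))"
      unfolding eq by (rule norm_triangle_ineq4)
    also have "\<dots> \<le> e / 2 + e / 2"
      using w(3)[of "t - a"] l(2) bspec[OF Iq(3) t] t by (intro add_mono) auto
    finally show ?thesis by simp
  qed
  ultimately show ?thesis by blast
qed

end

section \<open>Existence of weak solutions by a weighted contraction\<close>

text \<open>The rate 16^-k leaves room for weights 4^k: the sum \<open>D\<close> of the weighted
  squared increments is integrable, hence finite almost everywhere, and bounds the k-th increment by
  \<open>sqrt D\<close> times 2^-k. This gives pointwise convergence together with one integrable
  majorant for the whole sequence.\<close>

lemma fast_Cauchy_L2_limit:
  fixes V :: "nat \<Rightarrow> real \<Rightarrow> 'a::{banach,second_countable_topology}"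
  assumes cont: "\<And>k. continuous_on {a..b} (V k)"
    and fast: "\<And>k. (LINT t:{a..b}|lebesgue. (norm (V (Suc k) t - V k t))\<^sup>2) \<le> K * (1/16) ^ k"
  shows "\<exists>v D. sq_integrable {a..b} v \<and> set_integrable lebesgue {a..b} D \<and>
    (AE t in lebesgue. t \<in> {a..b} \<longrightarrow> (\<lambda>n. V n t) \<longlonglongrightarrow> v t \<and> (\<forall>n. (norm (V n t - V 0 t))\<^sup>2 \<le> 4 * D t))"
proof -
  define d where "d k t = norm (V (Suc k) t - V k t)" for k t
  define F where "F = (\<lambda>k t. indicat_real {a..b} t * (4 ^ k * (d k t)\<^sup>2))"
  define D where "D = (\<lambda>t. \<Sum>k. F k t)"
  have F0: "F k t \<ge> 0" for k t by (simp add: F_def)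
  have "continuous_on {a..b} (\<lambda>t. 4 ^ k * (d k t)\<^sup>2)" for k
    unfolding d_def by (intro continuous_intros cont)
  from set_integrable_continuous[OF this]
  have F_int: "integrable lebesgue (F k)" for k
    by (simp add: set_integrable_def F_def)
  have F_integral: "(LINT t|lebesgue. F k t) \<le> K * (1/4) ^ k" for k
  proof -
    have "(LINT t|lebesgue. F k t) = (LINT t:{a..b}|lebesgue. 4 ^ k * (d k t)\<^sup>2)"
      by (simp only: F_def set_lebesgue_integral_def real_scaleR_def)
    also have "\<dots> = 4 ^ k * (LINT t:{a..b}|lebesgue. (d k t)\<^sup>2)"
      by (rule set_integral_mult_right)
    also have "\<dots> \<le> 4 ^ k * (K * (1/16) ^ k)"
      using fast[of k] by (intro mult_left_mono) (auto simp: d_def)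
    also have "\<dots> = K * (4 * (1/16)) ^ k"
      by (simp only: power_mult_distrib mult.left_commute)
    finally show ?thesis by simp
  qed
  have geo: "summable (\<lambda>k. K * (1/4 :: real) ^ k)"
    by (intro summable_mult summable_geometric) simp
  have sumI: "summable (\<lambda>k. LINT t|lebesgue. F k t)"
    by (rule summable_comparison_test'[OF geo]) (use F_integral in \<open>simp add: F0\<close>)
  have "(\<integral>\<^sup>+t. (\<Sum>k. ennreal (F k t)) \<partial>lebesgue) = (\<Sum>k. \<integral>\<^sup>+t. ennreal (F k t) \<partial>lebesgue)"
    by (rule nn_integral_suminf) (use F_int in \<open>auto dest: borel_measurable_integrable\<close>)
  also have "\<dots> = (\<Sum>k. ennreal (LINT t|lebesgue. F k t))"
    by (intro suminf_cong nn_integral_eq_integral F_int) (simp add: F0)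
  also have "\<dots> = ennreal (\<Sum>k. LINT t|lebesgue. F k t)"
    by (rule suminf_ennreal2[OF _ sumI]) (simp add: F0)
  also have "\<dots> < \<infinity>" by simp
  finally have "AE t in lebesgue. (\<Sum>k. ennreal (F k t)) \<noteq> \<infinity>"
    by (intro nn_integral_PInf_AE) (use F_int in \<open>auto dest: borel_measurable_integrable\<close>)
  then have summ: "AE t in lebesgue. summable (\<lambda>k. F k t)"
    by (rule eventually_mono) (auto intro: summable_suminf_not_top F0)
  have D_int: "integrable lebesgue D"
    unfolding D_def
    by (rule integrable_suminf[OF F_int]) (use summ sumI in \<open>simp_all add: F0\<close>)
  define v where "v t = lim (\<lambda>n. indicat_real {a..b} t *\<^sub>R V n t)" for t
  have v_meas: "v \<in> borel_measurable lebesgue"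
    unfolding v_def using set_borel_measurable_continuous[OF cont]
    by (intro borel_measurable_lim_metric) (simp add: set_borel_measurable_def)
  have main: "(\<lambda>n. V n t) \<longlonglongrightarrow> v t \<and> (\<forall>n. (norm (V n t - V 0 t))\<^sup>2 \<le> 4 * D t)"
    if s: "summable (\<lambda>k. F k t)" and t: "t \<in> {a..b}" for t
  proof -
    have D0: "D t \<ge> 0" unfolding D_def by (intro suminf_nonneg s F0)
    have d_le: "d k t \<le> sqrt (D t) * (1/2) ^ k" for k
    proof -
      have "F k t \<le> D t"
        unfolding D_def using sum_le_suminf[OF s, of "{k}"] F0 by simp
      then have "(2 ^ k * d k t)\<^sup>2 \<le> D t"
        using t by (simp add: F_def power_mult_distrib power_mult[symmetric] mult.commute[of k] power_mult)
      then have "2 ^ k * d k t \<le> sqrt (D t)"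
        by (rule real_le_rsqrt)
      then show ?thesis by (simp add: field_simps power_divide)
    qed
    have geo2: "summable (\<lambda>k. sqrt (D t) * (1/2 :: real) ^ k)"
      by (intro summable_mult summable_geometric) simp
    have "summable (\<lambda>k. V (Suc k) t - V k t)"
      by (rule summable_comparison_test'[OF geo2]) (use d_le in \<open>simp add: d_def\<close>)
    from tendsto_add[OF tendsto_const[of "V 0 t"] summable_LIMSEQ[OF this]]
    have "(\<lambda>n. V n t) \<longlonglongrightarrow> V 0 t + (\<Sum>k. V (Suc k) t - V k t)"
      by (simp add: sum_lessThan_telescope[of "\<lambda>k. V k t"])
    moreover from limI[OF this] have "v t = V 0 t + (\<Sum>k. V (Suc k) t - V k t)"
      using t by (simp add: v_def)
    ultimately have lim: "(\<lambda>n. V n t) \<longlonglongrightarrow> v t" by simp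
    have "(norm (V n t - V 0 t))\<^sup>2 \<le> 4 * D t" for n
    proof -
      have "V n t - V 0 t = (\<Sum>k<n. V (Suc k) t - V k t)"
        by (rule sum_lessThan_telescope[symmetric])
      then have "norm (V n t - V 0 t) \<le> (\<Sum>k<n. d k t)"
        unfolding d_def by (simp only: norm_sum)
      also have "\<dots> \<le> (\<Sum>k<n. sqrt (D t) * (1/2) ^ k)"
        by (intro sum_mono d_le)
      also have "\<dots> \<le> (\<Sum>k. sqrt (D t) * (1/2) ^ k)"
        using D0 by (intro sum_le_suminf geo2) auto
      also have "\<dots> = 2 * sqrt (D t)"
        by (subst suminf_mult) (auto simp: suminf_geometric summable_geometric)
      finally have "(norm (V n t - V 0 t))\<^sup>2 \<le> (2 * sqrt (D t))\<^sup>2"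
        by (intro power_mono) auto
      then show ?thesis using D0 by (simp add: power_mult_distrib)
    qed
    with lim show ?thesis by blast
  qed
  have ae: "AE t in lebesgue. t \<in> {a..b} \<longrightarrow> (\<lambda>n. V n t) \<longlonglongrightarrow> v t \<and> (\<forall>n. (norm (V n t - V 0 t))\<^sup>2 \<le> 4 * D t)"
    by (rule eventually_mono[OF summ]) (use main in blast)
  have D_set: "set_integrable lebesgue {a..b} D"
    using integrable_mult_indicator[OF _ D_int, of "{a..b}"] by (simp add: set_integrable_def)
  have v_set: "set_borel_measurable lebesgue {a..b} v"
    using v_meas unfolding set_borel_measurable_def by (intro borel_measurable_scaleR borel_measurable_indicator) auto
  have "sq_integrable {a..b} (\<lambda>t. v t + (- 1) *\<^sub>R V 0 t)"
  proof (rule sq_integrable_bound[of _ _ "\<lambda>t. 4 * D t"])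
    show "set_borel_measurable lebesgue {a..b} (\<lambda>t. v t + (- 1) *\<^sub>R V 0 t)"
      by (intro set_borel_measurable_add v_set
          set_borel_measurable_linear[OF set_borel_measurable_continuous[OF cont] bounded_linear_scaleR_right])
    show "set_integrable lebesgue {a..b} (\<lambda>t. 4 * D t)" using D_set by simp
    show "AE t in lebesgue. t \<in> {a..b} \<longrightarrow> (norm (v t + (- 1) *\<^sub>R V 0 t))\<^sup>2 \<le> 4 * D t"
      using ae
    proof (rule eventually_mono, intro impI)
      fix t assume "t \<in> {a..b} \<longrightarrow> (\<lambda>n. V n t) \<longlonglongrightarrow> v t \<and> (\<forall>n. (norm (V n t - V 0 t))\<^sup>2 \<le> 4 * D t)"
        and "t \<in> {a..b}"
      then have *: "(\<lambda>n. V n t) \<longlonglongrightarrow> v t" "\<And>n. (norm (V n t - V 0 t))\<^sup>2 \<le> 4 * D t" by auto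
      have "(\<lambda>n. (norm (V n t - V 0 t))\<^sup>2) \<longlonglongrightarrow> (norm (v t - V 0 t))\<^sup>2"
        by (intro tendsto_intros *(1))
      then have "(norm (v t - V 0 t))\<^sup>2 \<le> 4 * D t"
        using *(2) by (intro LIMSEQ_le_const2) auto
      then show "(norm (v t + (- 1) *\<^sub>R V 0 t))\<^sup>2 \<le> 4 * D t" by simp
    qed
  qed
  from sq_integrable_add[OF this sq_integrable_continuous[OF cont[of 0]]]
  have "sq_integrable {a..b} v" by simp
  with D_set ae show ?thesis by (intro exI[of _ v] exI[of _ D] conjI)
qed

context pivot_space
begin

definition energy_density :: "real \<Rightarrow> real \<Rightarrow> (real \<Rightarrow> 'v) \<Rightarrow> real \<Rightarrow> real" where
  "energy_density l a u t = exp (- 2 * l * (t - a)) * ((norm (u t))\<^sup>2 + l * (norm (j (u t)))\<^sup>2)"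

lemma energy_density_nonneg: "l \<ge> 0 \<Longrightarrow> 0 \<le> energy_density l a u t"
  by (simp add: energy_density_def)

lemma energy_density_integrable:
  assumes "continuous_on {a..b} u" "a \<le> s" "t \<le> b"
  shows "set_integrable lebesgue {s..t} (energy_density l a u)"
proof -
  have "{s..t} \<subseteq> {a..b}" using assms by auto
  then have "continuous_on {s..t} u" by (rule continuous_on_subset[OF assms(1)])
  then show ?thesis
    unfolding energy_density_def by (intro set_integrable_continuous continuous_intros)
qed

text \<open>The energy estimate for a difference \<open>d\<close> of iterates whose lower-order term
  acts on the preceding difference \<open>q\<close>. Young's inequality leaves 1/64 in front of
  \<open>q\<close>; \<open>l = 128 * C^2 + 1\<close> meets the two requirements
  \<open>64 * C^2 \<le> l\<close> and \<open>2 * C^2 \<le> l / 64\<close>.\<close>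

lemma contraction_step:
  assumes R: "rel_bounded C R {a..b}" and d: "C1_pair d d'" and q: "continuous_on {a..b} q"
    and res: "\<And>t. t \<in> {a..b} \<Longrightarrow> norm (S (d' t) + d t + riesz (R t (q t))) \<le> \<rho>"
    and init: "norm (j (d a)) \<le> \<rho>" and l: "l = 128 * C\<^sup>2 + 1" and t: "t \<in> {a..b}"
  shows "exp (- 2 * l * (t - a)) * (norm (j (d t)))\<^sup>2 + (LINT r:{a..t}|lebesgue. energy_density l a d r)
    \<le> (1/64) * (LINT r:{a..t}|lebesgue. energy_density l a q r) + \<rho>\<^sup>2 * (1 + 2 * (b - a))"
proof -
  have l0: "l \<ge> 0" unfolding l by (simp add: add_nonneg_nonneg)
  have cd: "continuous_on {a..b} d" using C1_pair_continuous(1)[OF d] .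
  have at: "a \<le> t" "t \<le> b" using t by auto
  have "C1_pair (\<lambda>t. j (d t)) (\<lambda>t. j (d' t))"
    using C1_pair_linear[OF d blinfun.bounded_linear_right] .
  from C1_pair_primitive[OF this, of a b]
  have "primitive_on a b (\<lambda>t. j (d t) \<bullet> j (d t)) (\<lambda>t. j (d' t) \<bullet> j (d t) + j (d t) \<bullet> j (d' t))"
    using primitive_on_bilinear[OF _ _ bounded_bilinear_inner] by blast
  moreover have "j (d' t) \<bullet> j (d t) + j (d t) \<bullet> j (d' t) = 2 * (S (d' t) \<bullet> d t)" for t
    by (simp add: S_inner inner_commute[of "j (d t)"])
  ultimately have "primitive_on a b (\<lambda>t. (norm (j (d t)))\<^sup>2) (\<lambda>t. 2 * (S (d' t) \<bullet> d t))"
    by (simp only: power2_norm_eq_inner)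
  from primitive_on_exp_weight[OF this, of "- 2 * l" a]
  have prim: "primitive_on a b (\<lambda>t. exp (- 2 * l * (t - a)) * (norm (j (d t)))\<^sup>2)
    (\<lambda>t. exp (- 2 * l * (t - a)) * (- 2 * l * (norm (j (d t)))\<^sup>2 + 2 * (S (d' t) \<bullet> d t)))" .
  define G where "G r = - energy_density l a d r + ((1/64) * energy_density l a q r + 2 * \<rho>\<^sup>2)" for r
  have ic: "set_integrable lebesgue {a..t} (\<lambda>_. c :: real)" for c
    by (rule set_integrable_continuous) simp
  have ed: "set_integrable lebesgue {a..t} (energy_density l a d)"
    and eq: "set_integrable lebesgue {a..t} (energy_density l a q)"
    using energy_density_integrable[OF cd] energy_density_integrable[OF q] at by auto
  have nd: "set_integrable lebesgue {a..t} (\<lambda>r. - energy_density l a d r)"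
    using set_integrable_linear[OF ed bounded_linear_minus[OF bounded_linear_ident]] .
  have iq: "set_integrable lebesgue {a..t} (\<lambda>r. (1/64) * energy_density l a q r)"
    using eq by simp
  have iG: "set_integrable lebesgue {a..t} G"
    unfolding G_def by (intro set_integral_add(1) nd iq ic)
  have pw: "exp (- 2 * l * (r - a)) * (- 2 * l * (norm (j (d r)))\<^sup>2 + 2 * (S (d' r) \<bullet> d r)) \<le> G r"
    if r: "r \<in> {a..t}" for r
  proof -
    define Y where "Y = S (d' r) + d r + riesz (R r (q r))"
    have rab: "r \<in> {a..b}" using r at by auto
    have Y: "norm Y \<le> \<rho>" using res[OF rab] by (simp add: Y_def)
    have eq: "S (d' r) \<bullet> d r = Y \<bullet> d r - (norm (d r))\<^sup>2 - R r (q r) (d r)"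
      by (simp add: Y_def inner_add_left riesz_inner power2_norm_eq_inner)
    have 1: "2 * (Y \<bullet> d r) \<le> 2 * \<rho>\<^sup>2 + (norm (d r))\<^sup>2 / 2"
    proof -
      have "Y \<bullet> d r \<le> \<rho> * norm (d r)"
        using norm_cauchy_schwarz[of Y "d r"] mult_right_mono[OF Y norm_ge_zero[of "d r"]] by linarith
      moreover have "2 * (2 * \<rho>) * norm (d r) \<le> (2 * \<rho>)\<^sup>2 + (norm (d r))\<^sup>2"
        by (rule sum_squares_bound)
      ultimately show ?thesis by (simp add: power_mult_distrib)
    qed
    have 2: "- R r (q r) (d r) \<le> C * (norm (q r) * norm (j (d r)) + norm (j (q r)) * norm (d r))"
      using rel_boundedD[OF R rab, of "q r" "d r"] by linarith
    have 3: "2 * (C * norm (q r) * norm (j (d r))) \<le> (1/64) * (norm (q r))\<^sup>2 + 64 * C\<^sup>2 * (norm (j (d r)))\<^sup>2"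
      using sum_squares_bound[of "norm (q r) / 8" "8 * C * norm (j (d r))"]
      by (simp add: power_mult_distrib power_divide mult_ac)
    have 4: "2 * (C * norm (j (q r)) * norm (d r)) \<le> (norm (d r))\<^sup>2 / 2 + 2 * C\<^sup>2 * (norm (j (q r)))\<^sup>2"
      using sum_squares_bound[of "norm (d r)" "2 * C * norm (j (q r))"]
      by (simp add: power_mult_distrib mult_ac)
    have 5: "2 * C\<^sup>2 * (norm (j (q r)))\<^sup>2 \<le> (1/64) * (l * (norm (j (q r)))\<^sup>2)"
      by (simp add: l algebra_simps)
    have 6: "64 * C\<^sup>2 * (norm (j (d r)))\<^sup>2 \<le> l * (norm (j (d r)))\<^sup>2"
      by (simp add: l algebra_simps)
    have "- 2 * l * (norm (j (d r)))\<^sup>2 + 2 * (S (d' r) \<bullet> d r)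
      \<le> - ((norm (d r))\<^sup>2 + l * (norm (j (d r)))\<^sup>2) + ((1/64) * ((norm (q r))\<^sup>2 + l * (norm (j (q r)))\<^sup>2) + 2 * \<rho>\<^sup>2)"
      unfolding eq using 1 2 3 4 5 6 by (simp add: algebra_simps)
    then have "exp (- 2 * l * (r - a)) * (- 2 * l * (norm (j (d r)))\<^sup>2 + 2 * (S (d' r) \<bullet> d r))
      \<le> exp (- 2 * l * (r - a)) * (- ((norm (d r))\<^sup>2 + l * (norm (j (d r)))\<^sup>2)
          + ((1/64) * ((norm (q r))\<^sup>2 + l * (norm (j (q r)))\<^sup>2) + 2 * \<rho>\<^sup>2))"
      by (intro mult_left_mono) auto
    also have "\<dots> = - energy_density l a d r + ((1/64) * energy_density l a q r + exp (- 2 * l * (r - a)) * (2 * \<rho>\<^sup>2))"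
      by (simp add: energy_density_def algebra_simps)
    also have "\<dots> \<le> G r"
      unfolding G_def using l0 r by (intro add_left_mono mult_left_le_one_le) auto
    finally show ?thesis .
  qed
  have "exp (- 2 * l * (t - a)) * (norm (j (d t)))\<^sup>2 - exp (- 2 * l * (a - a)) * (norm (j (d a)))\<^sup>2
      \<le> (LINT r:{a..t}|lebesgue. G r)"
    using primitive_on_mono[OF prim order_refl at iG] pw by simp
  also have "\<dots> = - (LINT r:{a..t}|lebesgue. energy_density l a d r)
      + ((1/64) * (LINT r:{a..t}|lebesgue. energy_density l a q r) + 2 * \<rho>\<^sup>2 * (t - a))"
    unfolding G_def using set_integral_add(2)[OF nd set_integral_add(1)[OF iq ic]]
      set_integral_add(2)[OF iq ic] set_integral_uminus[OF ed] set_integral_const[OF at(1), of "2 * \<rho>\<^sup>2"]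
    by simp
  finally have "exp (- 2 * l * (t - a)) * (norm (j (d t)))\<^sup>2 + (LINT r:{a..t}|lebesgue. energy_density l a d r)
      \<le> (norm (j (d a)))\<^sup>2 + (1/64) * (LINT r:{a..t}|lebesgue. energy_density l a q r) + 2 * \<rho>\<^sup>2 * (t - a)"
    by simp
  moreover have "(norm (j (d a)))\<^sup>2 \<le> \<rho>\<^sup>2"
    using init by (intro power_mono) auto
  moreover have "2 * \<rho>\<^sup>2 * (t - a) \<le> 2 * \<rho>\<^sup>2 * (b - a)"
    using at by (intro mult_left_mono) auto
  ultimately show ?thesis by (simp add: algebra_simps)
qed

text \<open>Picard iteration in which every linear problem is solved only up to 4^-k, hence by a
  continuously differentiable function. The first member is arbitrary, so all bounds begin at
  \<open>V 1\<close>.\<close>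

lemma approximating_sequence:
  fixes R :: "real \<Rightarrow> 'v \<Rightarrow>\<^sub>L ('v \<Rightarrow>\<^sub>L real)"
  assumes R: "continuous_on {a..b} R" and f: "continuous_on {a..b} f"
  shows "\<exists>V V'. (\<forall>k. C1_pair (V k) (V' k)) \<and> (\<forall>k. norm (j (V (Suc k) a) - h) \<le> (1/4) ^ k) \<and>
    (\<forall>k. \<forall>t\<in>{a..b}. norm (S (V' (Suc k) t) + V (Suc k) t - (jstar (f t) - riesz (R t (V k t)))) \<le> (1/4) ^ k)"
proof -
  define P where "P n p \<longleftrightarrow> C1_pair (fst p) (snd p)" for n :: nat and p :: "(real \<Rightarrow> 'v) \<times> (real \<Rightarrow> 'v)"
  define Q where "Q n p q \<longleftrightarrow> norm (j (fst q a) - h) \<le> (1/4) ^ n \<and>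
    (\<forall>t\<in>{a..b}. norm (S (snd q t) + fst q t - (jstar (f t) - riesz (R t (fst p t)))) \<le> (1/4) ^ n)"
    for n :: nat and p q :: "(real \<Rightarrow> 'v) \<times> (real \<Rightarrow> 'v)"
  have "\<exists>F. \<forall>n. P n (F n) \<and> Q n (F n) (F (Suc n))"
  proof (rule dependent_nat_choice)
    show "\<exists>p. P 0 p" unfolding P_def by (rule exI[of _ "(\<lambda>_. 0, \<lambda>_. 0)"]) (simp add: C1_pair_const)
    fix p n assume "P n p"
    then have c: "continuous_on {a..b} (fst p)" unfolding P_def by (rule C1_pair_continuous)
    have cR: "continuous_on {a..b} (\<lambda>t. R t (fst p t))"
      by (rule bounded_bilinear.continuous_on[OF bounded_bilinear_blinfun_apply R c])
    have "continuous_on {a..b} (\<lambda>t. jstar (f t) - riesz (R t (fst p t)))"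
      by (intro continuous_on_diff bounded_linear.continuous_on[OF bounded_linear_jstar]
          bounded_linear.continuous_on[OF bounded_linear_riesz] cR f)
    moreover have "(1/4 :: real) ^ n > 0" by simp
    ultimately obtain v v' where *: "C1_pair v v' \<and> norm (j (v a) - h) \<le> (1/4) ^ n \<and>
      (\<forall>t\<in>{a..b}. norm (S (v' t) + v t - (jstar (f t) - riesz (R t (fst p t)))) \<le> (1/4) ^ n)"
      using approx_solution[of a b _ "(1/4) ^ n" h] by blast
    show "\<exists>q. P (Suc n) q \<and> Q n p q"
      unfolding P_def Q_def by (rule exI[of _ "(v, v')"]) (use * in simp)
  qed
  then obtain F where F: "\<forall>n. P n (F n) \<and> Q n (F n) (F (Suc n))" by (elim exE)
  show ?thesis
    by (rule exI[of _ "\<lambda>k. fst (F k)"], rule exI[of _ "\<lambda>k. snd (F k)"]) (use F in \<open>simp add: P_def Q_def\<close>)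
qed

text \<open>The differences of the iterates contract in the weighted energy norm faster than their
  residuals accumulate. This gives almost-everywhere convergence in V with a square integrable limit
  and uniform convergence in H; the equation is recovered in integrated form by dominated
  convergence.\<close>

theorem esol_exists:
  assumes ab: "a < b" and R: "continuous_on {a..b} R" "rel_bounded C R {a..b}"
    and f: "continuous_on {a..b} f"
  shows "\<exists>y. esol R f a b y \<and> y a = h"
proof -
  obtain V V' where V: "\<forall>k. C1_pair (V k) (V' k)" "\<forall>k. norm (j (V (Suc k) a) - h) \<le> (1/4) ^ k"
    and res: "\<forall>k. \<forall>t\<in>{a..b}. norm (S (V' (Suc k) t) + V (Suc k) t - (jstar (f t) - riesz (R t (V k t)))) \<le> (1/4) ^ k"
    using approximating_sequence[OF R(1) f, of h] by (elim exE conjE) (rule that)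
  have cV: "continuous_on {a..b} (V k)" for k
    using C1_pair_continuous(1) V(1) by blast
  define l where "l = 128 * C\<^sup>2 + 1"
  have l1: "l \<ge> 1" and l0: "l \<ge> 0" by (auto simp: l_def)
  define d d' where "d = (\<lambda>k t. V (Suc k) t - V k t)" and "d' = (\<lambda>k t. V' (Suc k) t - V' k t)"
  have C1d: "C1_pair (d k) (d' k)" for k
    unfolding d_def d'_def using V(1) by (intro C1_pair_diff) auto
  have cd: "continuous_on {a..b} (d k)" for k
    using C1_pair_continuous(1)[OF C1d] .
  define \<omega> where "\<omega> = (\<lambda>k. energy_density l a (d k))"
  have \<omega>0: "\<omega> k t \<ge> 0" for k t
    unfolding \<omega>_def by (rule energy_density_nonneg[OF l0])
  have \<omega>_int: "set_integrable lebesgue {s..t} (\<omega> k)" if "a \<le> s" "t \<le> b" for s t k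
    unfolding \<omega>_def using energy_density_integrable[OF cd that] .
  define W where "W k = (LINT r:{a..b}|lebesgue. \<omega> k r)" for k
  have I0: "(LINT r:{s..t}|lebesgue. \<omega> k r) \<ge> 0" for s t k
    unfolding set_lebesgue_integral_def by (intro Bochner_Integration.integral_nonneg) (simp add: \<omega>0)
  have I_le: "(LINT r:{a..t}|lebesgue. \<omega> k r) \<le> W k" if "t \<in> {a..b}" for t k
    using set_integral_combine[OF \<omega>_int[of a b k], of t] I0[of t b k] that by (simp add: W_def)
  define B where "B = 1 + 2 * (b - a)"
  have B0: "B \<ge> 0" using ab by (simp add: B_def)
  have step: "exp (- 2 * l * (t - a)) * (norm (j (d (Suc k) t)))\<^sup>2 + (LINT r:{a..t}|lebesgue. \<omega> (Suc k) r)
      \<le> (1/64) * (LINT r:{a..t}|lebesgue. \<omega> k r) + (5 * (1/4) ^ Suc k)\<^sup>2 * B" if t: "t \<in> {a..b}" for k t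
    unfolding \<omega>_def B_def
  proof (rule contraction_step[OF R(2) C1d cd _ _ l_def t])
    have pow: "(1/4 :: real) ^ Suc k + (1/4) ^ k = 5 * (1/4) ^ Suc k" by simp
    fix r assume r: "r \<in> {a..b}"
    define \<rho> where "\<rho> k = S (V' (Suc k) r) + V (Suc k) r - (jstar (f r) - riesz (R r (V k r)))" for k
    \<comment> \<open>The difference inherits both residuals, and 4^-(k+1) + 4^-k is 5 times
      4^-(k+1).\<close>
    have eq: "S (d' (Suc k) r) + d (Suc k) r + riesz (R r (d k r)) = \<rho> (Suc k) - \<rho> k"
      by (simp add: \<rho>_def d_def d'_def S_simps riesz_simps blinfun.bilinear_simps)
    have \<rho>: "norm (\<rho> k) \<le> (1/4) ^ k" for k unfolding \<rho>_def using res r by blast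
    show "norm (S (d' (Suc k) r) + d (Suc k) r + riesz (R r (d k r))) \<le> 5 * (1/4) ^ Suc k"
      unfolding eq using norm_triangle_ineq4[of "\<rho> (Suc k)" "\<rho> k"] \<rho>[of "Suc k"] \<rho>[of k] pow by linarith
  next
    have pow: "(1/4 :: real) ^ Suc k + (1/4) ^ k = 5 * (1/4) ^ Suc k" by simp
    have eq: "j (d (Suc k) a) = (j (V (Suc (Suc k)) a) - h) - (j (V (Suc k) a) - h)"
      by (simp add: d_def blinfun.bilinear_simps)
    show "norm (j (d (Suc k) a)) \<le> 5 * (1/4) ^ Suc k"
      unfolding eq using norm_triangle_ineq4[of "j (V (Suc (Suc k)) a) - h" "j (V (Suc k) a) - h"]
        V(2)[rule_format, of "Suc k"] V(2)[rule_format, of k] pow by linarith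
  qed
  \<comment> \<open>\<open>50 * B\<close> makes the inhomogeneity at most half of
    \<open>K * (1/16) ^ Suc k\<close>, while 1/64 of \<open>K * (1/16) ^ k\<close> is a quarter of
    it; the induction thus closes with room to spare.\<close>
  define K where "K = W 0 + 50 * B"
  have pow16: "(1/16 :: real) ^ n = ((1/4) ^ n)\<^sup>2" for n
    by (simp add: power2_eq_square power_mult_distrib[symmetric])
  have sq: "(5 * (1/4 :: real) ^ n)\<^sup>2 = 25 * (1/16) ^ n" for n
    unfolding pow16 by (simp add: power_mult_distrib)
  have W0: "W k \<ge> 0" for k unfolding W_def by (rule I0)
  have K0: "K \<ge> 0" using W0 B0 by (simp add: K_def)
  have W_le: "W k \<le> K * (1/16) ^ k" for k
  proof (induction k)
    case (Suc k)
    have "exp (- 2 * l * (b - a)) * (norm (j (d (Suc k) b)))\<^sup>2 \<ge> 0" by simp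
    moreover have "b \<in> {a..b}" using ab by simp
    ultimately have "W (Suc k) \<le> (1/64) * W k + 25 * (1/16) ^ Suc k * B"
      using step[of b k] unfolding W_def sq by linarith
    also have "\<dots> \<le> (1/64) * (K * (1/16) ^ k) + (K / 2) * (1/16) ^ Suc k"
    proof (intro add_mono mult_left_mono Suc)
      have "25 * B \<le> K / 2" using W0[of 0] by (simp add: K_def)
      then have "25 * B * (1/16) ^ Suc k \<le> (K / 2) * (1/16) ^ Suc k" by (intro mult_right_mono) auto
      then show "25 * (1/16) ^ Suc k * B \<le> (K / 2) * (1/16) ^ Suc k" by (simp only: mult_ac)
    qed auto
    also have "\<dots> \<le> K * (1/16) ^ Suc k" using K0 by simp
    finally show ?case .
  qed (simp add: K_def B0)
  \<comment> \<open>The factor that removes the exponential weight on the whole interval.\<close>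
  define Q where "Q = exp (2 * l * (b - a))"
  have Q0: "Q > 0" by (simp add: Q_def)
  have Q_le: "p \<le> Q * (exp (- 2 * l * (t - a)) * p)" if "t \<in> {a..b}" "p \<ge> 0" for t p
  proof -
    have "1 \<le> exp (2 * l * (b - a) + (- 2 * l * (t - a)))"
    proof -
      have "l * (t - a) \<le> l * (b - a)" using that l0 by (intro mult_left_mono) auto
      then show ?thesis by simp
    qed
    then have "1 * p \<le> (Q * exp (- 2 * l * (t - a))) * p"
      unfolding Q_def exp_add[symmetric] using that by (intro mult_right_mono) auto
    then show ?thesis by (simp only: mult.assoc mult_1)
  qed
  have jd: "norm (j (d (Suc k) t)) \<le> sqrt (Q * K) * (1/4) ^ Suc k" if t: "t \<in> {a..b}" for k t
  proof -
    have "exp (- 2 * l * (t - a)) * (norm (j (d (Suc k) t)))\<^sup>2 \<le> (1/64) * W k + 25 * (1/16) ^ Suc k * B"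
      using step[OF t, of k] I0[of a t "Suc k"] I_le[OF t, of k] unfolding sq by linarith
    also have "\<dots> \<le> (1/64) * (K * (1/16) ^ k) + (K / 2) * (1/16) ^ Suc k"
    proof (intro add_mono mult_left_mono W_le)
      have "25 * B \<le> K / 2" using W0[of 0] by (simp add: K_def)
      then have "25 * B * (1/16) ^ Suc k \<le> (K / 2) * (1/16) ^ Suc k" by (intro mult_right_mono) auto
      then show "25 * (1/16) ^ Suc k * B \<le> (K / 2) * (1/16) ^ Suc k" by (simp only: mult_ac)
    qed auto
    also have "\<dots> \<le> K * (1/16) ^ Suc k" using K0 by simp
    finally have "Q * (exp (- 2 * l * (t - a)) * (norm (j (d (Suc k) t)))\<^sup>2) \<le> Q * (K * (1/16) ^ Suc k)"
      using Q0 by (intro mult_left_mono) auto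
    then have "(norm (j (d (Suc k) t)))\<^sup>2 \<le> Q * (K * (1/16) ^ Suc k)"
      by (rule order_trans[OF Q_le[OF t zero_le_power2]])
    moreover have "(sqrt (Q * K) * (1/4) ^ Suc k)\<^sup>2 = Q * (K * (1/16) ^ Suc k)"
    proof -
      have "(sqrt (Q * K))\<^sup>2 = Q * K" using Q0 K0 by simp
      then show ?thesis by (simp only: power_mult_distrib[of "sqrt (Q * K)"] pow16 mult.assoc)
    qed
    ultimately have "(norm (j (d (Suc k) t)))\<^sup>2 \<le> (sqrt (Q * K) * (1/4) ^ Suc k)\<^sup>2"
      by (simp only:)
    then show ?thesis
      by (rule power2_le_imp_le) (use Q0 K0 in simp)
  qed
  have fast: "(LINT t:{a..b}|lebesgue. (norm (V (Suc k) t - V k t))\<^sup>2) \<le> (Q * K) * (1/16) ^ k" for k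
  proof -
    have "(LINT t:{a..b}|lebesgue. (norm (V (Suc k) t - V k t))\<^sup>2) \<le> (LINT t:{a..b}|lebesgue. Q * \<omega> k t)"
    proof (rule set_integral_mono)
      show "set_integrable lebesgue {a..b} (\<lambda>t. (norm (V (Suc k) t - V k t))\<^sup>2)"
        by (intro set_integrable_continuous continuous_intros cV)
      show "set_integrable lebesgue {a..b} (\<lambda>t. Q * \<omega> k t)"
        using \<omega>_int[of a b k] by simp
      fix t assume t: "t \<in> {a..b}"
      have "(norm (d k t))\<^sup>2 \<le> Q * (exp (- 2 * l * (t - a)) * (norm (d k t))\<^sup>2)"
        using Q_le[OF t] by simp
      also have "\<dots> \<le> Q * \<omega> k t"
        unfolding \<omega>_def energy_density_def using Q0 l0 by (intro mult_left_mono) auto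
      finally show "(norm (V (Suc k) t - V k t))\<^sup>2 \<le> Q * \<omega> k t" by (simp add: d_def)
    qed
    also have "\<dots> = Q * W k" unfolding W_def by (rule set_integral_mult_right)
    also have "\<dots> \<le> Q * (K * (1/16) ^ k)" using Q0 by (intro mult_left_mono W_le) auto
    finally show ?thesis by (simp only: mult.assoc)
  qed
  obtain v D where v: "sq_integrable {a..b} v" and D: "set_integrable lebesgue {a..b} D"
    and lim: "AE t in lebesgue. t \<in> {a..b} \<longrightarrow> (\<lambda>n. V n t) \<longlonglongrightarrow> v t \<and> (\<forall>n. (norm (V n t - V 0 t))\<^sup>2 \<le> 4 * D t)"
    using fast_Cauchy_L2_limit[OF cV fast] by (elim exE conjE) (rule that)
  have "summable (\<lambda>k. sqrt (Q * K) * (1/4 :: real) ^ Suc k)"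
    by (intro summable_mult summable_ignore_initial_segment[of _ 1, simplified] summable_geometric) simp
  from Weierstrass_m_test[OF jd this]
  have "uniform_limit {a..b} (\<lambda>n t. \<Sum>k<n. j (d (Suc k) t)) (\<lambda>t. \<Sum>k. j (d (Suc k) t)) sequentially" .
  \<comment> \<open>The uniform limit in H, telescoped from \<open>V 1\<close>, because the
    pointwise bound \<open>jd\<close> does not cover the difference \<open>d 0\<close>.\<close>
  define y where "y t = j (V 1 t) + (\<Sum>k. j (d (Suc k) t))" for t
  have ylim: "uniform_limit {a..b} (\<lambda>n t. j (V (Suc n) t)) y sequentially"
  proof -
    have eq: "j (V (Suc n) t) = j (V 1 t) + (\<Sum>k<n. j (d (Suc k) t))" for n t
      by (induction n) (simp_all add: d_def blinfun.bilinear_simps)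
    show ?thesis
      unfolding eq y_def[abs_def]
      by (intro uniform_limit_add uniform_limit_const) fact
  qed
  have cy: "continuous_on {a..b} y"
    by (rule uniform_limit_theorem[OF _ ylim])
      (auto intro!: always_eventually continuous_intros cV)
  have ypt: "(\<lambda>n. j (V (Suc n) t)) \<longlonglongrightarrow> y t" if "t \<in> {a..b}" for t
    using tendsto_uniform_limitI[OF ylim that] .
  have "(\<lambda>n. j (V (Suc n) a) - h) \<longlonglongrightarrow> 0"
    by (rule Lim_null_comparison[OF always_eventually[OF allI] LIMSEQ_power_zero[of "1/4 :: real"]])
      (use V(2) in auto)
  then have "(\<lambda>n. j (V (Suc n) a)) \<longlonglongrightarrow> h" by (simp add: LIM_zero_iff)
  then have ya: "y a = h" using LIMSEQ_unique[OF ypt[of a]] ab by auto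
  have yv: "AE t in lebesgue. t \<in> {a..b} \<longrightarrow> y t = j (v t)"
    using lim
  proof (rule eventually_mono, intro impI)
    fix t assume *: "t \<in> {a..b} \<longrightarrow> (\<lambda>n. V n t) \<longlonglongrightarrow> v t \<and> (\<forall>n. (norm (V n t - V 0 t))\<^sup>2 \<le> 4 * D t)" "t \<in> {a..b}"
    then have "(\<lambda>n. V (Suc n) t) \<longlonglongrightarrow> v t" by (intro LIMSEQ_Suc) simp
    then have "(\<lambda>n. j (V (Suc n) t)) \<longlonglongrightarrow> j (v t)"
      by (rule bounded_linear.tendsto[OF blinfun.bounded_linear_right])
    then show "y t = j (v t)" using LIMSEQ_unique[OF ypt[OF *(2)]] by blast
  qed
  have "compact (R ` {a..b})" using R(1) by (intro compact_continuous_image) auto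
  then have "bounded (R ` {a..b})" by (rule compact_imp_bounded)
  then obtain M where "\<forall>x\<in>R ` {a..b}. norm x \<le> M"
    unfolding bounded_iff by (elim exE) (rule that)
  then have M: "\<And>t. t \<in> {a..b} \<Longrightarrow> norm (R t) \<le> M" by blast
  have M0: "M \<ge> 0" using order_trans[OF norm_ge_zero M[of a]] ab by simp
  have Rv: "norm (riesz (R t w)) \<le> M * norm w" if "t \<in> {a..b}" for t w
    unfolding norm_riesz using norm_blinfun[of "R t" w] mult_right_mono[OF M[OF that] norm_ge_zero[of w]] by linarith
  define \<psi> where "\<psi> t = rhs R f t (v t)" for t
  \<comment> \<open>The derivatives themselves are not estimated: the equation with vanishing
    residual expresses \<open>S V'\<close> through iterates that converge.\<close>
  have SV': "(\<lambda>n. S (V' (Suc n) t)) \<longlonglongrightarrow> \<psi> t" if "(\<lambda>n. V n t) \<longlonglongrightarrow> v t" and t: "t \<in> {a..b}" for t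
  proof -
    have "(\<lambda>n. S (V' (Suc n) t) + V (Suc n) t - (jstar (f t) - riesz (R t (V n t)))) \<longlonglongrightarrow> 0"
      by (rule Lim_null_comparison[OF always_eventually[OF allI] LIMSEQ_power_zero[of "1/4 :: real"]])
        (use res t in auto)
    moreover have "(\<lambda>n. (jstar (f t) - riesz (R t (V n t))) - V (Suc n) t) \<longlonglongrightarrow> (jstar (f t) - riesz (R t (v t))) - v t"
      by (rule tendsto_diff[OF tendsto_diff[OF tendsto_const
            bounded_linear.tendsto[OF bounded_linear_riesz bounded_linear.tendsto[OF blinfun.bounded_linear_right that(1)]]]
            LIMSEQ_Suc[OF that(1)]])
    ultimately have "(\<lambda>n. (S (V' (Suc n) t) + V (Suc n) t - (jstar (f t) - riesz (R t (V n t))))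
        + ((jstar (f t) - riesz (R t (V n t))) - V (Suc n) t)) \<longlonglongrightarrow> 0 + ((jstar (f t) - riesz (R t (v t))) - v t)"
      by (rule tendsto_add)
    then show ?thesis by (simp add: \<psi>_def algebra_simps)
  qed
  have cSV': "continuous_on {a..b} (\<lambda>t. S (V' k t))" for k
    by (intro bounded_linear.continuous_on[OF bounded_linear_S]) (use C1_pair_continuous(2) V(1) in blast)
  have \<psi>meas: "set_borel_measurable lebesgue {a..b} \<psi>"
  proof -
    \<comment> \<open>\<open>\<psi>\<close> contains \<open>R t (v t)\<close>, so its measurability
      is obtained from that of a pointwise limit of continuous functions.\<close>
    define \<eta> where "\<eta> t = lim (\<lambda>n. indicat_real {a..b} t *\<^sub>R S (V' (Suc n) t))" for t
    have "\<eta> \<in> borel_measurable lebesgue"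
      unfolding \<eta>_def using set_borel_measurable_continuous[OF cSV']
      by (intro borel_measurable_lim_metric) (simp add: set_borel_measurable_def)
    then have "set_borel_measurable lebesgue {a..b} \<eta>"
      unfolding set_borel_measurable_def by (intro borel_measurable_scaleR borel_measurable_indicator) auto
    moreover have "AE t in lebesgue. t \<in> {a..b} \<longrightarrow> \<eta> t = \<psi> t"
      using lim by (rule eventually_mono) (auto simp: \<eta>_def intro!: limI SV')
    ultimately show ?thesis by (rule set_borel_measurable_cong_AE)
  qed
  have sqf: "sq_integrable {a..b} (\<lambda>t. jstar (f t))"
    by (intro sq_integrable_continuous bounded_linear.continuous_on[OF bounded_linear_jstar] f)
  have sqv: "set_integrable lebesgue {a..b} (\<lambda>t. (norm (v t))\<^sup>2)" "set_borel_measurable lebesgue {a..b} v"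
    using v by (auto simp: sq_integrable_def)
  have sq\<psi>: "sq_integrable {a..b} \<psi>"
  proof (rule sq_integrable_bound[OF \<psi>meas, of "\<lambda>t. 2 * (norm (jstar (f t)))\<^sup>2 + 2 * ((1 + M)\<^sup>2 * (norm (v t))\<^sup>2)"])
    show "set_integrable lebesgue {a..b} (\<lambda>t. 2 * (norm (jstar (f t)))\<^sup>2 + 2 * ((1 + M)\<^sup>2 * (norm (v t))\<^sup>2))"
      using sqf sqv by (simp add: sq_integrable_def)
    have "(norm (\<psi> t))\<^sup>2 \<le> 2 * (norm (jstar (f t)))\<^sup>2 + 2 * ((1 + M)\<^sup>2 * (norm (v t))\<^sup>2)" if t: "t \<in> {a..b}" for t
    proof -
      have "norm (\<psi> t) \<le> norm (jstar (f t)) + (1 + M) * norm (v t)"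
        using Rv[OF t, of "v t"] norm_triangle_ineq[of "- v t - riesz (R t (v t))" "jstar (f t)"]
          norm_triangle_ineq4[of "- v t" "riesz (R t (v t))"] by (simp add: \<psi>_def distrib_right)
      then have "(norm (\<psi> t))\<^sup>2 \<le> (norm (jstar (f t)) + (1 + M) * norm (v t))\<^sup>2"
        by (intro power_mono) auto
      also have "\<dots> \<le> 2 * (norm (jstar (f t)))\<^sup>2 + 2 * ((1 + M) * norm (v t))\<^sup>2"
        using sum_squares_bound[of "norm (jstar (f t))" "(1 + M) * norm (v t)"] by (simp add: power2_sum)
      finally show ?thesis by (simp add: power_mult_distrib)
    qed
    then show "AE t in lebesgue. t \<in> {a..b} \<longrightarrow> (norm (\<psi> t))\<^sup>2 \<le> 2 * (norm (jstar (f t)))\<^sup>2 + 2 * ((1 + M)\<^sup>2 * (norm (v t))\<^sup>2)"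
      by simp
  qed
  have prim: "primitive_on a b (\<lambda>t. jstar (y t)) \<psi>"
    unfolding primitive_on_def
  proof (intro conjI allI impI sq_integrable_imp_integrable[OF sq\<psi>])
    fix s t assume st: "a \<le> s" "s \<le> t" "t \<le> b"
    \<comment> \<open>An integrable majorant of \<open>S V'\<close>: the inequality x \<le> 1 + x^2
      turns the bound \<open>4 * D\<close> on squared distances to \<open>V 0\<close> into a bound
      on the norms of the iterates, and the residual is at most 1.\<close>
    define w where "w t = norm (jstar (f t)) + (1 + M) * (2 * norm (V 0 t) + 2 * (1 + 4 * D t)) + 1" for t
    have lim1: "(\<lambda>n. LINT r:{s..t}|lebesgue. S (V' (Suc n) r)) \<longlonglongrightarrow> (LINT r:{s..t}|lebesgue. \<psi> r)"
    proof (rule set_integral_dominated_convergence[where w=w])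
      have sub: "{s..t} \<subseteq> {a..b}" using st by auto
      show "set_borel_measurable lebesgue {s..t} \<psi>"
        using sub by (intro set_borel_measurable_subset[OF \<psi>meas]) auto
      show "set_borel_measurable lebesgue {s..t} (\<lambda>r. S (V' (Suc n) r))" for n
        by (intro set_borel_measurable_continuous continuous_on_subset[OF cSV' sub])
      have "set_integrable lebesgue {a..b} w"
        unfolding w_def
        by (intro set_integral_add(1) set_integrable_mult_right D set_integrable_continuous continuous_intros cV
            bounded_linear.continuous_on[OF bounded_linear_jstar] f)
      then show "set_integrable lebesgue {s..t} w"
        by (rule set_integrable_subset) (use sub in auto)
      show "AE r in lebesgue. r \<in> {s..t} \<longrightarrow> (\<lambda>n. S (V' (Suc n) r)) \<longlonglongrightarrow> \<psi> r"
        using lim by (rule eventually_mono) (use sub SV' in blast)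
      show "AE r in lebesgue. r \<in> {s..t} \<longrightarrow> norm (S (V' (Suc n) r)) \<le> w r" for n
        using lim
      proof (rule eventually_mono, intro impI)
        fix r assume *: "r \<in> {a..b} \<longrightarrow> (\<lambda>n. V n r) \<longlonglongrightarrow> v r \<and> (\<forall>n. (norm (V n r - V 0 r))\<^sup>2 \<le> 4 * D r)" "r \<in> {s..t}"
        then have r: "r \<in> {a..b}" using sub by auto
        have Vb: "norm (V k r) \<le> norm (V 0 r) + (1 + 4 * D r)" for k
        proof -
          have "norm (V k r - V 0 r) \<le> 1 + (norm (V k r - V 0 r))\<^sup>2"
            using sum_squares_bound[of "norm (V k r - V 0 r)" 1] by (simp add: power2_eq_square)
              (smt (verit) zero_le_mult_iff norm_ge_zero)
          then show ?thesis
            using * r norm_triangle_sub[of "V k r" "V 0 r"] by (smt (verit))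
        qed
        have "S (V' (Suc n) r) = (S (V' (Suc n) r) + V (Suc n) r - (jstar (f r) - riesz (R r (V n r))))
            + (jstar (f r) - riesz (R r (V n r)) - V (Suc n) r)" by simp
        then have "norm (S (V' (Suc n) r)) \<le> norm (S (V' (Suc n) r) + V (Suc n) r - (jstar (f r) - riesz (R r (V n r))))
            + norm (jstar (f r) - riesz (R r (V n r)) - V (Suc n) r)"
          by (metis norm_triangle_ineq)
        also have "\<dots> \<le> 1 + (norm (jstar (f r)) + M * norm (V n r) + norm (V (Suc n) r))"
        proof (intro add_mono)
          have "norm (S (V' (Suc n) r) + V (Suc n) r - (jstar (f r) - riesz (R r (V n r)))) \<le> (1/4) ^ n"
            using res r by blast
          also have "\<dots> \<le> 1" by (intro power_le_one) auto
          finally show "norm (S (V' (Suc n) r) + V (Suc n) r - (jstar (f r) - riesz (R r (V n r)))) \<le> 1" .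
          show "norm (jstar (f r) - riesz (R r (V n r)) - V (Suc n) r)
              \<le> norm (jstar (f r)) + M * norm (V n r) + norm (V (Suc n) r)"
            using norm_triangle_ineq4[of "jstar (f r) - riesz (R r (V n r))" "V (Suc n) r"]
              norm_triangle_ineq4[of "jstar (f r)" "riesz (R r (V n r))"] Rv[OF r, of "V n r"] by linarith
        qed
        also have "\<dots> \<le> 1 + (norm (jstar (f r)) + M * (norm (V 0 r) + (1 + 4 * D r)) + (norm (V 0 r) + (1 + 4 * D r)))"
          by (intro add_left_mono add_mono order_refl mult_left_mono Vb M0)
        also have "\<dots> \<le> w r"
        proof -
          have "0 \<le> (1 + M) * (norm (V 0 r) + (1 + 4 * D r))"
            using M0 Vb[of 0] norm_ge_zero[of "V 0 r"] by (intro mult_nonneg_nonneg) linarith+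
          then show ?thesis by (simp add: w_def algebra_simps)
        qed
        finally show "norm (S (V' (Suc n) r)) \<le> w r" .
      qed
    qed
    have lhs: "(LINT r:{s..t}|lebesgue. S (V' (Suc n) r)) = S (V (Suc n) t) - S (V (Suc n) s)" for n
      using primitive_onD(2)[OF C1_pair_primitive[OF C1_pair_linear[OF V(1)[rule_format] bounded_linear_S]] st, of "Suc n"]
      by simp
    have lim2: "(\<lambda>n. S (V (Suc n) t) - S (V (Suc n) s)) \<longlonglongrightarrow> jstar (y t) - jstar (y s)"
      unfolding S_def using st
      by (intro tendsto_diff bounded_linear.tendsto[OF bounded_linear_jstar] ypt) auto
    show "jstar (y t) - jstar (y s) = (LINT r:{s..t}|lebesgue. \<psi> r)"
      by (rule LIMSEQ_unique[OF lim2 lim1[unfolded lhs]])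
  qed
  have "regular a b y v \<psi>"
    using cy v sq\<psi> yv prim by (simp add: regular_def)
  then have "esol R f a b y"
    unfolding esol_def \<psi>_def by (intro exI[of _ v] exI[of _ "\<lambda>t. rhs R f t (v t)"]) (simp add: \<psi>_def)
  with ya show ?thesis by blast
qed

end

section \<open>Transposition, time reversal and polarisation\<close>

definition transpose_blinfun ::
    "('v::real_normed_vector \<Rightarrow>\<^sub>L ('v \<Rightarrow>\<^sub>L real)) \<Rightarrow> 'v \<Rightarrow>\<^sub>L ('v \<Rightarrow>\<^sub>L real)" where
  "transpose_blinfun T = Blinfun (\<lambda>w. Blinfun (\<lambda>v. T v w))"

lemma transpose_blinfun_apply: "transpose_blinfun T w v = T v w"
proof -
  have inner: "bounded_linear (\<lambda>v. T v w)" for w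
    by (rule bounded_linear_compose[OF blinfun.bounded_linear_left blinfun.bounded_linear_right])
  have *: "Blinfun (\<lambda>v. T v w) v = T v w" for v w
    by (simp add: bounded_linear_Blinfun_apply[OF inner])
  have "bounded_linear (\<lambda>w. Blinfun (\<lambda>v. T v w))"
  proof (rule bounded_linear_intro[of _ "norm T"])
    show "Blinfun (\<lambda>v. T v (x + y)) = Blinfun (\<lambda>v. T v x) + Blinfun (\<lambda>v. T v y)" for x y
      by (rule blinfun_eqI) (simp only: * blinfun.add_left, simp only: blinfun.add_right)
    show "Blinfun (\<lambda>v. T v (c *\<^sub>R x)) = c *\<^sub>R Blinfun (\<lambda>v. T v x)" for c x
      by (rule blinfun_eqI) (simp only: * blinfun.scaleR_left, simp only: blinfun.scaleR_right)
    show "norm (Blinfun (\<lambda>v. T v x)) \<le> norm x * norm T" for x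
    proof (rule norm_blinfun_bound)
      fix v
      have "norm (T v x) \<le> norm (T v) * norm x" by (rule norm_blinfun)
      also have "\<dots> \<le> (norm T * norm v) * norm x"
        by (intro mult_right_mono norm_blinfun) auto
      finally show "norm (Blinfun (\<lambda>v. T v x) v) \<le> norm x * norm T * norm v"
        by (simp add: * mult_ac)
    qed simp
  qed
  then show ?thesis
    by (simp add: transpose_blinfun_def bounded_linear_Blinfun_apply *)
qed

lemma bounded_linear_transpose_blinfun:
  "bounded_linear (transpose_blinfun :: ('v::real_normed_vector \<Rightarrow>\<^sub>L ('v \<Rightarrow>\<^sub>L real)) \<Rightarrow> _)"
proof (rule bounded_linear_intro[of _ 1])
  show "transpose_blinfun (x + y) = transpose_blinfun x + transpose_blinfun y" for x y :: "'v \<Rightarrow>\<^sub>L ('v \<Rightarrow>\<^sub>L real)"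
    by (intro blinfun_eqI) (simp add: transpose_blinfun_apply blinfun.bilinear_simps)
  show "transpose_blinfun (c *\<^sub>R x) = c *\<^sub>R transpose_blinfun x" for c and x :: "'v \<Rightarrow>\<^sub>L ('v \<Rightarrow>\<^sub>L real)"
    by (intro blinfun_eqI) (simp add: transpose_blinfun_apply blinfun.bilinear_simps)
  show "norm (transpose_blinfun T) \<le> norm T * 1" for T :: "'v \<Rightarrow>\<^sub>L ('v \<Rightarrow>\<^sub>L real)"
    unfolding mult_1_right
  proof (rule norm_blinfun_bound)
    fix w
    show "norm (transpose_blinfun T w) \<le> norm T * norm w"
    proof (rule norm_blinfun_bound)
      fix v
      have "norm (T v w) \<le> norm (T v) * norm w" by (rule norm_blinfun)
      also have "\<dots> \<le> (norm T * norm v) * norm w"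
        by (intro mult_right_mono norm_blinfun) auto
      finally show "norm (transpose_blinfun T w v) \<le> norm T * norm w * norm v"
        by (simp add: transpose_blinfun_apply mult_ac)
    qed simp
  qed simp
qed

lemma AE_lebesgue_reflect:
  fixes c :: real
  assumes "AE t in lebesgue. P t" shows "AE t in lebesgue. P (c - t)"
  by (rule AE_distrD[OF measurable_lebesgue_reflect[of c]]) (simp only: distr_lebesgue_reflect assms)

lemma sq_integrable_reflect:
  fixes f :: "real \<Rightarrow> 'a::{banach,second_countable_topology}"
  assumes "sq_integrable {a..b} f"
  shows "sq_integrable {c - b..c - a} (\<lambda>t. f (c - t))"
proof -
  have ind: "indicat_real {a..b} (c - r) = indicat_real {c - b..c - a} r" for r
    by (auto simp: indicator_def)
  have "set_borel_measurable lebesgue {c - b..c - a} (\<lambda>t. f (c - t))"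
    using measurable_compose[OF measurable_lebesgue_reflect[of c] assms[unfolded sq_integrable_def set_borel_measurable_def, THEN conjunct1]]
    by (simp add: set_borel_measurable_def ind)
  moreover have "set_integrable lebesgue {c - b..c - a} (\<lambda>t. (norm (f (c - t)))\<^sup>2)"
    using integrable_lebesgue_reflect[OF assms[unfolded sq_integrable_def set_integrable_def, THEN conjunct2], of c]
    by (simp add: set_integrable_def ind)
  ultimately show ?thesis by (simp add: sq_integrable_def)
qed

context pivot_space
begin

lemma regular_reflect:
  assumes "regular a b y v \<psi>"
  shows "regular (c - b) (c - a) (\<lambda>t. y (c - t)) (\<lambda>t. v (c - t)) (\<lambda>t. - \<psi> (c - t))"
proof -
  note r = regularD[OF assms]
  have "continuous_on {c - b..c - a} (\<lambda>t. y (c - t))"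
    by (rule continuous_on_compose2[OF r(1)]) (auto intro!: continuous_intros)
  moreover have "AE t in lebesgue. t \<in> {c - b..c - a} \<longrightarrow> y (c - t) = j (v (c - t))"
    using AE_lebesgue_reflect[OF r(4), of c] by (rule eventually_mono) auto
  moreover have "sq_integrable {c - b..c - a} (\<lambda>t. - \<psi> (c - t))"
    using sq_integrable_linear[OF sq_integrable_reflect[OF r(3)] bounded_linear_minus[OF bounded_linear_ident]] .
  ultimately show ?thesis
    unfolding regular_def using sq_integrable_reflect[OF r(2)] primitive_on_reflect[OF r(5)] by auto
qed

text \<open>Polarisation of \<open>energy_identity\<close>.\<close>

lemma energy_identity_inner:
  assumes "regular a b y v \<psi>" "regular a b z w \<phi>"
  shows "primitive_on a b (\<lambda>t. y t \<bullet> z t) (\<lambda>t. \<psi> t \<bullet> w t + \<phi> t \<bullet> v t)"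
proof -
  have 1: "primitive_on a b (\<lambda>t. (y t + z t) \<bullet> (y t + z t)) (\<lambda>t. 2 * ((\<psi> t + \<phi> t) \<bullet> (v t + w t)))"
    using energy_identity[OF regular_lin[OF assms, of 1]] by simp
  note 2 = primitive_on_linear[OF energy_identity[OF assms(1)] bounded_linear_mult_right[of "-1 :: real"]]
  note 3 = primitive_on_linear[OF energy_identity[OF assms(2)] bounded_linear_mult_right[of "-1 :: real"]]
  have eq: "y t \<bullet> z t = (1/2) * ((y t + z t) \<bullet> (y t + z t) + (- 1 * (y t \<bullet> y t) + - 1 * (z t \<bullet> z t)))" for t
    by (simp add: inner_add inner_commute)
  have eq2: "\<psi> t \<bullet> w t + \<phi> t \<bullet> v t = (1/2) * (2 * ((\<psi> t + \<phi> t) \<bullet> (v t + w t))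
      + (- 1 * (2 * (\<psi> t \<bullet> v t)) + - 1 * (2 * (\<phi> t \<bullet> w t))))" for t
    by (simp add: inner_add)
  show ?thesis
    unfolding eq eq2
    by (rule primitive_on_linear[OF primitive_on_add[OF 1 primitive_on_add[OF 2 3]] bounded_linear_mult_right])
qed

lemma esol_fun_cong:
  assumes "esol R f a b y" "\<And>t. t \<in> {a..b} \<Longrightarrow> y t = z t"
  shows "esol R f a b z"
proof -
  obtain v \<psi> where *: "regular a b y v \<psi>" "AE t in lebesgue. t \<in> {a..b} \<longrightarrow> \<psi> t = rhs R f t (v t)"
    using assms(1) unfolding esol_def by blast
  note r = regularD[OF *(1)]
  have "regular a b z v \<psi>"
    unfolding regular_def
  proof (intro conjI r)
    show "continuous_on {a..b} z" using r(1) assms(2) by (rule continuous_on_eq)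
    show "AE t in lebesgue. t \<in> {a..b} \<longrightarrow> z t = j (v t)"
      using r(4) assms(2) by (auto elim!: eventually_mono)
    show "primitive_on a b (\<lambda>t. jstar (z t)) \<psi>"
      using r(5) assms(2) unfolding primitive_on_def by simp
  qed
  then show ?thesis unfolding esol_def using *(2) by blast
qed

section \<open>The global flow and the density of its range\<close>

definition admissible :: "real \<Rightarrow> (real \<Rightarrow> 'v \<Rightarrow>\<^sub>L ('v \<Rightarrow>\<^sub>L real)) \<Rightarrow> bool" where
  "admissible C R \<longleftrightarrow> continuous_on {0..} R \<and> rel_bounded C R {0..}"

lemma admissibleD:
  assumes "admissible C R" "0 \<le> a"
  shows "continuous_on {a..b} R" "rel_bounded C R {a..b}"
  using assms by (auto simp: admissible_def intro: continuous_on_subset rel_bounded_subset)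

lemma esol_exists_global:
  assumes R: "admissible C R" and a: "0 \<le> a" and f: "continuous_on {a..} f"
  shows "\<exists>y. (\<forall>b. esol R f a b y) \<and> y a = h"
proof -
  have "\<exists>y. esol R f a (a + real n + 1) y \<and> y a = h" for n
    using f by (intro esol_exists[OF _ admissibleD[OF R a]]) (auto intro: continuous_on_subset)
  then obtain Y where Y: "\<And>n. esol R f a (a + real n + 1) (Y n)" "\<And>n. Y n a = h" by metis
  have agree: "Y n t = Y m t" if "t \<in> {a..a + real n + 1}" "n \<le> m" for n m t
  proof -
    have "esol R f a (a + real n + 1) (Y m)"
      using that(2) by (intro esol_subset[OF Y(1)]) auto
    from esol_unique[OF Y(1) this admissibleD(2)[OF R a]] show ?thesis
      using Y(2) that(1) by metis
  qed
  define y where "y t = Y (nat \<lceil>t - a\<rceil>) t" for t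
  have y_eq: "y t = Y n t" if t: "t \<in> {a..a + real n}" for n t
  proof -
    have "t - a \<le> real (nat \<lceil>t - a\<rceil>)" by (rule real_nat_ceiling_ge)
    then have "t \<in> {a..a + real (nat \<lceil>t - a\<rceil>) + 1}" using t unfolding atLeastAtMost_iff by linarith
    moreover have "nat \<lceil>t - a\<rceil> \<le> n" using t by (simp add: nat_le_iff ceiling_le_iff)
    ultimately show ?thesis
      unfolding y_def by (rule agree)
  qed
  have "esol R f a b y" for b
  proof -
    obtain n :: nat where n: "b - a \<le> real n" using real_arch_simple by blast
    have "esol R f a (a + real n) (Y n)" by (rule esol_subset[OF Y(1)]) auto
    then have "esol R f a (a + real n) y" by (rule esol_fun_cong) (rule y_eq[symmetric])
    then show ?thesis by (rule esol_subset) (use n in auto)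
  qed
  moreover have "y a = h" using Y(2) by (simp add: y_def)
  ultimately show ?thesis by blast
qed

text \<open>The evolution family of the homogeneous equation with initial time \<open>r\<close>; for
  \<open>admissible\<close> perturbations and \<open>0 \<le> r\<close> it exists and is unique on
  times from \<open>r\<close> on.\<close>

definition flow :: "(real \<Rightarrow> 'v \<Rightarrow>\<^sub>L ('v \<Rightarrow>\<^sub>L real)) \<Rightarrow> real \<Rightarrow> 'h \<Rightarrow> real \<Rightarrow> 'h" where
  "flow R r h = (SOME y. (\<forall>b. esol R (\<lambda>_. 0) r b y) \<and> y r = h)"

lemma flow:
  assumes "admissible C R" "0 \<le> r"
  shows "esol R (\<lambda>_. 0) r b (flow R r h)" "flow R r h r = h"
proof -
  have "(\<forall>b. esol R (\<lambda>_. 0) r b (flow R r h)) \<and> flow R r h r = h"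
    unfolding flow_def by (rule someI_ex[OF esol_exists_global[OF assms]]) simp
  then show "esol R (\<lambda>_. 0) r b (flow R r h)" "flow R r h r = h" by auto
qed

lemma flow_unique:
  assumes R: "admissible C R" and r: "0 \<le> r" and z: "esol R (\<lambda>_. 0) r b z" and t: "t \<in> {r..b}"
  shows "z t = flow R r (z r) t"
  using esol_unique[OF z flow(1)[OF R r] admissibleD(2)[OF R r] _ t] flow(2)[OF R r] by metis

lemma flow_norm_le:
  assumes R: "admissible C R" and r: "0 \<le> r" "r \<le> t"
  shows "norm (flow R r h t) \<le> exp (C\<^sup>2 * (t - r)) * norm h"
  using energy_free[OF flow(1)[OF R r(1), of t h] admissibleD(2)[OF R r(1)] order_refl r(2) order_refl]
    flow(2)[OF R r(1)] by simp

lemma flow_lin: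
  assumes R: "admissible C R" and r: "0 \<le> r" "r \<le> t"
  shows "flow R r (g + c *\<^sub>R h) t = flow R r g t + c *\<^sub>R flow R r h t"
proof -
  have "esol R (\<lambda>_. 0) r t (\<lambda>t. flow R r g t + c *\<^sub>R flow R r h t)"
    using esol_lin[OF flow(1)[OF R r(1), of t g] flow(1)[OF R r(1), of t h], of c] by simp
  from flow_unique[OF R r(1) this, of t] show ?thesis
    using r flow(2)[OF R r(1)] by simp
qed

lemma flow_diff:
  assumes "admissible C R" "0 \<le> r" "r \<le> t"
  shows "flow R r g t - flow R r h t = flow R r (g - h) t"
  using flow_lin[OF assms, of g "- 1" h] by simp

lemma flow_flow:
  assumes R: "admissible C R" and r: "0 \<le> r" "r \<le> s" "s \<le> t"
  shows "flow R s (flow R r h s) t = flow R r h t"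
proof -
  have "esol R (\<lambda>_. 0) s t (flow R r h)"
    using r by (intro esol_subset[OF flow(1)[OF R r(1)], of s t t]) auto
  from flow_unique[OF R _ this, of t] show ?thesis using r by simp
qed

text \<open>A vector orthogonal to the range of the flow is transported backwards by the adjoint equation, along
  which the pairing with every solution is constant; so it arrives at \<open>0\<close>, and backward
  uniqueness makes it vanish.\<close>

lemma dense_range_flow:
  assumes R: "admissible C R" and s: "0 \<le> s"
  shows "closure (range (\<lambda>h. flow R 0 h s)) = UNIV"
proof (cases "s = 0")
  case True
  then have "range (\<lambda>h. flow R 0 h s) = UNIV" using flow(2)[OF R] by simp
  then show ?thesis by simp
next
  case False
  then have s0: "0 < s" using s by simp
  show ?thesis
  proof (rule subspace_dense_if_orthogonal_trivial)
    show "subspace (range (\<lambda>h. flow R 0 h s))"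
    proof (rule subspaceI)
      have "flow R 0 0 s = 0" using flow_lin[OF R order_refl s, of 0 "- 1" 0] by simp
      then show "0 \<in> range (\<lambda>h. flow R 0 h s)" by (intro range_eqI[of _ _ 0]) simp
      show "x + y \<in> range (\<lambda>h. flow R 0 h s)" if xy: "x \<in> range (\<lambda>h. flow R 0 h s)" "y \<in> range (\<lambda>h. flow R 0 h s)" for x y
      proof -
        obtain g h where "x = flow R 0 g s" "y = flow R 0 h s" using xy by blast
        then have "x + y = flow R 0 (g + 1 *\<^sub>R h) s" by (simp only: flow_lin[OF R order_refl s]) simp
        then show ?thesis by (rule range_eqI)
      qed
      show "c *\<^sub>R x \<in> range (\<lambda>h. flow R 0 h s)" if x: "x \<in> range (\<lambda>h. flow R 0 h s)" for c x
      proof -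
        obtain h where "x = flow R 0 h s" using x by blast
        then have "c *\<^sub>R x = flow R 0 (0 + c *\<^sub>R h) s"
          using \<open>flow R 0 0 s = 0\<close> by (simp only: flow_lin[OF R order_refl s]) simp
        then show ?thesis by (rule range_eqI)
      qed
    qed
    fix w assume w: "\<And>m. m \<in> range (\<lambda>h. flow R 0 h s) \<Longrightarrow> w \<bullet> m = 0"
    \<comment> \<open>The adjoint equation runs backwards from time \<open>s\<close>; in the
      reversed time \<open>s - t\<close> it is a forward problem with the same relative
      bound.\<close>
    define R' where "R' t = transpose_blinfun (R (s - t))" for t
    have cR: "continuous_on {0..s} (\<lambda>t. R (s - t))"
      by (rule continuous_on_compose2[OF admissibleD(1)[OF R order_refl, of s]]) (auto intro!: continuous_intros)
    have cR': "continuous_on {0..s} R'"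
      unfolding R'_def[abs_def] using bounded_linear.continuous_on[OF bounded_linear_transpose_blinfun cR] .
    have bR': "rel_bounded C R' {0..s}"
      unfolding rel_bounded_def
    proof (intro ballI allI)
      fix t v u assume "t \<in> {0..s}"
      then have "s - t \<in> {0..s}" by auto
      from rel_boundedD[OF admissibleD(2)[OF R order_refl] this, of u v]
      show "\<bar>R' t v u\<bar> \<le> C * (norm v * norm (j u) + norm (j v) * norm u)"
        by (simp add: R'_def transpose_blinfun_apply mult.commute add.commute)
    qed
    obtain q where q: "esol R' (\<lambda>_. 0) 0 s q" "q 0 = w"
      using esol_exists[OF s0 cR' bR', of "\<lambda>_. 0" w] by auto
    obtain v2 \<psi>2 where 2: "regular 0 s q v2 \<psi>2" "AE t in lebesgue. t \<in> {0..s} \<longrightarrow> \<psi>2 t = rhs R' (\<lambda>_. 0) t (v2 t)"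
      using q(1) unfolding esol_def by blast
    have orth: "q s \<bullet> h = 0" for h
    proof -
      obtain v1 \<psi>1 where 1: "regular 0 s (flow R 0 h) v1 \<psi>1"
        "AE t in lebesgue. t \<in> {0..s} \<longrightarrow> \<psi>1 t = rhs R (\<lambda>_. 0) t (v1 t)"
        using flow(1)[OF R order_refl, of s h] unfolding esol_def by blast
      have reg: "regular 0 s (\<lambda>t. q (s - t)) (\<lambda>t. v2 (s - t)) (\<lambda>t. - \<psi>2 (s - t))"
        using regular_reflect[OF 2(1), of s] by simp
      have "AE t in lebesgue. t \<in> {0..s} \<longrightarrow> \<psi>1 t \<bullet> v2 (s - t) + - \<psi>2 (s - t) \<bullet> v1 t = 0"
        using 1(2) AE_lebesgue_reflect[OF 2(2), of s]
      proof (eventually_elim, intro impI)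
        fix t assume t: "t \<in> {0..s} \<longrightarrow> \<psi>1 t = rhs R (\<lambda>_. 0) t (v1 t)"
          "s - t \<in> {0..s} \<longrightarrow> \<psi>2 (s - t) = rhs R' (\<lambda>_. 0) (s - t) (v2 (s - t))" "t \<in> {0..s}"
        then have "\<psi>1 t = - v1 t - riesz (R t (v1 t))"
          "\<psi>2 (s - t) = - v2 (s - t) - riesz (R' (s - t) (v2 (s - t)))"
          by (auto simp: jstar_simps)
        then show "\<psi>1 t \<bullet> v2 (s - t) + - \<psi>2 (s - t) \<bullet> v1 t = 0"
          by (simp add: inner_diff_left inner_add_left riesz_inner R'_def transpose_blinfun_apply inner_commute[of "v2 (s - t)"])
      qed
      from primitive_on_cong_AE[OF energy_identity_inner[OF 1(1) reg] _ this]
      have "primitive_on 0 s (\<lambda>t. flow R 0 h t \<bullet> q (s - t)) (\<lambda>_. 0)"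
        by (simp add: set_borel_measurable_def)
      from primitive_onD(2)[OF this order_refl s order_refl]
      have "flow R 0 h s \<bullet> q 0 = flow R 0 h 0 \<bullet> q s" by simp
      then show ?thesis
        using w[of "flow R 0 h s"] q(2) flow(2)[OF R order_refl] by (simp add: inner_commute)
    qed
    from orth[of "q s"] have "q s = 0" by simp
    then show "w = 0"
      using backward_uniqueness[OF q(1) bR' s] q(2) by simp
  qed
qed

section \<open>Decay from every initial time, variation of constants, predictor\<close>

text \<open>The hypothesis covers only solutions that start at time 0, that is, data
  \<open>h\<close> reachable at time \<open>r\<close>. These are dense by
  \<open>dense_range_flow\<close>, and the flow from \<open>r\<close> to \<open>t\<close> is bounded
  by the energy estimate, so the decay bound extends to all \<open>h\<close>.\<close>

lemma stable_flow:
  assumes R: "admissible C R" and D: "D \<ge> 0"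
    and stab: "\<And>z s t. (\<And>b. esol R (\<lambda>_. 0) 0 b z) \<Longrightarrow> 0 \<le> s \<Longrightarrow> s \<le> t \<Longrightarrow>
      norm (z t) \<le> D * exp (- \<mu> * (t - s)) * norm (z s)"
    and r: "0 \<le> r" "r \<le> t"
  shows "norm (flow R r h t) \<le> D * exp (- \<mu> * (t - r)) * norm h"
proof -
  define p where "p = D * exp (- \<mu> * (t - r))"
  define q where "q = exp (C\<^sup>2 * (t - r))"
  have p0: "p \<ge> 0" and q0: "q > 0" using D by (auto simp: p_def q_def)
  have "norm (flow R r h t) \<le> p * norm h + e" if e: "e > 0" for e
  proof -
    have "h \<in> closure (range (\<lambda>g. flow R 0 g r))" using dense_range_flow[OF R r(1)] by simp
    \<comment> \<open>The distance to the approximating state enters twice: with factor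
      \<open>p\<close> through the decay bound and with factor \<open>q\<close> through the
      flow.\<close>
    moreover have "e / (q + p) > 0" using e q0 p0 by simp
    ultimately obtain g where g: "dist (flow R 0 g r) h < e / (q + p)"
      unfolding closure_approachable by blast
    define k where "k = flow R 0 g r"
    have kh: "norm (k - h) \<le> e / (q + p)" using g by (simp add: k_def dist_norm)
    have "flow R r k t = flow R 0 g t" unfolding k_def using r by (intro flow_flow[OF R]) auto
    then have 1: "norm (flow R r k t) \<le> p * norm k"
      using stab[of "flow R 0 g" r t] flow(1)[OF R order_refl] r by (simp add: k_def p_def)
    have "norm (flow R r h t) \<le> norm (flow R r k t) + norm (flow R r (h - k) t)"
      using norm_triangle_sub[of "flow R r h t" "flow R r k t"] flow_diff[OF R r, of h k] by simp
    also have "\<dots> \<le> p * norm k + q * norm (h - k)"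
      using 1 flow_norm_le[OF R r, of "h - k"] by (intro add_mono) (auto simp: q_def)
    also have "\<dots> \<le> p * (norm h + norm (k - h)) + q * norm (k - h)"
      unfolding norm_minus_commute[of h k]
      using p0 q0 norm_triangle_sub[of k h] by (intro add_mono mult_left_mono) auto
    also have "\<dots> = p * norm h + (q + p) * norm (k - h)"
      by (simp add: algebra_simps)
    also have "\<dots> \<le> p * norm h + (q + p) * (e / (q + p))"
      using kh p0 q0 by (intro add_left_mono mult_left_mono) auto
    also have "\<dots> = p * norm h + e" using p0 q0 by simp
    finally show ?thesis .
  qed
  then show ?thesis unfolding p_def by (rule field_le_epsilon)
qed

lemma half_le_one_minus_exp:
  fixes x :: real
  assumes "0 \<le> x" "x \<le> 1" shows "x / 2 \<le> 1 - exp (- x)"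
proof -
  have "exp (- x) \<le> inverse (1 + x)"
    unfolding exp_minus using assms exp_ge_add_one_self[of x] by (intro le_imp_inverse_le) auto
  moreover have "x / 2 \<le> 1 - inverse (1 + x)"
    using assms mult_left_le[of x x] by (simp add: field_simps)
  ultimately show ?thesis by simp
qed

text \<open>Variation of constants without an integral. \<open>Y r\<close> lets \<open>y\<close> run
  up to time \<open>r\<close> and then evolve freely until \<open>t\<close>; it joins the free
  evolution of \<open>y s\<close> to \<open>y t\<close>. Over a short interval its increment is the
  free evolution of what the forcing produced there, of size \<open>4 * G * h\<close> before decay.
  This is dominated by the increment of \<open>K * exp (- \<mu> * (t - r))\<close>, and such bounds
  add up by bisection.\<close>

lemma duhamel_bound:
  assumes R: "admissible C R" and D: "D \<ge> 0" and \<mu>: "\<mu> > 0"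
    and stab: "\<And>r q h. 0 \<le> r \<Longrightarrow> r \<le> q \<Longrightarrow> norm (flow R r h q) \<le> D * exp (- \<mu> * (q - r)) * norm h"
    and st: "0 \<le> s" "s \<le> t" and sol: "esol R f s t y"
    and f: "\<And>r. r \<in> {s..t} \<Longrightarrow> norm (f r) \<le> G"
  shows "norm (y t) \<le> D * exp (- \<mu> * (t - s)) * norm (y s) + 8 * (D / \<mu>) * G"
proof -
  have "norm (f s) \<le> G" using st by (intro f) auto
  then have G: "G \<ge> 0" using norm_ge_zero[of "f s"] by linarith
  define Y where "Y r = flow R r (y r) t" for r
  define K where "K = 8 * (D / \<mu>) * G"
  have K0: "K \<ge> 0" using D \<mu> G by (simp add: K_def)
  define P where "P p q \<longleftrightarrow> (s \<le> p \<longrightarrow> p \<le> q \<longrightarrow> q \<le> t \<longrightarrow>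
    norm (Y q - Y p) \<le> K * (exp (- \<mu> * (t - q)) - exp (- \<mu> * (t - p))))" for p q
  \<comment> \<open>Short enough that \<open>\<mu> * h \<le> 1\<close>, as
    \<open>half_le_one_minus_exp\<close> demands, and that the energy growth factor is at most 2.
    Adding 1 to the denominator covers \<open>C = 0\<close>.\<close>
  define d where "d = min (1 / \<mu>) (ln 2 / (2 * C\<^sup>2 + 1))"
  have c1: "2 * C\<^sup>2 + 1 > 0" by (intro add_nonneg_pos) auto
  have d: "d > 0" using \<mu> c1 by (simp add: d_def)
  have local: "P p q" if pq: "q - p < d" for p q
    unfolding P_def
  proof (intro impI)
    assume spq: "s \<le> p" "p \<le> q" "q \<le> t"
    define h where "h = q - p"
    have h: "h \<ge> 0" "\<mu> * h \<le> 1" "2 * C\<^sup>2 * h \<le> ln 2"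
    proof -
      show "h \<ge> 0" using spq by (simp add: h_def)
      show "\<mu> * h \<le> 1" using pq \<mu> by (simp add: h_def d_def field_simps)
      have "(2 * C\<^sup>2 + 1) * h \<le> ln 2" using pq c1 by (simp add: h_def d_def pos_less_divide_eq mult.commute)
      then show "2 * C\<^sup>2 * h \<le> ln 2" using \<open>h \<ge> 0\<close> by (simp add: distrib_right)
    qed
    have p0: "0 \<le> p" and q0: "0 \<le> q" using spq st by auto
    define z where "z = (\<lambda>r. y r + (- 1) *\<^sub>R flow R p (y p) r)"
    have "{p..q} \<subseteq> {s..t}" using spq by auto
    from esol_lin[OF esol_subset[OF sol this] flow(1)[OF R p0, of q "y p"], of "- 1"]
    have "esol R f p q z" by (simp add: z_def)
    from energy_forced[OF this admissibleD(2)[OF R p0], of G q]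
    have "norm (z q) \<le> 2 * G * h * exp (2 * C\<^sup>2 * h)"
      using f spq flow(2)[OF R p0] by (auto simp: z_def h_def)
    also have "\<dots> \<le> 2 * G * h * 2"
    proof (rule mult_left_mono)
      have "exp (2 * C\<^sup>2 * h) \<le> exp (ln 2)" using h(3) by (simp only: exp_le_cancel_iff)
      then show "exp (2 * C\<^sup>2 * h) \<le> 2" by simp
    qed (use G h in simp)
    finally have zq: "norm (z q) \<le> 4 * G * h" by simp
    \<comment> \<open>Both terms pass through time \<open>q\<close>; their states there differ by
      \<open>z q\<close>, the response to the forcing on [p,q] from zero data.\<close>
    have "Y q - Y p = flow R q (z q) t"
      unfolding Y_def z_def using flow_flow[OF R p0 spq(2,3), of "y p"] flow_diff[OF R q0 spq(3), of "y q" "flow R p (y p) q"]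
      by simp
    then have "norm (Y q - Y p) \<le> D * exp (- \<mu> * (t - q)) * norm (z q)"
      using stab[OF q0 spq(3), of "z q"] by simp
    also have "\<dots> \<le> D * exp (- \<mu> * (t - q)) * (4 * G * h)"
      using D zq by (intro mult_left_mono) auto
    also have "\<dots> = K * exp (- \<mu> * (t - q)) * (\<mu> * h / 2)"
      using \<mu> by (simp add: K_def)
    also have "\<dots> \<le> K * exp (- \<mu> * (t - q)) * (1 - exp (- (\<mu> * h)))"
      using half_le_one_minus_exp[of "\<mu> * h"] h \<mu> K0 by (intro mult_left_mono) auto
    also have "\<dots> = K * (exp (- \<mu> * (t - q)) - exp (- \<mu> * (t - q) + - (\<mu> * h)))"
      unfolding exp_add by (simp add: algebra_simps)
    also have "- \<mu> * (t - q) + - (\<mu> * h) = - \<mu> * (t - p)"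
      by (simp add: h_def algebra_simps)
    finally show "norm (Y q - Y p) \<le> K * (exp (- \<mu> * (t - q)) - exp (- \<mu> * (t - p)))" .
  qed
  have "P s t"
  proof (rule Bolzano[OF st(2)])
    fix p q r assume "P p q" "P q r" and pqr: "p \<le> q" "q \<le> r"
    show "P p r"
      unfolding P_def
    proof (intro impI)
      assume "s \<le> p" "p \<le> r" "r \<le> t"
      then have "norm (Y q - Y p) \<le> K * (exp (- \<mu> * (t - q)) - exp (- \<mu> * (t - p)))"
        "norm (Y r - Y q) \<le> K * (exp (- \<mu> * (t - r)) - exp (- \<mu> * (t - q)))"
        using \<open>P p q\<close> \<open>P q r\<close> pqr by (auto simp: P_def)
      moreover have "norm (Y r - Y p) \<le> norm (Y r - Y q) + norm (Y q - Y p)"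
        using norm_triangle_ineq[of "Y r - Y q" "Y q - Y p"] by simp
      ultimately show "norm (Y r - Y p) \<le> K * (exp (- \<mu> * (t - r)) - exp (- \<mu> * (t - p)))"
        by (simp add: algebra_simps)
    qed
  next
    show "\<exists>d>0. \<forall>p q. p \<le> x \<and> x \<le> q \<and> q - p < d \<longrightarrow> P p q" for x
      using d local by blast
  qed
  then have "norm (Y t - Y s) \<le> K * (exp (- \<mu> * (t - t)) - exp (- \<mu> * (t - s)))"
    using st by (simp only: P_def)
  also have "\<dots> \<le> K * 1" using K0 by (intro mult_left_mono) auto
  finally have "norm (Y t - Y s) \<le> K" by simp
  moreover have "Y t = y t" using flow(2)[OF R] st by (simp add: Y_def)
  moreover have "norm (Y s) \<le> D * exp (- \<mu> * (t - s)) * norm (y s)"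
    unfolding Y_def using stab[OF st] .
  ultimately show ?thesis
    using norm_triangle_sub[of "y t" "Y s"] unfolding K_def by (simp add: norm_minus_commute)
qed

text \<open>Initial time, initial value and final time all move with \<open>t\<close>. Restarting
  from \<open>e\<close> at \<open>c\<close> instead of \<open>a\<close> changes the trajectory by
  the response to \<open>f\<close> on [a,c], which is of order \<open>c - a\<close>. What remains is
  continuity in time of the single trajectory started at \<open>t0\<close>.\<close>

lemma continuous_predictor:
  assumes R: "admissible C R" and sol: "\<And>b. esol R f 0 b e" and \<tau>: "\<tau> > 0"
    and f: "\<And>r. r \<ge> 0 \<Longrightarrow> norm (f r) \<le> M"
  shows "continuous_on {0..} (\<lambda>t. flow R t (e t) (t + \<tau>))"
proof -
  have M: "M \<ge> 0" using f[of 0] norm_ge_zero[of "f 0"] by linarith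
  define K where "K = exp (C\<^sup>2 * (\<tau> + 1)) * (2 * M * exp (2 * C\<^sup>2))"
  have K0: "K \<ge> 0" using M by (simp add: K_def)
  have lip: "norm (flow R a (e a) r - flow R c (e c) r) \<le> K * (c - a)"
    if ac: "0 \<le> a" "a \<le> c" "c - a \<le> 1" "c \<le> r" "r - c \<le> \<tau> + 1" for a c r
  proof -
    have c0: "0 \<le> c" using ac by simp
    define z where "z = (\<lambda>r. e r + (- 1) *\<^sub>R flow R a (e a) r)"
    have "esol R f a c e" using ac by (intro esol_subset[OF sol[of c]]) auto
    from esol_lin[OF this flow(1)[OF R ac(1), of c "e a"], of "- 1"]
    have "esol R f a c z" by (simp add: z_def)
    from energy_forced[OF this admissibleD(2)[OF R ac(1)], of M c]
    have "norm (z c) \<le> 2 * M * (c - a) * exp (2 * C\<^sup>2 * (c - a))"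
      using f ac flow(2)[OF R ac(1)] by (auto simp: z_def)
    also have "\<dots> \<le> 2 * M * (c - a) * exp (2 * C\<^sup>2)"
      using ac M by (intro mult_left_mono) (auto simp: mult_left_le)
    finally have zc: "norm (z c) \<le> 2 * M * (c - a) * exp (2 * C\<^sup>2)" .
    have "flow R a (e a) r - flow R c (e c) r = flow R c (- z c) r"
      using flow_flow[OF R ac(1,2,4), of "e a"] flow_diff[OF R c0 ac(4), of "flow R a (e a) c" "e c"]
      by (simp add: z_def)
    then have "norm (flow R a (e a) r - flow R c (e c) r) \<le> exp (C\<^sup>2 * (r - c)) * norm (z c)"
      using flow_norm_le[OF R c0 ac(4), of "- z c"] by simp
    also have "\<dots> \<le> exp (C\<^sup>2 * (\<tau> + 1)) * (2 * M * (c - a) * exp (2 * C\<^sup>2))"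
      using zc ac by (intro mult_mono) (auto intro!: mult_left_mono)
    also have "\<dots> = K * (c - a)" by (simp add: K_def)
    finally show ?thesis .
  qed
  show ?thesis
    unfolding continuous_on_def
  proof
    fix t0 :: real assume t0: "t0 \<in> {0..}"
    then have t0': "0 \<le> t0" by simp
    define z where "z = flow R t0 (e t0)"
    \<comment> \<open>The additional unit of time makes \<open>t0 + \<tau>\<close> an interior
      point.\<close>
    have "continuous_on {t0..t0 + \<tau> + 1} z"
      unfolding z_def by (rule esol_continuous[OF flow(1)[OF R t0']])
    then have "continuous_on {t0<..<t0 + \<tau> + 1} z"
      by (rule continuous_on_subset) auto
    then have "isCont z (t0 + \<tau>)"
      using \<tau> by (auto simp: continuous_on_eq_continuous_at)
    then have "((\<lambda>t. z (t + \<tau>)) \<longlongrightarrow> z (t0 + \<tau>)) (at t0 within {0..})"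
      by (rule isCont_tendsto_compose) (auto intro!: tendsto_intros)
    moreover have "((\<lambda>t. flow R t (e t) (t + \<tau>) - z (t + \<tau>)) \<longlongrightarrow> 0) (at t0 within {0..})"
    proof (rule Lim_null_comparison)
      have "\<forall>\<^sub>F t in at t0 within {0..}. dist t t0 < min \<tau> 1"
        using \<tau> by (auto simp: eventually_at intro!: exI[of _ "min \<tau> 1"])
      moreover have "\<forall>\<^sub>F t in at t0 within {0..}. t \<in> {0..}"
        by (auto simp: eventually_at intro!: exI[of _ 1])
      ultimately show "\<forall>\<^sub>F t in at t0 within {0..}. norm (flow R t (e t) (t + \<tau>) - z (t + \<tau>)) \<le> K * \<bar>t - t0\<bar>"
      proof eventually_elim
        case (elim t)
        then have t: "0 \<le> t" "\<bar>t - t0\<bar> < \<tau>" "\<bar>t - t0\<bar> < 1" by (auto simp: dist_real_def)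
        show ?case
        proof (cases "t \<le> t0")
          case True
          then show ?thesis using lip[of t t0 "t + \<tau>"] t \<tau> by (simp add: z_def)
        next
          case False
          then show ?thesis using lip[of t0 t "t + \<tau>"] t t0' \<tau> by (simp add: z_def norm_minus_commute)
        qed
      qed
      show "((\<lambda>t. K * \<bar>t - t0\<bar>) \<longlongrightarrow> 0) (at t0 within {0..})"
        by (rule tendsto_eq_intros | simp)+
    qed
    ultimately have "((\<lambda>t. (flow R t (e t) (t + \<tau>) - z (t + \<tau>)) + z (t + \<tau>)) \<longlongrightarrow> 0 + z (t0 + \<tau>)) (at t0 within {0..})"
      by (rule tendsto_add[rotated])
    then show "((\<lambda>t. flow R t (e t) (t + \<tau>)) \<longlongrightarrow> flow R t0 (e t0) (t0 + \<tau>)) (at t0 within {0..})"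
      by (simp add: z_def)
  qed
qed

end

section \<open>The sum norm, feedback terms and the given notion of solution\<close>

lemma bounded_linear_pivot_dual: "bounded_linear (pivot_dual j)"
proof -
  have "bounded_linear (\<lambda>h. blinfun_inner_right h o\<^sub>L j)"
    by (rule bounded_linear_compose[OF bounded_bilinear.bounded_linear_left[OF bounded_bilinear_blinfun_compose]
          bounded_linear_blinfun_inner_right])
  moreover have "pivot_dual j = (\<lambda>h. blinfun_inner_right h o\<^sub>L j)"
    by (rule ext) (simp add: pivot_dual_def)
  ultimately show ?thesis by simp
qed

lemma pivot_dual_apply: "pivot_dual j h v = h \<bullet> j v"
  by (simp add: pivot_dual_def)

text \<open>Each splitting gives the bound with its own norms; division by the bracket, when
  positive, allows passing to the infimum over splittings.\<close>

lemma sum_norm_lower: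
  fixes j :: "'v::real_inner \<Rightarrow>\<^sub>L 'h::real_inner"
  assumes R: "R \<in> sum_space j"
  shows "\<bar>R v w\<bar> \<le> sum_norm j R * (norm v * norm (j w) + norm (j v) * norm w)"
proof -
  define X where "X = norm v * norm (j w) + norm (j v) * norm w"
  have split: "\<bar>R v w\<bar> \<le> (norm P + norm Q) * X" if PQ: "sum_split j R P Q" for P Q
  proof -
    have "\<bar>P v \<bullet> j w\<bar> \<le> norm (P v) * norm (j w)" by (rule Cauchy_Schwarz_ineq2)
    also have "\<dots> \<le> (norm P * norm v) * norm (j w)" by (intro mult_right_mono norm_blinfun) auto
    finally have 1: "\<bar>P v \<bullet> j w\<bar> \<le> norm P * (norm v * norm (j w))" by (simp add: mult.assoc)
    have "norm (Q (j v) w) \<le> norm (Q (j v)) * norm w" by (rule norm_blinfun)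
    also have "\<dots> \<le> (norm Q * norm (j v)) * norm w" by (intro mult_right_mono norm_blinfun) auto
    finally have 2: "\<bar>Q (j v) w\<bar> \<le> norm Q * (norm (j v) * norm w)" by (simp add: mult.assoc)
    have "R v w = P v \<bullet> j w + Q (j v) w"
      using PQ by (simp add: sum_split_def pivot_dual_apply blinfun.add_left)
    then have "\<bar>R v w\<bar> \<le> norm P * (norm v * norm (j w)) + norm Q * (norm (j v) * norm w)"
      using 1 2 by linarith
    also have "\<dots> \<le> norm P * X + norm Q * X"
      by (intro add_mono mult_left_mono) (auto simp: X_def)
    finally show ?thesis by (simp add: distrib_right)
  qed
  have ne: "{norm P + norm Q | P Q. sum_split j R P Q} \<noteq> {}" using R by (auto simp: sum_space_def)
  have X0: "X \<ge> 0" by (simp add: X_def)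
  show ?thesis
  proof (cases "X = 0")
    case True
    obtain P Q where "sum_split j R P Q" using R by (auto simp: sum_space_def)
    from split[OF this] True show ?thesis by (simp add: X_def)
  next
    case False
    with X0 have X: "X > 0" by simp
    have "\<bar>R v w\<bar> / X \<le> sum_norm j R"
      unfolding sum_norm_def
    proof (rule cInf_greatest[OF ne])
      fix c assume "c \<in> {norm P + norm Q | P Q. sum_split j R P Q}"
      then show "\<bar>R v w\<bar> / X \<le> c" using split X by (auto simp: pos_divide_le_eq)
    qed
    then show ?thesis using X by (simp add: pos_divide_le_eq X_def)
  qed
qed

lemma sum_norm_nonneg:
  assumes "R \<in> sum_space j" shows "0 \<le> sum_norm j R"
  unfolding sum_norm_def using assms by (intro cInf_greatest) (auto simp: sum_space_def)

lemma sum_space_diff: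
  assumes "R \<in> sum_space j" "R' \<in> sum_space j"
  shows "R - R' \<in> sum_space j"
proof -
  obtain P Q P' Q' where "sum_split j R P Q" "sum_split j R' P' Q'"
    using assms by (auto simp: sum_space_def)
  then have "sum_split j (R - R') (P - P') (Q - Q')"
    by (simp add: sum_split_def blinfun.diff_left bounded_linear.linear[OF bounded_linear_pivot_dual, THEN linear_diff])
  then show ?thesis by (auto simp: sum_space_def)
qed

lemma norm_le_sum_norm:
  fixes j :: "'v::real_inner \<Rightarrow>\<^sub>L 'h::real_inner"
  assumes "R \<in> sum_space j"
  shows "norm R \<le> 2 * norm j * sum_norm j R"
proof -
  have s: "0 \<le> sum_norm j R" using sum_norm_nonneg[OF assms] .
  have "\<bar>R v w\<bar> \<le> (2 * norm j * sum_norm j R * norm v) * norm w" for v w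
  proof -
    have jv: "norm (j v) \<le> norm j * norm v" and jw: "norm (j w) \<le> norm j * norm w"
      by (rule norm_blinfun)+
    have "norm v * norm (j w) + norm (j v) * norm w \<le> norm v * (norm j * norm w) + (norm j * norm v) * norm w"
      using jv jw by (intro add_mono mult_left_mono mult_right_mono) auto
    also have "\<dots> = 2 * norm j * norm v * norm w" by simp
    finally have "sum_norm j R * (norm v * norm (j w) + norm (j v) * norm w) \<le> sum_norm j R * (2 * norm j * norm v * norm w)"
      using s by (intro mult_left_mono) auto
    then show ?thesis using sum_norm_lower[OF assms, of v w] by (simp add: mult_ac)
  qed
  then have "norm (R v) \<le> 2 * norm j * sum_norm j R * norm v" for v
    using s by (intro norm_blinfun_bound) auto
  then show ?thesis using s by (intro norm_blinfun_bound[of _ R]) auto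
qed

context pivot_space
begin

lemma admissible_if_continuous_bounded_in_sum:
  assumes "continuous_bounded_in_sum j R"
  shows "admissible (sup_sum_norm j R) R"
proof -
  have sp: "\<And>t. t \<ge> 0 \<Longrightarrow> R t \<in> sum_space j"
    and co: "\<And>t e. t \<ge> 0 \<Longrightarrow> e > 0 \<Longrightarrow> \<exists>d>0. \<forall>r\<ge>0. \<bar>r - t\<bar> < d \<longrightarrow> sum_norm j (R r - R t) < e"
    and bdd: "bdd_above ((\<lambda>t. sum_norm j (R t)) ` {0..})"
    using assms by (auto simp: continuous_bounded_in_sum_def)
  have "continuous_on {0..} R"
    unfolding continuous_on_iff
  proof (intro ballI allI impI)
    fix t e :: real assume t: "t \<in> {0..}" and e: "e > 0"
    have p: "2 * norm j + 1 > 0" by (intro add_nonneg_pos) auto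
    obtain d where d: "d > 0" "\<And>r. r \<ge> 0 \<Longrightarrow> \<bar>r - t\<bar> < d \<Longrightarrow> sum_norm j (R r - R t) < e / (2 * norm j + 1)"
      using co[of t "e / (2 * norm j + 1)"] t e p by auto
    have "dist (R r) (R t) < e" if r: "r \<ge> 0" "dist r t < d" for r
    proof -
      have sd: "R r - R t \<in> sum_space j" using sum_space_diff sp r t by auto
      have "norm (R r - R t) \<le> 2 * norm j * sum_norm j (R r - R t)" by (rule norm_le_sum_norm[OF sd])
      also have "\<dots> \<le> (2 * norm j + 1) * sum_norm j (R r - R t)"
        using sum_norm_nonneg[OF sd] by (intro mult_right_mono) auto
      also have "\<dots> < e"
        using d(2)[of r] r p by (simp add: dist_real_def pos_less_divide_eq mult.commute)
      finally show ?thesis by (simp add: dist_norm)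
    qed
    then show "\<exists>d>0. \<forall>r\<in>{0..}. dist r t < d \<longrightarrow> dist (R r) (R t) < e"
      using d(1) by auto
  qed
  moreover have "rel_bounded (sup_sum_norm j R) R {0..}"
    unfolding rel_bounded_def
  proof (intro ballI allI)
    fix t :: real and v w assume t: "t \<in> {0..}"
    have "sum_norm j (R t) \<le> sup_sum_norm j R"
      unfolding sup_sum_norm_def using t bdd by (rule cSUP_upper)
    then have "sum_norm j (R t) * (norm v * norm (j w) + norm (j v) * norm w)
        \<le> sup_sum_norm j R * (norm v * norm (j w) + norm (j v) * norm w)"
      by (intro mult_right_mono) auto
    then show "\<bar>R t v w\<bar> \<le> sup_sum_norm j R * (norm v * norm (j w) + norm (j v) * norm w)"
      using sum_norm_lower[OF sp, of t v w] t by simp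
  qed
  ultimately show ?thesis by (simp add: admissible_def)
qed

text \<open>A bounded feedback in H regarded as an operator from V to V'. Subtracting it from the
  perturbation keeps the latter admissible, so the closed-loop equations fall under the same
  theory.\<close>

definition feedback :: "('h \<Rightarrow> 'h) \<Rightarrow> 'v \<Rightarrow>\<^sub>L ('v \<Rightarrow>\<^sub>L real)" where
  "feedback F = Blinfun (\<lambda>v. pivot_dual j (F (j v)))"

lemma feedback_apply:
  assumes "bounded_linear F" shows "feedback F v = pivot_dual j (F (j v))"
proof -
  have "bounded_linear (\<lambda>v. pivot_dual j (F (j v)))"
    by (rule bounded_linear_compose[OF bounded_linear_pivot_dual
          bounded_linear_compose[OF assms blinfun.bounded_linear_right]])
  then show ?thesis by (simp add: feedback_def bounded_linear_Blinfun_apply)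
qed

lemma admissible_feedback:
  assumes R: "admissible C R" and F: "bounded_linear F"
  shows "admissible (C + onorm F * norm j) (\<lambda>t. R t - feedback F)"
proof -
  have "continuous_on {0..} (\<lambda>t. R t - feedback F)"
    using R unfolding admissible_def by (intro continuous_intros) auto
  moreover have "rel_bounded (C + onorm F * norm j) (\<lambda>t. R t - feedback F) {0..}"
    unfolding rel_bounded_def
  proof (intro ballI allI)
    fix t :: real and v w assume t: "t \<in> {0..}"
    define X where "X = norm v * norm (j w) + norm (j v) * norm w"
    have o: "0 \<le> onorm F" by (rule onorm_pos_le[OF F])
    have 1: "\<bar>R t v w\<bar> \<le> C * X" using R t unfolding admissible_def rel_bounded_def X_def by blast
    have "\<bar>F (j v) \<bullet> j w\<bar> \<le> norm (F (j v)) * norm (j w)" by (rule Cauchy_Schwarz_ineq2)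
    also have "\<dots> \<le> (onorm F * norm (j v)) * (norm j * norm w)"
      using o by (intro mult_mono onorm[OF F] norm_blinfun) auto
    also have "\<dots> \<le> onorm F * norm j * X"
    proof -
      have "onorm F * norm j * (norm (j v) * norm w) \<le> onorm F * norm j * X"
        using o by (intro mult_left_mono) (auto simp: X_def)
      then show ?thesis by (simp add: mult_ac)
    qed
    finally have 2: "\<bar>F (j v) \<bullet> j w\<bar> \<le> onorm F * norm j * X" .
    have "(R t - feedback F) v w = R t v w - F (j v) \<bullet> j w"
      by (simp add: blinfun.diff_left feedback_apply[OF F] pivot_dual_apply)
    then show "\<bar>(R t - feedback F) v w\<bar> \<le> (C + onorm F * norm j) * (norm v * norm (j w) + norm (j v) * norm w)"
      using 1 2 unfolding X_def[symmetric] by (simp add: distrib_right)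
  qed
  ultimately show ?thesis by (simp add: admissible_def)
qed

lemma esol_feedback:
  assumes F: "bounded_linear F"
  shows "esol (\<lambda>t. R t - feedback F) g a b y \<longleftrightarrow> esol R (\<lambda>t. F (y t) + g t) a b y"
proof -
  have eq: "rhs (\<lambda>t. R t - feedback F) g t v = rhs R (\<lambda>t. F (y t) + g t) t v" if "y t = j v" for t v
    using that by (simp add: blinfun.diff_left riesz_simps feedback_apply[OF F] jstar_simps)
      (simp add: jstar_def)
  show ?thesis
  proof
    assume "esol (\<lambda>t. R t - feedback F) g a b y"
    then show "esol R (\<lambda>t. F (y t) + g t) a b y"
      by (rule esol_cong) (rule AE_I2, use eq in blast)
  next
    assume "esol R (\<lambda>t. F (y t) + g t) a b y"
    then show "esol (\<lambda>t. R t - feedback F) g a b y"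
      by (rule esol_cong) (rule AE_I2, use eq in force)
  qed
qed

text \<open>Since \<open>y = j v\<close> almost everywhere, a state-dependent term can be read along
  the solution and becomes a forcing in time alone, the form that \<open>esol\<close>
  expects.\<close>

lemma weak_solution_dynamics:
  "weak_solution j J (dynamics j A R g) y \<longleftrightarrow>
   weak_solution j J (\<lambda>t v. - A v - R t v + pivot_dual j (g t (y t))) y"
proof -
  have "(AE t in lebesgue_on J. y t = j (v t)) \<and> weak_time_derivative j J y yd \<and>
      (AE t in lebesgue_on J. yd t = dynamics j A R g t (v t)) \<longleftrightarrow>
    (AE t in lebesgue_on J. y t = j (v t)) \<and> weak_time_derivative j J y yd \<and>
      (AE t in lebesgue_on J. yd t = - A (v t) - R t (v t) + pivot_dual j (g t (y t)))" for v yd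
  proof -
    have "(AE t in lebesgue_on J. yd t = dynamics j A R g t (v t)) \<longleftrightarrow>
      (AE t in lebesgue_on J. yd t = - A (v t) - R t (v t) + pivot_dual j (g t (y t)))"
      if ae: "AE t in lebesgue_on J. y t = j (v t)"
      by (rule eventually_subst, rule eventually_mono[OF ae]) (simp add: dynamics_def)
    then show ?thesis by blast
  qed
  then show ?thesis unfolding weak_solution_def by simp
qed

lemma weak_solution_iff_esol_atLeast:
  "weak_solution j {a..} (dynamics j A R g) y \<longleftrightarrow> (\<forall>b. esol R (\<lambda>t. g t (y t)) a b y)"
  unfolding weak_solution_dynamics
  using weak_solution_imp_esol[of "{a..}" R "\<lambda>t. g t (y t)" y a]
    esol_imp_weak_solution_atLeast[of a R "\<lambda>t. g t (y t)" y] by auto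

lemma weak_solution_iff_esol_atLeastAtMost:
  "weak_solution j {a..b} (dynamics j A R g) y \<longleftrightarrow> esol R (\<lambda>t. g t (y t)) a b y"
  unfolding weak_solution_dynamics
  using weak_solution_imp_esol[of "{a..b}" R "\<lambda>t. g t (y t)" y a b]
    esol_imp_weak_solution[of R "\<lambda>t. g t (y t)" a b y] by auto

text \<open>The exceptional time \<open>c\<close> accommodates the jump of the delayed input at time
  \<open>\<tau>\<close>.\<close>

lemma esol_cong_forcing:
  assumes "esol R f a b y" "\<And>t. t \<in> {a..b} \<Longrightarrow> t \<noteq> c \<Longrightarrow> f t = g t"
  shows "esol R g a b y"
proof (rule esol_cong[OF assms(1)])
  have "{c} \<in> null_sets lebesgue" by simp
  from AE_not_in[OF this]
  show "AE t in lebesgue. t \<in> {a..b} \<longrightarrow> (\<forall>v. y t = j v \<longrightarrow> rhs R f t v = rhs R g t v)"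
    by (rule eventually_mono) (use assms(2) in auto)
qed

end

section \<open>Essential suprema and coordinate spaces\<close>

lemma Linf_norm_bounded:
  assumes "f \<in> borel_measurable (lebesgue_on J)" "\<And>t. t \<in> J \<Longrightarrow> norm (f t) \<le> M"
  shows "Linf_norm J f \<le> ennreal M"
  unfolding Linf_norm_def
proof (rule esssup_I)
  show "(\<lambda>t. ennreal (norm (f t))) \<in> borel_measurable (lebesgue_on J)"
    using assms(1) by measurable
  show "AE t in lebesgue_on J. ennreal (norm (f t)) \<le> ennreal M"
    by (rule AE_I2) (auto intro!: ennreal_leI assms(2))
qed

lemma borel_measurable_extend_by_zero:
  fixes e :: "real \<Rightarrow> 'a::real_normed_vector"
  assumes "continuous_on {0..} e"
  shows "extend_by_zero e \<in> borel_measurable (lebesgue_on J)"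
proof -
  have "(\<lambda>t. indicator {0<..} t *\<^sub>R e t) \<in> borel_measurable borel"
    by (rule borel_measurable_continuous_on_indicator) (auto intro: continuous_on_subset[OF assms])
  moreover have "extend_by_zero e = (\<lambda>t. indicator {0<..} t *\<^sub>R e t)"
    by (auto simp: extend_by_zero_def indicator_def)
  ultimately show ?thesis by (simp add: measurable_restrict_space1 measurable_completion)
qed

text \<open>At positive times the extension by zero is \<open>e\<close> itself, and by continuity
  the set where the bound holds is closed. It contains almost every point of the nonempty open
  interval from \<open>max 0 a\<close> to \<open>b\<close>, hence the closed interval.\<close>

lemma norm_le_Linf_norm:
  fixes e :: "real \<Rightarrow> 'a::real_normed_vector"
  assumes e: "continuous_on {0..} e" and N: "Linf_norm {a<..<b} (extend_by_zero e) \<le> ennreal N" "N \<ge> 0"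
    and r: "max 0 a \<le> r" "r \<le> b" "max 0 a < b"
  shows "norm (e r) \<le> N"
proof -
  define T where "T = {t \<in> {0..}. norm (e t) \<le> N}"
  have "closed T"
    unfolding T_def using e by (intro continuous_on_closed_Collect_le continuous_intros) auto
  have "AE t in lebesgue_on {a<..<b}. ennreal (norm (extend_by_zero e t)) \<le> ennreal N"
    using esssup_AE[of "\<lambda>t. ennreal (norm (extend_by_zero e t))" "lebesgue_on {a<..<b}"] N(1)
    unfolding Linf_norm_def by (auto elim: eventually_mono)
  then have ae: "AE t in lebesgue. t \<in> {a<..<b} \<longrightarrow> ennreal (norm (extend_by_zero e t)) \<le> ennreal N"
    by (simp add: AE_restrict_space_iff)
  have "AE t\<in>{max 0 a<..<b} in lebesgue. t \<in> T"
    by (rule eventually_mono[OF ae]) (use N(2) in \<open>auto simp: T_def extend_by_zero_def ennreal_le_iff\<close>)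
  from mem_closed_if_AE_lebesgue_open[OF open_greaterThanLessThan \<open>closed T\<close> this]
  have "{max 0 a<..<b} \<subseteq> T" by blast
  then have "closure {max 0 a<..<b} \<subseteq> T" using \<open>closed T\<close> by (rule closure_minimal)
  then have "r \<in> T" using r by auto
  then show ?thesis by (simp add: T_def)
qed

lemma Rn_norm_nonneg: "0 \<le> Rn_norm n x"
  by (simp add: Rn_norm_def L2_set_nonneg)

lemma bounded_linear_into_RnD:
  assumes "bounded_linear_into_Rn n K"
  shows "K x \<in> Rn n" "K (x + y) = (\<lambda>i. K x i + K y i)" "K (c *\<^sub>R x) = (\<lambda>i. c * K x i)"
  using assms by (auto simp: bounded_linear_into_Rn_def)

lemma bounded_linear_into_Rn_bound:
  assumes "bounded_linear_into_Rn n K"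
  shows "\<exists>M\<ge>0. \<forall>x. Rn_norm n (K x) \<le> M * norm x"
proof -
  obtain M where M: "\<And>x. Rn_norm n (K x) \<le> M * norm x"
    using assms by (auto simp: bounded_linear_into_Rn_def)
  have "Rn_norm n (K x) \<le> \<bar>M\<bar> * norm x" for x
    using M[of x] mult_right_mono[OF abs_ge_self[of M] norm_ge_zero[of x]] by linarith
  then show ?thesis by (intro exI[of _ "\<bar>M\<bar>"]) auto
qed

lemma bounded_linear_into_Rn_component:
  assumes "bounded_linear_into_Rn n K"
  shows "bounded_linear (\<lambda>x. K x i)"
proof -
  obtain M where M: "M \<ge> 0" "\<And>x. Rn_norm n (K x) \<le> M * norm x"
    using bounded_linear_into_Rn_bound[OF assms] by blast
  have le: "\<bar>K x i\<bar> \<le> norm x * M" for x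
  proof (cases "i < n")
    case True
    have "sqrt ((K x i)\<^sup>2) \<le> Rn_norm n (K x)"
      unfolding Rn_norm_def L2_set_def using True by (intro real_sqrt_le_mono member_le_sum) auto
    then show ?thesis using M(2)[of x] by (simp add: mult.commute)
  next
    case False
    then have "K x i = 0" using bounded_linear_into_RnD(1)[OF assms, of x] by (simp add: Rn_def)
    then show ?thesis using M(1) by simp
  qed
  show ?thesis
    by (rule bounded_linear_intro[of _ M]) (use le bounded_linear_into_RnD(2,3)[OF assms] in auto)
qed

lemma bounded_linear_control_operator:
  fixes \<Phi> :: "nat \<Rightarrow> 'a::real_normed_vector"
  assumes "bounded_linear_into_Rn m K"
  shows "bounded_linear (\<lambda>x. control_operator m \<Phi> (K x))"
  unfolding control_operator_def
  by (intro bounded_linear_sum bounded_linear_compose[OF bounded_linear_scaleR_left]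
      bounded_linear_into_Rn_component[OF assms])

lemma bounded_linear_injection:
  assumes W: "bounded_linear_into_Rn n W" and L: "bounded_linear_from_Rn n L"
  shows "bounded_linear (\<lambda>x. L (W x))"
proof -
  obtain M where M: "M \<ge> 0" "\<And>x. Rn_norm n (W x) \<le> M * norm x"
    using bounded_linear_into_Rn_bound[OF W] by blast
  obtain M' where M': "\<And>x. x \<in> Rn n \<Longrightarrow> norm (L x) \<le> M' * Rn_norm n x"
    using L unfolding bounded_linear_from_Rn_def by blast
  note WD = bounded_linear_into_RnD[OF W]
  show ?thesis
  proof (rule bounded_linear_intro[of _ "\<bar>M'\<bar> * M"])
    show "L (W (x + y)) = L (W x) + L (W y)" for x y
      using L WD(1)[of x] WD(1)[of y] unfolding WD(2) bounded_linear_from_Rn_def by blast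
    show "L (W (c *\<^sub>R x)) = c *\<^sub>R L (W x)" for c x
      using L WD(1)[of x] unfolding WD(3) bounded_linear_from_Rn_def by blast
    show "norm (L (W x)) \<le> norm x * (\<bar>M'\<bar> * M)" for x
    proof -
      have "norm (L (W x)) \<le> M' * Rn_norm n (W x)" by (rule M'[OF WD(1)])
      also have "\<dots> \<le> \<bar>M'\<bar> * (M * norm x)"
        by (intro mult_mono M) (auto simp: Rn_norm_nonneg)
      finally show ?thesis by (simp add: mult_ac)
    qed
  qed
qed

section \<open>The closed loop with predictor and observer\<close>

locale predictor_loop = pivot_space j A
  for j :: "'v::{real_inner,banach,second_countable_topology}
                \<Rightarrow>\<^sub>L 'h::{real_inner,banach,second_countable_topology}"
    and A :: "'v \<Rightarrow>\<^sub>L ('v \<Rightarrow>\<^sub>L real)" +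
  fixes Arc :: "real \<Rightarrow> ('v \<Rightarrow>\<^sub>L ('v \<Rightarrow>\<^sub>L real))" and Crc :: real and m n :: nat
    and \<Phi> :: "nat \<Rightarrow> 'h" and W K :: "'h \<Rightarrow> (nat \<Rightarrow> real)" and L :: "(nat \<Rightarrow> real) \<Rightarrow> 'h"
    and D \<mu> C \<tau> :: real
  assumes Arc: "admissible Crc Arc"
    and W: "bounded_linear_into_Rn n W" and K: "bounded_linear_into_Rn m K"
    and L: "bounded_linear_from_Rn n L"
    and D: "D \<ge> 1" and \<mu>: "\<mu> > 0" and C: "C \<ge> 1" and \<tau>: "\<tau> > 0"
    and stable_BK: "exp_stable j (dynamics j A Arc (\<lambda>t x. control_operator m \<Phi> (K x))) D \<mu>"
    and stable_LW: "exp_stable j (dynamics j A Arc (\<lambda>t x. L (W x))) C 0"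
begin

abbreviation "B \<equiv> control_operator m \<Phi>"
abbreviation "BK \<equiv> \<lambda>x. B (K x)"
abbreviation "LW \<equiv> \<lambda>x. L (W x)"

lemma B_zero: "B (\<lambda>i. 0) = 0"
  by (simp add: control_operator_def)

lemma linear_BK: "bounded_linear BK" and linear_LW: "bounded_linear LW"
  by (rule bounded_linear_control_operator[OF K] bounded_linear_injection[OF W L])+

lemma LW_diff: "L (\<lambda>i. W x i - W y i) = LW (x - y)"
proof -
  have "W (x - y) = (\<lambda>i. W x i - W y i)"
    using bounded_linear_into_RnD(2)[OF W, of x "(- 1) *\<^sub>R y"] unfolding bounded_linear_into_RnD(3)[OF W] by simp
  then show ?thesis by simp
qed

abbreviation "R\<^sub>K \<equiv> \<lambda>t. Arc t - feedback BK"
abbreviation "R\<^sub>L \<equiv> \<lambda>t. Arc t - feedback LW"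

lemmas R\<^sub>K = admissible_feedback[OF Arc linear_BK]
lemmas R\<^sub>L = admissible_feedback[OF Arc linear_LW]

lemma flow_RK_le:
  assumes "0 \<le> r" "r \<le> t"
  shows "norm (flow R\<^sub>K r h t) \<le> D * exp (- \<mu> * (t - r)) * norm h"
proof (rule stable_flow[OF R\<^sub>K _ _ assms])
  fix z s t assume z: "\<And>b. esol R\<^sub>K (\<lambda>_. 0) 0 b z" and st: "0 \<le> s" "s \<le> (t::real)"
  have "weak_solution j {0..} (dynamics j A Arc (\<lambda>t x. BK x)) z"
    unfolding weak_solution_iff_esol_atLeast using z unfolding esol_feedback[OF linear_BK] by simp
  then show "norm (z t) \<le> D * exp (- \<mu> * (t - s)) * norm (z s)"
    using stable_BK st unfolding exp_stable_def by blast
qed (use D in simp)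

text \<open>The estimation error as a function of its initial value: the input enters plant and
  observer alike and cancels in their difference.\<close>

definition err :: "'h \<Rightarrow> real \<Rightarrow> 'h" where "err h = flow R\<^sub>L 0 h"

lemma err_zero: "err h 0 = h"
  unfolding err_def by (rule flow(2)[OF R\<^sub>L order_refl])

lemma esol_err: "esol Arc (\<lambda>t. LW (err h t)) 0 b (err h)"
  using flow(1)[OF R\<^sub>L order_refl, of b h] unfolding err_def esol_feedback[OF linear_LW] by simp

lemma norm_err_le:
  assumes "0 \<le> t" shows "norm (err h t) \<le> C * norm h"
proof -
  have "weak_solution j {0..} (dynamics j A Arc (\<lambda>t x. LW x)) (err h)"
    unfolding weak_solution_iff_esol_atLeast using esol_err by blast
  then have "norm (err h t) \<le> C * exp (- 0 * (t - 0)) * norm (err h 0)"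
    using stable_LW assms unfolding exp_stable_def by blast
  then show ?thesis by (simp add: err_zero)
qed

lemma continuous_on_atLeast:
  assumes "\<And>b. esol R f 0 b y" shows "continuous_on {0..} y"
proof -
  have "weak_solution j {0..} (dynamics j A R (\<lambda>t _. f t)) y"
    unfolding weak_solution_iff_esol_atLeast using assms by blast
  then show ?thesis by (simp add: weak_solution_def)
qed

lemma continuous_err: "continuous_on {0..} (err h)"
  by (rule continuous_on_atLeast[OF esol_err])

text \<open>The error, at time \<open>t + \<tau>\<close>, of the prediction made at time
  \<open>t\<close>: the estimation error transported by the plant without input.\<close>

definition pred_err :: "'h \<Rightarrow> real \<Rightarrow> 'h" where "pred_err h t = flow Arc t (err h t) (t + \<tau>)"

lemma continuous_pred_err: "continuous_on {0..} (pred_err h)"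
proof -
  have "norm (LW (err h r)) \<le> onorm LW * (C * norm h)" if "r \<ge> 0" for r
    by (rule order_trans[OF onorm[OF linear_LW] mult_left_mono[OF norm_err_le[OF that] onorm_pos_le[OF linear_LW]]])
  from continuous_predictor[OF Arc esol_err \<tau> this] show ?thesis
    unfolding pred_err_def[abs_def] .
qed

lemma norm_pred_err_le:
  assumes "0 \<le> t" shows "norm (pred_err h t) \<le> exp (Crc\<^sup>2 * \<tau>) * norm (err h t)"
  using flow_norm_le[OF Arc assms, of "t + \<tau>" "err h t"] \<tau> by (simp add: pred_err_def)

abbreviation "closed_loop y0 yh0 \<equiv> closed_loop_solution j A Arc m B W K L \<tau> y0 yh0"

text \<open>The input expressed through the true state. Although \<open>y (t + \<tau>)\<close>
  appears, the law is causal: that state is fixed by the inputs before time \<open>t\<close>, as an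
  input acts only after the delay.\<close>

definition control_law :: "'h \<Rightarrow> (real \<Rightarrow> 'h) \<Rightarrow> real \<Rightarrow> nat \<Rightarrow> real" where
  "control_law h y t = (if t < 0 then (\<lambda>i. 0) else K (y (t + \<tau>) + pred_err h t))"

text \<open>The reduction on which everything rests. Plant, observer and predictor receive the same
  input, so their pairwise differences solve input-free equations and are given by flows;
  substituting the resulting formula for \<open>u\<close> turns the delayed equation into one with
  instantaneous feedback.\<close>

lemma closed_loopD:
  assumes sol: "closed_loop y0 yh0 y yh u"
  shows "\<And>t. 0 \<le> t \<Longrightarrow> yh t = y t + err (yh0 - y0) t"
    and "\<And>t. - \<tau> \<le> t \<Longrightarrow> u t = control_law (yh0 - y0) y t"
    and "esol Arc (\<lambda>_. 0) 0 \<tau> y" and "y 0 = y0"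
    and "esol R\<^sub>K (\<lambda>t. BK (pred_err (yh0 - y0) (t - \<tau>))) \<tau> b y"
proof -
  define h where "h = yh0 - y0"
  define f where "f t = B (u (t - \<tau>))" for t
  have y: "esol Arc f 0 b y" for b
    using sol unfolding closed_loop_solution_def weak_solution_iff_esol_atLeast f_def[abs_def] by blast
  have yh: "esol Arc (\<lambda>t. f t + LW (yh t - y t)) 0 b yh" for b
    using sol unfolding closed_loop_solution_def weak_solution_iff_esol_atLeast f_def LW_diff by blast
  have init: "y 0 = y0" "yh 0 = yh0" and u0: "\<And>t. t \<in> {-\<tau>..<0} \<Longrightarrow> u t = (\<lambda>i. 0)"
    and pred: "\<And>t. t \<ge> 0 \<Longrightarrow> \<exists>p. predicted_state j A Arc B t (t + \<tau>) (\<lambda>r. u (r - \<tau>)) (yh t) p \<and> u t = K p"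
    using sol unfolding closed_loop_solution_def by blast+
  show e: "yh t = y t + err (yh0 - y0) t" if t: "0 \<le> t" for t
  proof -
    have "esol Arc (\<lambda>t. LW (yh t + (- 1) *\<^sub>R y t) + 0) 0 t (\<lambda>t. yh t + (- 1) *\<^sub>R y t)"
      using esol_lin[OF yh[of t] y[of t], of "- 1"] by simp
    then have "esol R\<^sub>L (\<lambda>_. 0) 0 t (\<lambda>t. yh t + (- 1) *\<^sub>R y t)"
      unfolding esol_feedback[OF linear_LW] .
    from flow_unique[OF R\<^sub>L order_refl this, of t] t init
    have "yh t - y t = err h t" by (simp add: err_def h_def)
    then show ?thesis by (simp add: h_def algebra_simps)
  qed
  have u: "u t = K (y (t + \<tau>) + pred_err h t)" if t: "0 \<le> t" for t
  proof -
    obtain Y where Y: "weak_solution j {t..t + \<tau>} (dynamics j A Arc (\<lambda>r _. B (u (r - \<tau>)))) Y"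
      "Y t = yh t" "u t = K (Y (t + \<tau>))"
      using pred[OF t] unfolding predicted_state_def by blast
    have "esol Arc f t (t + \<tau>) Y"
      using Y(1) unfolding weak_solution_iff_esol_atLeastAtMost f_def[abs_def] .
    moreover have "esol Arc f t (t + \<tau>) y"
      by (rule esol_subset[OF y[of "t + \<tau>"]]) (use t in auto)
    ultimately have "esol Arc (\<lambda>_. 0) t (t + \<tau>) (\<lambda>r. Y r + (- 1) *\<^sub>R y r)"
      using esol_lin[of Arc f t "t + \<tau>" Y f y "- 1"] by simp
    from flow_unique[OF Arc t this, of "t + \<tau>"] Y(2) e[OF t] \<tau>
    have "Y (t + \<tau>) - y (t + \<tau>) = pred_err h t" by (simp add: pred_err_def h_def)
    then have "Y (t + \<tau>) = y (t + \<tau>) + pred_err h t" by (simp add: algebra_simps)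
    then show ?thesis using Y(3) by simp
  qed
  show "u t = control_law (yh0 - y0) y t" if "- \<tau> \<le> t" for t
    using that u u0 by (simp add: control_law_def h_def)
  show "y 0 = y0" by (rule init)
  show "esol Arc (\<lambda>_. 0) 0 \<tau> y"
    \<comment> \<open>At time \<open>\<tau>\<close> itself the delayed input is already
      \<open>u 0\<close>, in general nonzero.\<close>
    by (rule esol_cong_forcing[OF y, of _ \<tau>]) (use u0 B_zero in \<open>auto simp: f_def\<close>)
  show "esol R\<^sub>K (\<lambda>t. BK (pred_err (yh0 - y0) (t - \<tau>))) \<tau> b y" for b
    unfolding esol_feedback[OF linear_BK] h_def[symmetric]
  proof (rule esol_cong_forcing[where c = 0, OF esol_subset[OF y[of b]]])
    show "{\<tau>..b} \<subseteq> {0..b}" using \<tau> by auto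
    fix t assume "t \<in> {\<tau>..b}"
    then have "0 \<le> t - \<tau>" by simp
    then show "f t = BK (y t) + BK (pred_err h (t - \<tau>))"
      using bounded_linear.linear[OF linear_BK, THEN linear_add] by (simp add: f_def u)
  qed
qed

lemma continuous_control_law:
  assumes "continuous_on {0..} y"
  shows "continuous_on {0..} (\<lambda>t. control_law h y t i)"
proof -
  have "continuous_on {0..} (\<lambda>t. y (t + \<tau>))"
    using \<tau> by (intro continuous_on_compose2[OF assms] continuous_intros) auto
  then have "continuous_on {0..} (\<lambda>t. y (t + \<tau>) + pred_err h t)"
    by (intro continuous_on_add continuous_pred_err)
  from bounded_linear.continuous_on[OF bounded_linear_into_Rn_component[OF K, of i] this]
  show ?thesis by (rule continuous_on_eq) (simp add: control_law_def)
qed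

text \<open>The prediction error depends only on the initial error, so the representation in
  \<open>closed_loopD\<close> can be read as a construction: first \<open>y\<close>, then
  \<open>u\<close> and \<open>yh\<close>. No fixed point has to be found.\<close>

lemma closed_loop_exists: "\<exists>y yh u. closed_loop y0 yh0 y yh u"
proof -
  define h where "h = yh0 - y0"
  define g where "g = (\<lambda>t. BK (pred_err h (t - \<tau>)))"
  have \<tau>0: "0 \<le> \<tau>" using \<tau> by simp
  have "continuous_on {\<tau>..} (\<lambda>t. pred_err h (t - \<tau>))"
    by (rule continuous_on_compose2[OF continuous_pred_err]) (auto intro!: continuous_intros)
  then have "continuous_on {\<tau>..} g"
    unfolding g_def by (rule bounded_linear.continuous_on[OF linear_BK])
  from esol_exists_global[OF R\<^sub>K \<tau>0 this, of "flow Arc 0 y0 \<tau>"]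
  obtain y2 where y2: "\<And>b. esol R\<^sub>K g \<tau> b y2" "y2 \<tau> = flow Arc 0 y0 \<tau>" by blast
  \<comment> \<open>No input arrives before \<open>\<tau>\<close>; from then on the feedback with
    the known forcing \<open>g\<close> acts.\<close>
  define y where "y t = (if t \<le> \<tau> then flow Arc 0 y0 t else y2 t)" for t
  define u where "u = control_law h y"
  define f where "f = (\<lambda>t. B (u (t - \<tau>)))"
  have "esol Arc (\<lambda>_. 0) 0 \<tau> y"
    by (rule esol_fun_cong[OF flow(1)[OF Arc order_refl]]) (simp add: y_def)
  then have 1: "esol Arc f 0 \<tau> y"
    by (rule esol_cong_forcing[of _ _ _ _ _ \<tau>]) (simp add: f_def u_def control_law_def B_zero)
  have 2: "esol Arc f \<tau> b y" for b
  proof -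
    have "esol R\<^sub>K g \<tau> b y"
      by (rule esol_fun_cong[OF y2(1)]) (use y2(2) in \<open>auto simp: y_def\<close>)
    then have "esol Arc (\<lambda>t. BK (y t) + g t) \<tau> b y"
      unfolding esol_feedback[OF linear_BK] .
    then show ?thesis
      by (rule esol_cong_forcing)
        (simp add: f_def u_def g_def control_law_def bounded_linear.linear[OF linear_BK, THEN linear_add])
  qed
  have y: "esol Arc f 0 b y" for b
  proof (cases "\<tau> \<le> b")
    case True
    then show ?thesis by (rule esol_combine[OF 1 2 \<tau>0])
  next
    case False
    then show ?thesis by (intro esol_subset[OF 1]) auto
  qed
  define yh where "yh = (\<lambda>t. y t + 1 *\<^sub>R err h t)"
  have yh: "esol Arc (\<lambda>t. f t + L (\<lambda>i. W (yh t) i - W (y t) i)) 0 b yh" for b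
    unfolding LW_diff using esol_lin[OF y[of b] esol_err[of h b], of 1] by (simp add: yh_def)
  have cy: "continuous_on {0..} y" by (rule continuous_on_atLeast[OF y])
  have "L2_loc {-\<tau>..} (\<lambda>t. u t i)" for i
    unfolding L2_loc_iff
  proof (intro allI impI)
    fix a b assume ab: "{a..b} \<subseteq> {-\<tau>..}"
    have "sq_integrable {-\<tau>..0} (\<lambda>t. u t i)"
    proof (rule sq_integrable_cong_AE)
      show "sq_integrable {-\<tau>..0} (\<lambda>_. 0 :: real)" by (intro sq_integrable_continuous continuous_intros)
      have "{0} \<in> null_sets lebesgue" by simp
      from AE_not_in[OF this] show "AE t in lebesgue. t \<in> {-\<tau>..0} \<longrightarrow> 0 = u t i"
        by (rule eventually_mono) (simp add: u_def control_law_def)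
    qed
    moreover have "sq_integrable {0..max 0 b} (\<lambda>t. u t i)"
      unfolding u_def by (intro sq_integrable_continuous continuous_on_subset[OF continuous_control_law[OF cy]]) auto
    ultimately have "sq_integrable {-\<tau>..max 0 b} (\<lambda>t. u t i)"
      using \<tau>0 by (intro sq_integrable_Un[of "-\<tau>" 0 _ "max 0 b"]) auto
    then show "sq_integrable {a..b} (\<lambda>t. u t i)"
      by (rule sq_integrable_subset) (use ab in auto)
  qed
  moreover have "weak_solution j {0..} (dynamics j A Arc (\<lambda>t _. B (u (t - \<tau>)))) y"
    using y unfolding weak_solution_iff_esol_atLeast f_def by blast
  moreover have "weak_solution j {0..}
      (dynamics j A Arc (\<lambda>t x. B (u (t - \<tau>)) + L (\<lambda>i. W x i - W (y t) i))) yh"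
    using yh unfolding weak_solution_iff_esol_atLeast f_def by blast
  moreover have "y 0 = y0" using \<tau> flow(2)[OF Arc order_refl] by (simp add: y_def)
  moreover from this have "yh 0 = yh0" by (simp add: yh_def err_zero h_def)
  moreover have "u t = (\<lambda>i. 0)" if "t \<in> {-\<tau>..<0}" for t using that by (simp add: u_def control_law_def)
  moreover have "\<exists>p. predicted_state j A Arc B t (t + \<tau>) (\<lambda>r. u (r - \<tau>)) (yh t) p \<and> u t = K p"
    if t: "t \<ge> 0" for t
  proof -
    \<comment> \<open>The predictor's trajectory is the true one plus the freely evolving estimation
      error.\<close>
    define Y where "Y = (\<lambda>r. y r + 1 *\<^sub>R flow Arc t (err h t) r)"
    have "esol Arc f t (t + \<tau>) y" by (rule esol_subset[OF y[of "t + \<tau>"]]) (use t in auto)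
    from esol_lin[OF this flow(1)[OF Arc t], of 1 "err h t"]
    have "esol Arc f t (t + \<tau>) Y" by (simp add: Y_def)
    then have "weak_solution j {t..t + \<tau>} (dynamics j A Arc (\<lambda>r _. B (u (r - \<tau>)))) Y"
      unfolding weak_solution_iff_esol_atLeastAtMost f_def .
    moreover have "Y t = yh t" using flow(2)[OF Arc t] by (simp add: Y_def yh_def)
    moreover have "u t = K (Y (t + \<tau>))" using t by (simp add: u_def control_law_def Y_def pred_err_def)
    ultimately show ?thesis unfolding predicted_state_def by blast
  qed
  ultimately have "closed_loop y0 yh0 y yh u"
    unfolding closed_loop_solution_def by blast
  then show ?thesis by blast
qed

lemma closed_loop_unique:
  assumes sol: "closed_loop y0 yh0 y yh u" "closed_loop y0 yh0 y' yh' u'"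
  shows "\<And>t. 0 \<le> t \<Longrightarrow> y t = y' t \<and> yh t = yh' t" and "\<And>t. - \<tau> \<le> t \<Longrightarrow> u t = u' t"
proof -
  note c = closed_loopD[OF sol(1)] and c' = closed_loopD[OF sol(2)]
  have \<tau>0: "0 \<le> \<tau>" using \<tau> by simp
  have 1: "y t = y' t" if "t \<in> {0..\<tau>}" for t
    using esol_unique[OF c(3) c'(3) admissibleD(2)[OF Arc order_refl] _ that] c(4) c'(4) by simp
  have 2: "y t = y' t" if "\<tau> \<le> t" for t
    using esol_unique[OF c(5) c'(5)[of t] admissibleD(2)[OF R\<^sub>K \<tau>0], of t] 1[of \<tau>] that \<tau>0 by simp
  have eq: "y t = y' t" if "0 \<le> t" for t
    using 1[of t] 2[of t] that by (cases "t \<le> \<tau>") auto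
  show "y t = y' t \<and> yh t = yh' t" if "0 \<le> t" for t
    using eq[OF that] c(1)[OF that] c'(1)[OF that] by simp
  show "u t = u' t" if t: "- \<tau> \<le> t" for t
    using c(2)[OF t] c'(2)[OF t] eq[of "t + \<tau>"] \<tau> by (auto simp: control_law_def)
qed

lemma delayed_estimate:
  assumes sol: "closed_loop y0 yh0 y yh u" and st: "\<tau> \<le> s" "s \<le> t"
    and N: "\<And>r. s - \<tau> \<le> r \<Longrightarrow> r \<le> t - \<tau> \<Longrightarrow> norm (err (yh0 - y0) r) \<le> \<epsilon>"
  shows "norm (y t) \<le> D * exp (- \<mu> * (t - s)) * norm (y s) +
    8 * (D / \<mu>) * (onorm BK * (exp (Crc\<^sup>2 * \<tau>) * \<epsilon>))"
proof (rule duhamel_bound[OF R\<^sub>K])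
  have "{s..t} \<subseteq> {\<tau>..t}" using st by auto
  from esol_subset[OF closed_loopD(5)[OF sol] this]
  show "esol R\<^sub>K (\<lambda>t. BK (pred_err (yh0 - y0) (t - \<tau>))) s t y" .
  show "norm (BK (pred_err (yh0 - y0) (r - \<tau>))) \<le> onorm BK * (exp (Crc\<^sup>2 * \<tau>) * \<epsilon>)" if r: "r \<in> {s..t}" for r
  proof -
    have "norm (pred_err (yh0 - y0) (r - \<tau>)) \<le> exp (Crc\<^sup>2 * \<tau>) * norm (err (yh0 - y0) (r - \<tau>))"
      using r st by (intro norm_pred_err_le) auto
    also have "\<dots> \<le> exp (Crc\<^sup>2 * \<tau>) * \<epsilon>"
      using r by (intro mult_left_mono N) auto
    finally show ?thesis
      by (rule order_trans[OF onorm[OF linear_BK] mult_left_mono[OF _ onorm_pos_le[OF linear_BK]]])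
  qed
  show "norm (flow R\<^sub>K r h q) \<le> D * exp (- \<mu> * (q - r)) * norm h" if "0 \<le> r" "r \<le> q" for r q h
    using that by (rule flow_RK_le)
qed (use D \<mu> \<tau> st in auto)

text \<open>Before \<open>\<tau>\<close> the plant is free, and the energy growth is written as
  decay at rate \<open>\<mu>\<close> at the price of the factor
  \<open>exp ((Crc^2 + \<mu>) * \<tau>)\<close>. After \<open>\<tau>\<close> the bound of
  \<open>delayed_estimate\<close> holds; for \<open>s < \<tau> < t\<close> the two are composed at
  \<open>\<tau>\<close>, which accounts for the product with \<open>D\<close>.\<close>

lemma state_estimate:
  assumes sol: "closed_loop y0 yh0 y yh u" and st: "0 \<le> s" "s \<le> t"
    and N: "\<epsilon> \<ge> 0" "\<And>r. max 0 (s - \<tau>) \<le> r \<Longrightarrow> r \<le> t - \<tau> \<Longrightarrow> max 0 (s - \<tau>) < t - \<tau> \<Longrightarrow>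
      norm (err (yh0 - y0) r) \<le> \<epsilon>"
  shows "norm (y t) \<le> max 1 (D * exp ((Crc\<^sup>2 + \<mu>) * \<tau>)) * exp (- \<mu> * (t - s)) * norm (y s) +
    8 * (D / \<mu>) * (onorm BK * (exp (Crc\<^sup>2 * \<tau>) * \<epsilon>))"
proof -
  define E where "E = max 1 (D * exp ((Crc\<^sup>2 + \<mu>) * \<tau>))"
  define Q where "Q = 8 * (D / \<mu>) * (onorm BK * (exp (Crc\<^sup>2 * \<tau>) * \<epsilon>))"
  have Q: "Q \<ge> 0" using D \<mu> N(1) onorm_pos_le[OF linear_BK] by (simp add: Q_def)
  have x: "exp ((Crc\<^sup>2 + \<mu>) * \<tau>) \<ge> 1" using \<mu> \<tau> by (simp add: mult_nonneg_nonneg)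
  have "D \<le> D * exp ((Crc\<^sup>2 + \<mu>) * \<tau>)" "exp ((Crc\<^sup>2 + \<mu>) * \<tau>) \<le> D * exp ((Crc\<^sup>2 + \<mu>) * \<tau>)"
    using mult_left_mono[OF x, of D] mult_right_mono[OF D, of "exp ((Crc\<^sup>2 + \<mu>) * \<tau>)"] D by auto
  then have E1: "E \<ge> D" "E \<ge> exp ((Crc\<^sup>2 + \<mu>) * \<tau>)"
    unfolding E_def by (auto intro: max.coboundedI2)
  have free: "norm (y q) \<le> exp ((Crc\<^sup>2 + \<mu>) * \<tau>) * (exp (- \<mu> * (q - s)) * norm (y s))"
    if q: "s \<le> q" "q \<le> \<tau>" for q
  proof -
    have "norm (y q) \<le> exp (Crc\<^sup>2 * (q - s)) * norm (y s)"
      by (rule energy_free[OF closed_loopD(3)[OF sol] admissibleD(2)[OF Arc order_refl]]) (use st q in auto)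
    moreover have "exp (Crc\<^sup>2 * (q - s)) \<le> exp ((Crc\<^sup>2 + \<mu>) * \<tau>) * exp (- \<mu> * (q - s))"
    proof -
      have "(Crc\<^sup>2 + \<mu>) * (q - s) \<le> (Crc\<^sup>2 + \<mu>) * \<tau>"
        using q st \<mu> by (intro mult_left_mono) auto
      then show ?thesis unfolding exp_add[symmetric] exp_le_cancel_iff by (simp add: algebra_simps)
    qed
    ultimately show ?thesis
      using mult_right_mono[of "exp (Crc\<^sup>2 * (q - s))" _ "norm (y s)"] by (fastforce simp: mult.assoc)
  qed
  have "norm (y t) \<le> E * (exp (- \<mu> * (t - s)) * norm (y s)) + Q"
  proof (cases "t \<le> \<tau>")
    case True
    have "norm (y t) \<le> exp ((Crc\<^sup>2 + \<mu>) * \<tau>) * (exp (- \<mu> * (t - s)) * norm (y s))"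
      by (rule free) (use st True in auto)
    also have "\<dots> \<le> E * (exp (- \<mu> * (t - s)) * norm (y s))"
      using E1 by (intro mult_right_mono) auto
    finally show ?thesis using Q by linarith
  next
    case False
    then have t: "\<tau> < t" by simp
    show ?thesis
    proof (cases "\<tau> \<le> s")
      case True
      show ?thesis
      \<comment> \<open>For \<open>s = t\<close> the window of the error is degenerate and provides
        no bound; here the estimate holds because the constant is at least 1.\<close>
      proof (cases "s = t")
        case eq: True
        have "1 \<le> E" by (simp add: E_def)
        then have "1 * norm (y t) \<le> E * norm (y t)" by (intro mult_right_mono) auto
        then show ?thesis using eq Q by simp
      next
        case False
        have "norm (y t) \<le> D * exp (- \<mu> * (t - s)) * norm (y s) + Q"
          unfolding Q_def
        proof (rule delayed_estimate[OF sol True st(2)])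
          fix r assume "s - \<tau> \<le> r" "r \<le> t - \<tau>"
          then show "norm (err (yh0 - y0) r) \<le> \<epsilon>" using True False st by (intro N(2)) auto
        qed
        moreover have "D * (exp (- \<mu> * (t - s)) * norm (y s)) \<le> E * (exp (- \<mu> * (t - s)) * norm (y s))"
          using E1 by (intro mult_right_mono) auto
        ultimately show ?thesis unfolding mult.assoc[of D] by linarith
      qed
    next
      case False
      have "norm (y t) \<le> D * exp (- \<mu> * (t - \<tau>)) * norm (y \<tau>) + Q"
        unfolding Q_def by (rule delayed_estimate[OF sol order_refl]) (use False t in \<open>auto intro!: N(2)\<close>)
      moreover have "D * exp (- \<mu> * (t - \<tau>)) * norm (y \<tau>)
          \<le> D * exp (- \<mu> * (t - \<tau>)) * (exp ((Crc\<^sup>2 + \<mu>) * \<tau>) * (exp (- \<mu> * (\<tau> - s)) * norm (y s)))"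
        using D False by (intro mult_left_mono free) auto
      moreover have "D * exp (- \<mu> * (t - \<tau>)) * (exp ((Crc\<^sup>2 + \<mu>) * \<tau>) * (exp (- \<mu> * (\<tau> - s)) * norm (y s)))
          = D * exp ((Crc\<^sup>2 + \<mu>) * \<tau>) * (exp (- \<mu> * (t - s)) * norm (y s))"
      proof -
        have "exp (- \<mu> * (t - s)) = exp (- \<mu> * (t - \<tau>)) * exp (- \<mu> * (\<tau> - s))"
          unfolding exp_add[symmetric] by (simp add: algebra_simps)
        then show ?thesis by simp
      qed
      moreover have "D * exp ((Crc\<^sup>2 + \<mu>) * \<tau>) * (exp (- \<mu> * (t - s)) * norm (y s))
          \<le> E * (exp (- \<mu> * (t - s)) * norm (y s))"
        by (intro mult_right_mono) (auto simp: E_def)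
      ultimately show ?thesis by linarith
    qed
  qed
  then show ?thesis unfolding E_def Q_def by (simp only: mult.assoc)
qed

lemma continuous_closed_loop:
  assumes "closed_loop y0 yh0 y yh u" shows "continuous_on {0..} y" "continuous_on {0..} yh"
  using assms by (auto simp: closed_loop_solution_def weak_solution_def)

text \<open>The essential supremum is finite because (C,0)-stability bounds the estimation error, so
  it can serve as the real number \<open>\<epsilon>\<close> of
  \<open>state_estimate\<close>.\<close>

lemma state_estimate_Linf:
  assumes sol: "closed_loop y0 yh0 y yh u" and st: "0 \<le> s" "s \<le> t"
  shows "ennreal (norm (y t)) \<le>
    ennreal (max 1 (D * exp ((Crc\<^sup>2 + \<mu>) * \<tau>)) * exp (- \<mu> * (t - s)) * norm (y s)) +
    ennreal (8 * (D / \<mu>) * (onorm BK * exp (Crc\<^sup>2 * \<tau>))) *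
      Linf_norm {s - \<tau><..<t - \<tau>} (extend_by_zero (\<lambda>r. yh r - y r))"
proof -
  define e where "e = (\<lambda>r. yh r - y r)"
  define X where "X = Linf_norm {s - \<tau><..<t - \<tau>} (extend_by_zero e)"
  define \<epsilon> where "\<epsilon> = enn2real X"
  have err: "e r = err (yh0 - y0) r" if "0 \<le> r" for r
    using closed_loopD(1)[OF sol that] by (simp add: e_def)
  have ce: "continuous_on {0..} e"
    unfolding e_def by (intro continuous_on_diff continuous_closed_loop[OF sol])
  have "X \<le> ennreal (C * norm (yh0 - y0))"
    unfolding X_def using norm_err_le[of _ "yh0 - y0"] err C
    by (intro Linf_norm_bounded borel_measurable_extend_by_zero[OF ce]) (auto simp: extend_by_zero_def)
  then have XN: "X = ennreal \<epsilon>"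
    unfolding \<epsilon>_def by (intro ennreal_enn2real[symmetric]) (auto intro: le_less_trans)
  have N0: "\<epsilon> \<ge> 0" by (simp add: \<epsilon>_def)
  have "norm (err (yh0 - y0) r) \<le> \<epsilon>"
    if "max 0 (s - \<tau>) \<le> r" "r \<le> t - \<tau>" "max 0 (s - \<tau>) < t - \<tau>" for r
    using norm_le_Linf_norm[OF ce, of "s - \<tau>" "t - \<tau>" \<epsilon> r] that N0 err[of r] XN unfolding X_def by auto
  note est = state_estimate[OF sol st N0 this]
  define P where "P = max 1 (D * exp ((Crc\<^sup>2 + \<mu>) * \<tau>)) * exp (- \<mu> * (t - s)) * norm (y s)"
  define Q where "Q = 8 * (D / \<mu>) * (onorm BK * exp (Crc\<^sup>2 * \<tau>))"
  have P: "P \<ge> 0" unfolding P_def by (intro mult_nonneg_nonneg) auto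
  have Q: "Q \<ge> 0" unfolding Q_def using D \<mu> onorm_pos_le[OF linear_BK] by (intro mult_nonneg_nonneg) auto
  have "norm (y t) \<le> P + Q * \<epsilon>" using est unfolding P_def Q_def by (simp only: mult.assoc)
  then have "ennreal (norm (y t)) \<le> ennreal (P + Q * \<epsilon>)" by (rule ennreal_leI)
  also have "\<dots> = ennreal P + ennreal Q * X"
    using P Q N0 by (simp add: XN ennreal_plus ennreal_mult)
  finally show ?thesis unfolding P_def Q_def X_def e_def .
qed

text \<open>By the control law the input inherits continuity from the state and the prediction
  error. Boundedness follows from \<open>delayed_estimate\<close> with initial time
  \<open>\<tau>\<close> and the uniform bound on the estimation error.\<close>

lemma input_regularity:
  assumes sol: "closed_loop y0 yh0 y yh u"
  shows "continuous_on {0..} u" and "\<And>t. 0 \<le> t \<Longrightarrow> u t \<in> Rn m" and "Linf_Rn m {0..} u"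
proof -
  define h where "h = yh0 - y0"
  have u: "u t = control_law h y t" if "0 \<le> t" for t
    unfolding h_def using \<tau> that by (intro closed_loopD(2)[OF sol]) auto
  have ci: "continuous_on {0..} (\<lambda>t. u t i)" for i
    by (rule continuous_on_eq[OF continuous_control_law[OF continuous_closed_loop(1)[OF sol]]]) (simp add: u)
  then show "continuous_on {0..} u" by (rule continuous_on_coordinatewise_then_product)
  show "u t \<in> Rn m" if "0 \<le> t" for t
    using u[OF that] that bounded_linear_into_RnD(1)[OF K] by (simp add: control_law_def)
  have meas: "(\<lambda>t. u t i) \<in> borel_measurable (lebesgue_on {0..})" for i
    by (rule continuous_imp_measurable_on_sets_lebesgue[OF ci]) auto
  obtain M where M: "M \<ge> 0" "\<And>x. Rn_norm m (K x) \<le> M * norm x"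
    using bounded_linear_into_Rn_bound[OF K] by blast
  define \<epsilon> where "\<epsilon> = C * norm h"
  define G where "G = D * norm (y \<tau>) + 8 * (D / \<mu>) * (onorm BK * (exp (Crc\<^sup>2 * \<tau>) * \<epsilon>)) + exp (Crc\<^sup>2 * \<tau>) * \<epsilon>"
  have "Linf_norm {0..} (\<lambda>t. Rn_norm m (u t)) \<le> ennreal (M * G)"
  proof (rule Linf_norm_bounded)
    show "(\<lambda>t. Rn_norm m (u t)) \<in> borel_measurable (lebesgue_on {0..})"
      unfolding Rn_norm_def L2_set_def using meas by measurable
    fix t :: real assume "t \<in> {0..}"
    then have t: "0 \<le> t" by simp
    have "norm (y (t + \<tau>)) \<le> D * exp (- \<mu> * (t + \<tau> - \<tau>)) * norm (y \<tau>) + 8 * (D / \<mu>) * (onorm BK * (exp (Crc\<^sup>2 * \<tau>) * \<epsilon>))"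
      by (rule delayed_estimate[OF sol order_refl]) (use t norm_err_le in \<open>auto simp: \<epsilon>_def h_def\<close>)
    moreover have "D * exp (- \<mu> * (t + \<tau> - \<tau>)) * norm (y \<tau>) \<le> D * 1 * norm (y \<tau>)"
      using D \<mu> t by (intro mult_right_mono mult_left_mono) auto
    moreover have "norm (pred_err h t) \<le> exp (Crc\<^sup>2 * \<tau>) * \<epsilon>"
      by (rule order_trans[OF norm_pred_err_le[OF t]]) (simp add: \<epsilon>_def norm_err_le[OF t])
    ultimately have "norm (y (t + \<tau>) + pred_err h t) \<le> G"
      using norm_triangle_ineq[of "y (t + \<tau>)" "pred_err h t"] unfolding G_def by linarith
    then have "M * norm (y (t + \<tau>) + pred_err h t) \<le> M * G" using M(1) by (rule mult_left_mono)
    then show "norm (Rn_norm m (u t)) \<le> M * G"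
      using M(2)[of "y (t + \<tau>) + pred_err h t"] t by (simp add: u control_law_def Rn_norm_nonneg)
  qed
  then show "Linf_Rn m {0..} u"
    unfolding Linf_Rn_def using meas by (auto intro: le_less_trans)
qed

end

theorem theorem4p2:
  fixes j :: "'v::{real_inner,banach,second_countable_topology}
                \<Rightarrow>\<^sub>L 'h::{real_inner,banach,second_countable_topology}"
    and A :: "'v \<Rightarrow>\<^sub>L ('v \<Rightarrow>\<^sub>L real)"
  assumes "dense_compact_inclusion j"
    and "scalar_product_operator A"
  shows "\<exists>C1 C2 :: real \<Rightarrow> real \<Rightarrow> real \<Rightarrow> real \<Rightarrow> real.
    (\<forall>a b c d. C1 a b c d \<ge> 1 \<and> C2 a b c d \<ge> 0) \<and>
    (\<forall>(Arc :: real \<Rightarrow> ('v \<Rightarrow>\<^sub>L ('v \<Rightarrow>\<^sub>L real))) (Crc :: real) (m :: nat) (n :: nat)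
       (\<Phi> :: nat \<Rightarrow> 'h) (B :: (nat \<Rightarrow> real) \<Rightarrow> 'h) (W :: 'h \<Rightarrow> (nat \<Rightarrow> real))
       (K :: 'h \<Rightarrow> (nat \<Rightarrow> real)) (L :: (nat \<Rightarrow> real) \<Rightarrow> 'h)
       (D1 :: real) (\<mu>1 :: real) (C :: real) (\<tau> :: real).
      continuous_bounded_in_sum j Arc \<and> Crc = sup_sum_norm j Arc \<and>
      B = control_operator m \<Phi> \<and>
      bounded_linear_into_Rn n W \<and>
      bounded_linear_into_Rn m K \<and>
      bounded_linear_from_Rn n L \<and>
      D1 \<ge> 1 \<and> \<mu>1 > 0 \<and> exp_stable j (dynamics j A Arc (\<lambda>t x. B (K x))) D1 \<mu>1 \<and>
      C \<ge> 1 \<and> exp_stable j (dynamics j A Arc (\<lambda>t x. L (W x))) C 0 \<and>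
      \<tau> > 0 \<longrightarrow>
      (\<forall>y0 yh0.
        (\<exists>y yh u. closed_loop_solution j A Arc m B W K L \<tau> y0 yh0 y yh u) \<and>
        (\<forall>y yh u y' yh' u'.
          closed_loop_solution j A Arc m B W K L \<tau> y0 yh0 y yh u \<and>
          closed_loop_solution j A Arc m B W K L \<tau> y0 yh0 y' yh' u' \<longrightarrow>
          (\<forall>t\<ge>0. y t = y' t \<and> yh t = yh' t) \<and> (\<forall>t\<ge>-\<tau>. u t = u' t)) \<and>
        (\<forall>y yh u. closed_loop_solution j A Arc m B W K L \<tau> y0 yh0 y yh u \<longrightarrow>
          (\<forall>t s. t \<ge> s \<and> s \<ge> 0 \<longrightarrow>
            ennreal (norm (y t)) \<le>
              ennreal (C1 D1 Crc \<tau> \<mu>1 * exp (- \<mu>1 * (t - s)) * norm (y s)) +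
              ennreal (C2 Crc \<tau> (D1 / \<mu>1) (onorm (\<lambda>x. B (K x)))) *
                Linf_norm {s - \<tau><..<t - \<tau>} (extend_by_zero (\<lambda>r. yh r - y r))) \<and>
          Linf_Rn m {0..} u \<and> continuous_on {0..} u \<and> (\<forall>t\<ge>0. u t \<in> Rn m))))"
proof -
  interpret pivot_space j A
    using assms by unfold_locales (auto simp: dense_compact_inclusion_def scalar_product_operator_def)
  \<comment> \<open>The constants of \<open>state_estimate_Linf\<close> as functions of the
    permitted parameters alone. The maximum with 1 and the absolute values secure the required signs
    for all real arguments; on actual parameters the absolute values change nothing.\<close>
  define C1 where "C1 = (\<lambda>a b c d :: real. max 1 (a * exp ((b\<^sup>2 + d) * c)))"
  define C2 where "C2 = (\<lambda>a b c d :: real. 8 * \<bar>c\<bar> * (\<bar>d\<bar> * exp (a\<^sup>2 * b)))"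
  show ?thesis
  proof (rule exI[of _ C1], rule exI[of _ C2], rule conjI, goal_cases)
    case 1
    show ?case by (simp add: C1_def C2_def)
  next
    case 2
    show ?case
    proof (intro allI impI, goal_cases)
      case (1 Arc Crc m n \<Phi> B W K L D1 \<mu>1 C \<tau> y0 yh0)
      then have B: "B = control_operator m \<Phi>" by blast
      interpret predictor_loop j A Arc Crc m n \<Phi> W K L D1 \<mu>1 C \<tau>
        using 1 admissible_if_continuous_bounded_in_sum[of Arc] by unfold_locales auto
      have C2: "C2 Crc \<tau> (D1 / \<mu>1) (onorm BK) = 8 * (D1 / \<mu>1) * (onorm BK * exp (Crc\<^sup>2 * \<tau>))"
        using D \<mu> onorm_pos_le[OF linear_BK] by (simp add: C2_def)
      show ?case
        unfolding B C1_def C2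
      proof (intro conjI allI impI; (elim conjE)?)
        show "\<exists>y yh u. closed_loop y0 yh0 y yh u" by (rule closed_loop_exists)
      qed (rule state_estimate_Linf input_regularity closed_loop_unique(2)
          closed_loop_unique(1)[THEN conjunct1] closed_loop_unique(1)[THEN conjunct2]; assumption)+
    qed
  qed
qed

end
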